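(* Let $\mathcal{H}$ be a Hilbert space and let $u$ be a free holomorphic function on $[B(\mathcal{H})^n]_1$. (i) There exists $f\in F_n^\infty$ with $u=P[f]$ if and only if $\sup_{0\le r<1}\|u(rS_1,\ldots,rS_n)\|<\infty$. In this case, $u(rS_1,\ldots,rS_n)\to f$, as $r\to1$, in the $w^*$-topology (or strong operator topology). (ii) There exists $f\in\mathcal{A}_n$ with $u=P[f]$ if and only if $\{u(rS_1,\ldots,rS_n)\}_{0\le r<1}$ is convergent in norm, as $r\to1$. In this case, $u(rS_1,\ldots,rS_n)\to f$ in the operator norm, as $r\to1$.
   Context: $\mathbb{F}_n^+$ is the unital free semigroup on generators $g_1,\ldots,g_n$ with identity $g_0$; $|\alpha|$ is word length; $X_\alpha:=X_{i_1}\cdots X_{i_k}$ if $\alpha=g_{i_1}\cdots g_{i_k}$, $X_{g_0}:=I$. $[B(\mathcal{H})^n]_1$ is the set of $[X_1,\ldots,X_n]\in B(\mathcal{H})^n$ with $\|\sum_iX_iX_i^*\|^{1/2}<1$. A free holomorphic function on $[B(\mathcal{H})^n]_1$ (here with scalar coefficients) is a function of the form $u(X_1,\ldots,X_n)=\sum_{k=0}^\infty\sum_{|\alpha|=k}a_\alpha X_\alpha$, where $a_\alpha\in\mathbb{C}$ and $\limsup_{k\to\infty}(\sum_{|\alpha|=k}|a_\alpha|^2)^{1/2k}\le1$; the series converges in operator norm. For $0\le r<1$, $u(rS_1,\ldots,rS_n):=\sum_{k=0}^\infty\sum_{|\alpha|=k}r^ka_\alpha S_\alpha$ (norm convergent),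 computed from the power series representing $u$. $F^2(H_n)=\mathbb{C}1\oplus\bigoplus_{m\ge1}H_n^{\otimes m}$ is the full Fock space, $H_n$ an $n$-dimensional complex Hilbert space with orthonormal basis $e_1,\ldots,e_n$; $e_\alpha:=e_{i_1}\otimes\cdots\otimes e_{i_k}$ if $\alpha=g_{i_1}\cdots g_{i_k}$, $e_{g_0}:=1$; $S_i\xi:=e_i\otimes\xi$ are the left creation operators. $F_n^\infty$ is the set of $f=\sum a_\alpha e_\alpha\in F^2(H_n)$ for which left multiplication $L_f:g\mapsto f\otimes g$ (noncommutative Cauchy product, $e_\alpha\otimes e_\beta=e_{\alpha\beta}$) is a bounded operator on $F^2(H_n)$; $f$ is identified with $L_f\in B(F^2(H_n))$. $\mathcal{A}_n\subset F_n^\infty$ is the norm closed algebra generated by $S_1,\ldots,S_n$ and the identity. Noncommutative Poisson transform: for $X=[X_1,\ldots,X_n]\in[B(\mathcal{H})^n]_1$ let $\Delta_X:=(I-\sum_iX_iX_i^* )^{1/2}$ and $K_X:\mathcal{H}\to F^2(H_n)\otimes\mathcal{H}$, $K_Xh:=\sum_{\alpha\in\mathbb{F}_n^+}e_\alpha\otimes\Delta_XX_\alpha^*h$. For $A\in B(F^2(H_n))$, the function $P[A]:[B(\mathcal{H})^n]_1\to B(\mathcal{H})$ is $P[A](X):=K_X^*(A\otimes I_{\mathcal{H}})K_X$; for $f\in F_n^\infty$, $P[f]:=P[L_f]$.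
   Formalization: H is assumed infinite-dimensional, or n = 1 and H nonzero; otherwise u does not determine its power series, so u(rS_1,…,rS_n) is ill-defined (for H = C, n = 2, the zero function is also Σ(k+1)(X_1^k X_2 − X_2 X_1^k), whose radial norms are unbounded). *)

theory Defs
  imports "HOL-Analysis.Analysis"
begin

section \<open>Complex Hilbert spaces\<close>

class scaleC =
  fixes scaleC :: "complex \<Rightarrow> 'a \<Rightarrow> 'a"  (infixr "*\<^sub>C" 75)

class complex_normed_vector = real_normed_vector + scaleC +
  assumes scaleR_scaleC: "r *\<^sub>R x = complex_of_real r *\<^sub>C x"
    and scaleC_add_right: "c *\<^sub>C (x + y) = c *\<^sub>C x + c *\<^sub>C y"
    and scaleC_add_left: "(c + d) *\<^sub>C x = c *\<^sub>C x + d *\<^sub>C x"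
    and scaleC_scaleC: "c *\<^sub>C d *\<^sub>C x = (c * d) *\<^sub>C x"
    and norm_scaleC: "norm (c *\<^sub>C x) = cmod c * norm x"

text \<open>The inner product is linear in the first argument.\<close>

class complex_hilbert_space = complex_normed_vector + complete_space +
  fixes cinner :: "'a \<Rightarrow> 'a \<Rightarrow> complex"
  assumes cinner_commute: "cinner x y = cnj (cinner y x)"
    and cinner_add_left: "cinner (x + y) z = cinner x z + cinner y z"
    and cinner_scaleC_left: "cinner (c *\<^sub>C x) y = c * cinner x y"
    and cinner_self: "cinner x x = complex_of_real ((norm x)\<^sup>2)"

instantiation complex :: complex_hilbert_space
begin

definition scaleC_complex :: "complex \<Rightarrow> complex \<Rightarrow> complex" where
  "scaleC_complex c x = c * x"

definition cinner_complex :: "complex \<Rightarrow> complex \<Rightarrow> complex" where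
  "cinner_complex x y = x * cnj y"

instance
proof
  fix x y z c d :: complex and r :: real
  show "r *\<^sub>R x = complex_of_real r *\<^sub>C x"
    by (simp add: scaleC_complex_def scaleR_conv_of_real)
  show "norm (c *\<^sub>C x) = cmod c * norm x" by (simp add: scaleC_complex_def norm_mult)
  show "cinner x x = complex_of_real ((norm x)\<^sup>2)"
    unfolding cinner_complex_def by (rule complex_norm_square[symmetric])
qed (simp_all add: scaleC_complex_def cinner_complex_def algebra_simps)

end

lemma cinner_add_right:
  "cinner (x::'a::complex_hilbert_space) (y + z) = cinner x y + cinner x z"
  by (metis cinner_add_left cinner_commute complex_cnj_add)

lemma cinner_scaleC_right:
  "cinner (x::'a::complex_hilbert_space) (c *\<^sub>C y) = cnj c * cinner x y"
  by (metis cinner_scaleC_left cinner_commute complex_cnj_mult)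

lemma norm_cinner_le:
  fixes x y :: "'a::complex_hilbert_space"
  shows "cmod (cinner x y) \<le> (norm x)\<^sup>2 + (norm y)\<^sup>2"
proof -
  define c where "c = - cis (Arg (cinner x y))"
  have c: "cmod c = 1" by (simp add: c_def)
  have z: "cinner x y = complex_of_real (cmod (cinner x y)) * cis (Arg (cinner x y))"
    by (metis rcis_cmod_Arg rcis_def)
  have "cnj c * cinner x y
      = - (complex_of_real (cmod (cinner x y)) * (cis (Arg (cinner x y)) * cnj (cis (Arg (cinner x y)))))"
    unfolding c_def by (subst (2) z) simp
  also have "cis (Arg (cinner x y)) * cnj (cis (Arg (cinner x y))) = 1"
    by (simp add: cis_cnj cis_mult)
  finally have 1: "cnj c * cinner x y = - complex_of_real (cmod (cinner x y))" by simp
  have 2: "c * cinner y x = - complex_of_real (cmod (cinner x y))"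
    using arg_cong[OF 1, of cnj] by (simp add: cinner_commute[of y x])
  have "complex_of_real ((norm (x + c *\<^sub>C y))\<^sup>2) = cinner (x + c *\<^sub>C y) (x + c *\<^sub>C y)"
    by (simp only: cinner_self)
  also have "\<dots> = cinner x x + cnj c * cinner x y + c * cinner y x + c * cnj c * cinner y y"
    by (simp add: cinner_add_left cinner_add_right cinner_scaleC_left cinner_scaleC_right
        algebra_simps)
  also have "c * cnj c = 1" using c by (simp add: complex_norm_square[symmetric])
  also have "cinner x x + cnj c * cinner x y + c * cinner y x + 1 * cinner y y
      = complex_of_real ((norm x)\<^sup>2 - 2 * cmod (cinner x y) + (norm y)\<^sup>2)"
    unfolding 1 2 cinner_self by simp
  finally have "(norm (x + c *\<^sub>C y))\<^sup>2 = (norm x)\<^sup>2 - 2 * cmod (cinner x y) + (norm y)\<^sup>2"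
    by (simp only: of_real_eq_iff)
  then have "2 * cmod (cinner x y) \<le> (norm x)\<^sup>2 + (norm y)\<^sup>2"
    using zero_le_power2[of "norm (x + c *\<^sub>C y)"] by linarith
  then show ?thesis using norm_ge_zero[of "cinner x y"] by linarith
qed


section \<open>Square-summable families\<close>

text \<open>
  The type \<open>('i, 'h) ell2\<close> is the Hilbert space of square-summable families indexed by
  \<open>'i\<close> with values in \<open>'h\<close>, that is, the Hilbert space tensor product of
  \<open>('i, complex) ell2\<close> and \<open>'h\<close>.
\<close>

typedef (overloaded) ('i, 'h) ell2 =
  "{f :: 'i \<Rightarrow> 'h::complex_hilbert_space. (\<lambda>i. (norm (f i))\<^sup>2) summable_on UNIV}"
  morphisms coord Abs_ell2
  by (rule exI[of _ "\<lambda>_. 0"]) simp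

setup_lifting type_definition_ell2

lemma summable_iff_L2:
  "(\<lambda>i. (norm (f i))\<^sup>2) summable_on UNIV \<longleftrightarrow> (\<exists>C. \<forall>F. finite F \<longrightarrow> L2_set (\<lambda>i. norm (f i)) F \<le> C)"
proof
  assume "(\<lambda>i. (norm (f i))\<^sup>2) summable_on UNIV"
  then have "L2_set (\<lambda>i. norm (f i)) F \<le> sqrt (\<Sum>\<^sub>\<infinity>i. (norm (f i))\<^sup>2)" if "finite F" for F
    unfolding L2_set_def using that
    by (intro real_sqrt_le_mono finite_sum_le_infsum) auto
  then show "\<exists>C. \<forall>F. finite F \<longrightarrow> L2_set (\<lambda>i. norm (f i)) F \<le> C" by blast
next
  assume "\<exists>C. \<forall>F. finite F \<longrightarrow> L2_set (\<lambda>i. norm (f i)) F \<le> C"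
  then obtain C where C: "\<And>F. finite F \<Longrightarrow> L2_set (\<lambda>i. norm (f i)) F \<le> C" by blast
  have "(\<Sum>i\<in>F. (norm (f i))\<^sup>2) \<le> C\<^sup>2" if "finite F" for F
  proof -
    have "(L2_set (\<lambda>i. norm (f i)) F)\<^sup>2 \<le> C\<^sup>2"
      using C[OF that] by (intro power_mono) auto
    then show ?thesis by (simp add: L2_set_def sum_nonneg)
  qed
  then show "(\<lambda>i. (norm (f i))\<^sup>2) summable_on UNIV"
    by (intro nonneg_bounded_partial_sums_imp_summable_on[where C = "C\<^sup>2"])
      (auto simp: eventually_finite_subsets_at_top)
qed

lemma L2_set_norm_add:
  "L2_set (\<lambda>i. norm (f i + g i)) F \<le> L2_set (\<lambda>i. norm (f i)) F + L2_set (\<lambda>i. norm (g i)) F"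
proof -
  have "L2_set (\<lambda>i. norm (f i + g i)) F \<le> L2_set (\<lambda>i. norm (f i) + norm (g i)) F"
    by (intro L2_set_mono norm_triangle_ineq) auto
  then show ?thesis by (rule order_trans[OF _ L2_set_triangle_ineq])
qed

lemma summable_add_L2:
  assumes "(\<lambda>i. (norm (f i))\<^sup>2) summable_on UNIV" "(\<lambda>i. (norm (g i))\<^sup>2) summable_on UNIV"
  shows "(\<lambda>i. (norm (f i + g i))\<^sup>2) summable_on UNIV"
proof -
  obtain C D where "\<And>F. finite F \<Longrightarrow> L2_set (\<lambda>i. norm (f i)) F \<le> C"
    "\<And>F. finite F \<Longrightarrow> L2_set (\<lambda>i. norm (g i)) F \<le> D"
    using assms unfolding summable_iff_L2 by blast
  then have "L2_set (\<lambda>i. norm (f i + g i)) F \<le> C + D" if "finite F" for F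
    using L2_set_norm_add[of f g F] that by (meson add_mono order_trans)
  then show ?thesis unfolding summable_iff_L2 by blast
qed

lemma summable_scaleC_L2:
  assumes "(\<lambda>i. (norm (f i))\<^sup>2) summable_on UNIV"
  shows "(\<lambda>i. (norm (c *\<^sub>C (f i :: 'h::complex_normed_vector)))\<^sup>2) summable_on UNIV"
  using summable_on_cmult_right[OF assms, of "(cmod c)\<^sup>2"]
  by (simp add: norm_scaleC power_mult_distrib)

instantiation ell2 :: (type, complex_hilbert_space) complex_normed_vector
begin

lift_definition zero_ell2 :: "('a, 'b) ell2" is "\<lambda>_. 0" by simp
lift_definition plus_ell2 :: "('a, 'b) ell2 \<Rightarrow> ('a, 'b) ell2 \<Rightarrow> ('a, 'b) ell2"
  is "\<lambda>f g i. f i + g i" by (rule summable_add_L2)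
lift_definition scaleC_ell2 :: "complex \<Rightarrow> ('a, 'b) ell2 \<Rightarrow> ('a, 'b) ell2"
  is "\<lambda>c f i. c *\<^sub>C f i" by (rule summable_scaleC_L2)
lift_definition scaleR_ell2 :: "real \<Rightarrow> ('a, 'b) ell2 \<Rightarrow> ('a, 'b) ell2"
  is "\<lambda>c f i. c *\<^sub>R f i" unfolding scaleR_scaleC by (rule summable_scaleC_L2)
lift_definition uminus_ell2 :: "('a, 'b) ell2 \<Rightarrow> ('a, 'b) ell2"
  is "\<lambda>f i. - f i" by simp
lift_definition minus_ell2 :: "('a, 'b) ell2 \<Rightarrow> ('a, 'b) ell2 \<Rightarrow> ('a, 'b) ell2"
  is "\<lambda>f g i. f i - g i"
proof -
  fix f g :: "'a \<Rightarrow> 'b"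
  assume "(\<lambda>i. (norm (f i))\<^sup>2) summable_on UNIV" "(\<lambda>i. (norm (g i))\<^sup>2) summable_on UNIV"
  then show "(\<lambda>i. (norm (f i - g i))\<^sup>2) summable_on UNIV"
    using summable_add_L2[of f "\<lambda>i. - g i"] by simp
qed

lift_definition norm_ell2 :: "('a, 'b) ell2 \<Rightarrow> real"
  is "\<lambda>f. sqrt (\<Sum>\<^sub>\<infinity>i. (norm (f i))\<^sup>2)" .

definition dist_ell2 :: "('a, 'b) ell2 \<Rightarrow> ('a, 'b) ell2 \<Rightarrow> real" where
  "dist_ell2 x y = norm (x - y)"
definition sgn_ell2 :: "('a, 'b) ell2 \<Rightarrow> ('a, 'b) ell2" where
  "sgn_ell2 x = scaleR (inverse (norm x)) x"
definition uniformity_ell2 :: "(('a, 'b) ell2 \<times> ('a, 'b) ell2) filter" where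
  "uniformity_ell2 = (INF e\<in>{0<..}. principal {(x, y). dist x y < e})"
definition open_ell2 :: "('a, 'b) ell2 set \<Rightarrow> bool" where
  "open_ell2 U = (\<forall>x\<in>U. \<forall>\<^sub>F (x', y) in uniformity. x' = x \<longrightarrow> y \<in> U)"

lemma summable_coord: "(\<lambda>i. (norm (coord x i))\<^sup>2) summable_on UNIV"
  using coord[of x] by simp

lemma L2_le_norm_ell2: "finite F \<Longrightarrow> L2_set (\<lambda>i. norm (coord x i)) F \<le> norm x"
  unfolding norm_ell2.rep_eq L2_set_def
  by (intro real_sqrt_le_mono finite_sum_le_infsum summable_coord) auto

lemma norm_ell2_le:
  assumes "\<And>F. finite F \<Longrightarrow> L2_set (\<lambda>i. norm (coord x i)) F \<le> C"
  shows "norm x \<le> C"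
proof -
  have "0 \<le> C" using assms[of "{}"] by simp
  have "(\<Sum>i\<in>F. (norm (coord x i))\<^sup>2) \<le> C\<^sup>2" if "finite F" for F
  proof -
    have "(L2_set (\<lambda>i. norm (coord x i)) F)\<^sup>2 \<le> C\<^sup>2"
      using assms[OF that] by (intro power_mono) auto
    then show ?thesis by (simp add: L2_set_def sum_nonneg)
  qed
  then have "(\<Sum>\<^sub>\<infinity>i. (norm (coord x i))\<^sup>2) \<le> C\<^sup>2"
    by (intro infsum_le_finite_sums summable_coord) auto
  then have "norm x \<le> sqrt (C\<^sup>2)" unfolding norm_ell2.rep_eq by (rule real_sqrt_le_mono)
  then show ?thesis using \<open>0 \<le> C\<close> by simp
qed

lemma norm_coord_le: "norm (coord x i) \<le> norm x"
  using L2_le_norm_ell2[of "{i}" x] by (simp add: L2_set_def)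

instance
proof
  fix x y z :: "('a, 'b) ell2" and r s :: real and c d :: complex
  show "x + y + z = x + (y + z)" by transfer (simp add: add.assoc)
  show "x + y = y + x" by transfer (simp add: add.commute)
  show "0 + x = x" by transfer simp
  show "- x + x = 0" by transfer simp
  show "x - y = x + - y" by transfer simp
  show "r *\<^sub>R (x + y) = r *\<^sub>R x + r *\<^sub>R y" by transfer (simp add: scaleR_add_right)
  show "(r + s) *\<^sub>R x = r *\<^sub>R x + s *\<^sub>R x" by transfer (simp add: scaleR_add_left)
  show "r *\<^sub>R s *\<^sub>R x = (r * s) *\<^sub>R x" by transfer simp
  show "1 *\<^sub>R x = x" by transfer simp
  show "dist x y = norm (x - y)" by (rule dist_ell2_def)
  show "sgn x = inverse (norm x) *\<^sub>R x" by (rule sgn_ell2_def)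
  show "(uniformity :: (('a, 'b) ell2 \<times> ('a, 'b) ell2) filter)
      = (INF e\<in>{0<..}. principal {(x, y). dist x y < e})"
    by (rule uniformity_ell2_def)
  show "open U = (\<forall>x\<in>U. \<forall>\<^sub>F (x', y) in uniformity. x' = x \<longrightarrow> y \<in> U)"
    for U :: "('a, 'b) ell2 set"
    by (rule open_ell2_def)
  show "norm x = 0 \<longleftrightarrow> x = 0"
  proof
    assume "norm x = 0"
    then have "coord x i = 0" for i using norm_coord_le[of x i] by simp
    then show "x = 0" by transfer auto
  next
    assume "x = 0"
    then show "norm x = 0" by (simp add: norm_ell2.rep_eq zero_ell2.rep_eq)
  qed
  show "norm (x + y) \<le> norm x + norm y"
  proof (rule norm_ell2_le)
    fix F :: "'a set" assume F: "finite F"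
    show "L2_set (\<lambda>i. norm (coord (x + y) i)) F \<le> norm x + norm y"
      using L2_set_norm_add[of "coord x" "coord y" F] L2_le_norm_ell2[OF F, of x]
        L2_le_norm_ell2[OF F, of y]
      by (simp add: plus_ell2.rep_eq)
  qed
  have nC: "norm (c *\<^sub>C x) = cmod c * norm x" for c
    by transfer (simp add: norm_scaleC power_mult_distrib infsum_cmult_right' real_sqrt_mult)
  have RC: "r *\<^sub>R x = complex_of_real r *\<^sub>C x" for r
    by transfer (simp add: scaleR_scaleC)
  show "norm (r *\<^sub>R x) = \<bar>r\<bar> * norm x" by (simp add: RC nC)
  show "r *\<^sub>R x = complex_of_real r *\<^sub>C x" by (rule RC)
  show "norm (c *\<^sub>C x) = cmod c * norm x" by (rule nC)
  show "c *\<^sub>C (x + y) = c *\<^sub>C x + c *\<^sub>C y" by transfer (simp add: scaleC_add_right)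
  show "(c + d) *\<^sub>C x = c *\<^sub>C x + d *\<^sub>C x" by transfer (simp add: scaleC_add_left)
  show "c *\<^sub>C d *\<^sub>C x = (c * d) *\<^sub>C x" by transfer (simp add: scaleC_scaleC)
qed

end

instantiation ell2 :: (type, complex_hilbert_space) complex_hilbert_space
begin

lift_definition cinner_ell2 :: "('a, 'b) ell2 \<Rightarrow> ('a, 'b) ell2 \<Rightarrow> complex"
  is "\<lambda>f g. \<Sum>\<^sub>\<infinity>i. cinner (f i) (g i)" .

lemma summable_cinner: "(\<lambda>i. cinner (coord x i) (coord y i)) summable_on UNIV"
proof -
  have "(\<lambda>i. (norm (coord x i))\<^sup>2 + (norm (coord y i))\<^sup>2) summable_on UNIV"
    by (intro summable_on_add summable_coord)
  then have "(\<lambda>i. cmod (cinner (coord x i) (coord y i))) summable_on UNIV"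
    by (rule summable_on_comparison_test) (auto intro: norm_cinner_le)
  then show ?thesis by (rule abs_summable_summable)
qed

instance
proof
  fix x y z :: "('a, 'b) ell2" and c :: complex
  show "cinner x y = cnj (cinner y x)"
    unfolding cinner_ell2.rep_eq infsum_cnj[symmetric]
    by (intro infsum_cong) (rule cinner_commute)
  show "cinner (x + y) z = cinner x z + cinner y z"
    by (simp add: cinner_ell2.rep_eq plus_ell2.rep_eq cinner_add_left infsum_add summable_cinner)
  show "cinner (c *\<^sub>C x) y = c * cinner x y"
    by (simp add: cinner_ell2.rep_eq scaleC_ell2.rep_eq cinner_scaleC_left infsum_cmult_right')
  have "((\<lambda>i. (norm (coord x i))\<^sup>2) has_sum (norm x)\<^sup>2) UNIV"
    using has_sum_infsum[OF summable_coord[of x]]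
    by (simp add: norm_ell2.rep_eq infsum_nonneg)
  then have "((\<lambda>i. complex_of_real ((norm (coord x i))\<^sup>2)) has_sum complex_of_real ((norm x)\<^sup>2)) UNIV"
    by (rule has_sum_of_real)
  then have "((\<lambda>i. cinner (coord x i) (coord x i)) has_sum complex_of_real ((norm x)\<^sup>2)) UNIV"
    by (simp only: cinner_self)
  then show "cinner x x = complex_of_real ((norm x)\<^sup>2)"
    unfolding cinner_ell2.rep_eq by (rule infsumI)
next
  fix X :: "nat \<Rightarrow> ('a, 'b) ell2" assume X: "Cauchy X"
  have "Cauchy (\<lambda>n. coord (X n) i)" for i
  proof (rule CauchyI)
    fix e :: real assume "0 < e"
    then obtain M where M: "\<And>m n. m \<ge> M \<Longrightarrow> n \<ge> M \<Longrightarrow> norm (X m - X n) < e"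
      using CauchyD[OF X] by blast
    have "norm (coord (X m) i - coord (X n) i) < e" if "m \<ge> M" "n \<ge> M" for m n
      using norm_coord_le[of "X m - X n" i] M[OF that] by (simp add: minus_ell2.rep_eq)
    then show "\<exists>M. \<forall>m\<ge>M. \<forall>n\<ge>M. norm (coord (X m) i - coord (X n) i) < e" by blast
  qed
  then have l: "(\<lambda>n. coord (X n) i) \<longlonglongrightarrow> lim (\<lambda>n. coord (X n) i)" for i
    by (simp add: Cauchy_convergent convergent_LIMSEQ_iff[symmetric])
  define l where "l i = lim (\<lambda>n. coord (X n) i)" for i
  note l = l[folded l_def]
  have bd: "\<exists>M. \<forall>n\<ge>M. \<forall>F. finite F \<longrightarrow> L2_set (\<lambda>i. norm (l i - coord (X n) i)) F \<le> e"
    if e: "0 < e" for e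
  proof -
    obtain M where M: "\<And>m n. m \<ge> M \<Longrightarrow> n \<ge> M \<Longrightarrow> norm (X m - X n) < e"
      using CauchyD[OF X e] by blast
    have "L2_set (\<lambda>i. norm (l i - coord (X n) i)) F \<le> e" if n: "n \<ge> M" and F: "finite F" for n F
    proof (rule LIMSEQ_le_const2)
      show "(\<lambda>m. L2_set (\<lambda>i. norm (coord (X m) i - coord (X n) i)) F)
          \<longlonglongrightarrow> L2_set (\<lambda>i. norm (l i - coord (X n) i)) F"
        unfolding L2_set_def by (intro tendsto_intros l)
      have "L2_set (\<lambda>i. norm (coord (X m) i - coord (X n) i)) F \<le> e" if "m \<ge> M" for m
        using L2_le_norm_ell2[OF F, of "X m - X n"] M[OF that n] by (simp add: minus_ell2.rep_eq)
      then show "\<exists>N. \<forall>m\<ge>N. L2_set (\<lambda>i. norm (coord (X m) i - coord (X n) i)) F \<le> e" by blast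
    qed
    then show ?thesis by blast
  qed
  obtain M where "\<forall>n\<ge>M. \<forall>F. finite F \<longrightarrow> L2_set (\<lambda>i. norm (l i - coord (X n) i)) F \<le> 1"
    using bd[of 1] by auto
  then have "(\<lambda>i. (norm (l i - coord (X M) i))\<^sup>2) summable_on UNIV"
    unfolding summable_iff_L2 by blast
  from summable_add_L2[OF this summable_coord[of "X M"]]
  have "(\<lambda>i. (norm (l i))\<^sup>2) summable_on UNIV" by simp
  then obtain L where L: "coord L = l" using Abs_ell2_inverse by blast
  have "X \<longlonglongrightarrow> L"
  proof (rule LIMSEQ_I)
    fix e :: real assume "0 < e"
    then obtain M where
      M: "\<And>n F. n \<ge> M \<Longrightarrow> finite F \<Longrightarrow> L2_set (\<lambda>i. norm (l i - coord (X n) i)) F \<le> e / 2"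
      using bd[of "e / 2"] by auto
    have "norm (X n - L) < e" if "n \<ge> M" for n
    proof -
      have "norm (L - X n) \<le> e / 2"
        using M[OF that] by (intro norm_ell2_le) (simp only: minus_ell2.rep_eq L)
      then show ?thesis using \<open>0 < e\<close> by (simp add: norm_minus_commute)
    qed
    then show "\<exists>no. \<forall>n\<ge>no. norm (X n - L) < e" by blast
  qed
  then show "convergent X" unfolding convergent_def by blast
qed

end

lift_definition ket :: "'i \<Rightarrow> ('i, complex) ell2" is "\<lambda>i j. if j = i then 1 else 0"
proof -
  fix i :: 'i
  have "(\<lambda>j. (cmod (if j = i then 1 else 0))\<^sup>2) summable_on {i}" by simp
  then show "(\<lambda>j. (cmod (if j = i then 1 else 0))\<^sup>2) summable_on UNIV"
    by (rule summable_on_cong_neutral[THEN iffD1, rotated -1]) auto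
qed

lift_definition tensor :: "('i, complex) ell2 \<Rightarrow> 'h \<Rightarrow> ('i, 'h::complex_hilbert_space) ell2"
  is "\<lambda>\<xi> h i. \<xi> i *\<^sub>C h"
proof -
  fix \<xi> :: "'i \<Rightarrow> complex" and h :: 'h
  assume "(\<lambda>i. (cmod (\<xi> i))\<^sup>2) summable_on UNIV"
  from summable_on_cmult_left[OF this, of "(norm h)\<^sup>2"]
  show "(\<lambda>i. (norm (\<xi> i *\<^sub>C h))\<^sup>2) summable_on UNIV"
    by (simp add: norm_scaleC power_mult_distrib)
qed


section \<open>Bounded operators\<close>

instantiation blinfun :: (real_normed_vector, complex_normed_vector) complex_normed_vector
begin

lift_definition scaleC_blinfun :: "complex \<Rightarrow> ('a \<Rightarrow>\<^sub>L 'b) \<Rightarrow> ('a \<Rightarrow>\<^sub>L 'b)"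
  is "\<lambda>c f x. c *\<^sub>C f x"
proof -
  fix c and f :: "'a \<Rightarrow> 'b" assume "bounded_linear f"
  then interpret bounded_linear f .
  obtain K where K: "\<And>x. norm (f x) \<le> norm x * K" using bounded by blast
  show "bounded_linear (\<lambda>x. c *\<^sub>C f x)"
  proof (rule bounded_linear_intro)
    show "c *\<^sub>C f (x + y) = c *\<^sub>C f x + c *\<^sub>C f y" for x y
      by (simp add: add scaleC_add_right)
    show "c *\<^sub>C f (r *\<^sub>R x) = r *\<^sub>R c *\<^sub>C f x" for r x
      by (simp add: scaleR scaleR_scaleC scaleC_scaleC mult.commute)
    show "norm (c *\<^sub>C f x) \<le> norm x * (K * cmod c)" for x
      using mult_left_mono[OF K[of x] norm_ge_zero[of c]] by (simp add: norm_scaleC mult_ac)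
  qed
qed

instance
proof
  fix x y :: "'a \<Rightarrow>\<^sub>L 'b" and r :: real and c d :: complex
  show "r *\<^sub>R x = complex_of_real r *\<^sub>C x" by transfer (simp add: scaleR_scaleC)
  show "c *\<^sub>C (x + y) = c *\<^sub>C x + c *\<^sub>C y" by transfer (simp add: scaleC_add_right)
  show "(c + d) *\<^sub>C x = c *\<^sub>C x + d *\<^sub>C x" by transfer (simp add: scaleC_add_left)
  show "c *\<^sub>C d *\<^sub>C x = (c * d) *\<^sub>C x" by transfer (simp add: scaleC_scaleC)
  have le: "norm (c *\<^sub>C x) \<le> cmod c * norm x" for c and x :: "'a \<Rightarrow>\<^sub>L 'b"
    by (rule norm_blinfun_bound)
      (auto simp: scaleC_blinfun.rep_eq norm_scaleC mult.assoc intro!: mult_left_mono norm_blinfun)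
  show "norm (c *\<^sub>C x) = cmod c * norm x"
  proof (cases "c = 0")
    case True
    then show ?thesis using le[of 0 x] by simp
  next
    case False
    have one: "1 *\<^sub>C y = y" for y :: 'b using scaleR_scaleC[of 1 y] by simp
    have "inverse c *\<^sub>C c *\<^sub>C x = x"
      using False by transfer (simp add: scaleC_scaleC one)
    then have "norm x \<le> cmod (inverse c) * norm (c *\<^sub>C x)" using le[of "inverse c" "c *\<^sub>C x"] by simp
    then have "cmod c * norm x \<le> norm (c *\<^sub>C x)"
      using False mult_left_mono[OF _ norm_ge_zero[of c], of "norm x"]
      by (fastforce simp: norm_inverse mult.assoc[symmetric])
    then show ?thesis using le[of c x] by simp
  qed
qed

end

text \<open>
  The library type \<open>'a \<Rightarrow>\<^sub>L 'b\<close> consists of the bounded real-linear maps; the space of bounded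
  operators between complex Hilbert spaces is the following subset, with the inherited norm.
\<close>

definition bops :: "('a::complex_hilbert_space \<Rightarrow>\<^sub>L 'b::complex_hilbert_space) set" where
  "bops = {T :: 'a \<Rightarrow>\<^sub>L 'b. \<forall>c x. T (c *\<^sub>C x) = c *\<^sub>C T x}"

definition cadj :: "('a::complex_hilbert_space \<Rightarrow>\<^sub>L 'b::complex_hilbert_space) \<Rightarrow> ('b \<Rightarrow>\<^sub>L 'a)" where
  "cadj T = (THE S :: 'b \<Rightarrow>\<^sub>L 'a. \<forall>x y. cinner (T x) y = cinner x (S y))"

definition positive_op :: "('a::complex_hilbert_space \<Rightarrow>\<^sub>L 'a) \<Rightarrow> bool" where
  "positive_op T \<longleftrightarrow> T \<in> bops \<and> (\<forall>x. Im (cinner (T x) x) = 0 \<and> 0 \<le> Re (cinner (T x) x))"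

definition sqrt_op :: "('a::complex_hilbert_space \<Rightarrow>\<^sub>L 'a) \<Rightarrow> ('a \<Rightarrow>\<^sub>L 'a)" where
  "sqrt_op T = (THE R. positive_op R \<and> R o\<^sub>L R = T)"

text \<open>\<open>ampl A\<close> is \<open>A \<otimes> I\<close>.\<close>

definition ampl ::
    "(('i, complex) ell2 \<Rightarrow>\<^sub>L ('i, complex) ell2)
      \<Rightarrow> (('i, 'h::complex_hilbert_space) ell2 \<Rightarrow>\<^sub>L ('i, 'h) ell2)" where
  "ampl A = (THE T :: ('i, 'h) ell2 \<Rightarrow>\<^sub>L ('i, 'h) ell2. \<forall>\<xi> h. T (tensor \<xi> h) = tensor (A \<xi>) h)"

text \<open>
  The \<open>w\<^sup>*\<close>-topology, given by the predual: the weak-star continuous (normal) functionals are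
  \<open>A \<mapsto> \<Sum>j. \<langle>A x\<^sub>j, y\<^sub>j\<rangle>\<close> with \<open>\<Sum>j. \<parallel>x\<^sub>j\<parallel>\<^sup>2 < \<infinity>\<close> and \<open>\<Sum>j. \<parallel>y\<^sub>j\<parallel>\<^sup>2 < \<infinity>\<close>, i.e. the functionals
  \<open>A \<mapsto> tr (A T)\<close> with \<open>T\<close> of trace class. The definition parallels that of
  \<^const>\<open>strong_operator_topology\<close>.
\<close>

definition weak_star_topology ::
    "('a::complex_hilbert_space \<Rightarrow>\<^sub>L 'a) topology" where
  "weak_star_topology = pullback_topology UNIV
     (\<lambda>(A :: 'a \<Rightarrow>\<^sub>L 'a) (x, y). \<Sum>\<^sub>\<infinity>j. cinner (A (coord x j)) (coord y j) :: complex)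
     (euclidean :: ((nat, 'a) ell2 \<times> (nat, 'a) ell2 \<Rightarrow> complex) topology)"


section \<open>The full Fock space\<close>

text \<open>
  The generators are indexed by a finite type \<open>'n\<close> (so \<open>n = CARD('n)\<close>); words are lists over
  \<open>'n\<close>. The full Fock space on \<open>n\<close> generators is realised as \<open>\<ell>\<^sup>2\<close> over words: the words of
  length \<open>m\<close> index the orthonormal basis of the \<open>m\<close>-fold tensor power of the
  \<open>n\<close>-dimensional space, and \<open>e\<^sub>\<alpha>\<close> is \<open>ket \<alpha>\<close>.
\<close>

type_synonym 'n fock = "('n list, complex) ell2"

text \<open>
  Noncommutative Cauchy product determined by \<open>e\<^sub>\<alpha> \<otimes> e\<^sub>\<beta> = e\<^sub>\<alpha>\<^sub>\<beta>\<close>; the product of two elements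
  of the Fock space need not be square-summable, hence a plain family of coefficients.
\<close>

definition fock_mult :: "'n fock \<Rightarrow> 'n fock \<Rightarrow> 'n list \<Rightarrow> complex" where
  "fock_mult f g \<gamma> = (\<Sum>k\<le>length \<gamma>. coord f (take k \<gamma>) * coord g (drop k \<gamma>))"

definition F_infty :: "('n::finite) fock set" where
  "F_infty = {f. \<exists>T :: 'n fock \<Rightarrow>\<^sub>L 'n fock. \<forall>g. coord (T g) = fock_mult f g}"

text \<open>\<open>Lmult f\<close> is meaningful for \<open>f \<in> F_infty\<close>.\<close>

definition Lmult :: "('n::finite) fock \<Rightarrow> ('n fock \<Rightarrow>\<^sub>L 'n fock)" where
  "Lmult f = (THE T :: 'n fock \<Rightarrow>\<^sub>L 'n fock. \<forall>g. coord (T g) = fock_mult f g)"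

definition creation :: "'n::finite \<Rightarrow> ('n fock \<Rightarrow>\<^sub>L 'n fock)" where
  "creation i = Lmult (ket [i])"

definition disc_algebra_ops :: "('n::finite fock \<Rightarrow>\<^sub>L 'n fock) set" where
  "disc_algebra_ops = \<Inter>{A. closed A \<and> id_blinfun \<in> A \<and> range creation \<subseteq> A \<and>
     (\<forall>S\<in>A. \<forall>T\<in>A. S + T \<in> A \<and> S o\<^sub>L T \<in> A) \<and> (\<forall>c. \<forall>T\<in>A. c *\<^sub>C T \<in> A)}"

definition disc_algebra :: "('n::finite) fock set" where
  "disc_algebra = {f \<in> F_infty. Lmult f \<in> disc_algebra_ops}"


section \<open>Free holomorphic functions and the Poisson transform\<close>

fun word_op :: "('n \<Rightarrow> ('h::real_normed_vector \<Rightarrow>\<^sub>L 'h)) \<Rightarrow> 'n list \<Rightarrow> ('h \<Rightarrow>\<^sub>L 'h)" where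
  "word_op X [] = id_blinfun"
| "word_op X (i # \<alpha>) = X i o\<^sub>L word_op X \<alpha>"

definition row_ball :: "('n::finite \<Rightarrow> ('h::complex_hilbert_space \<Rightarrow>\<^sub>L 'h)) set" where
  "row_ball = {X. (\<forall>i. X i \<in> bops) \<and> sqrt (norm (\<Sum>i\<in>UNIV. X i o\<^sub>L cadj (X i))) < 1}"

text \<open>
  \<open>u\<close> is the free holomorphic function with coefficients \<open>a\<close>; only its values on
  \<^const>\<open>row_ball\<close> matter. These values determine the coefficients exactly if \<open>H\<close> is
  infinite-dimensional, or \<open>n = 1\<close> and \<open>H \<noteq> 0\<close>: for \<open>n \<ge> 2\<close> and \<open>dim H < \<infinity>\<close> there are
  nonzero noncommutative polynomials vanishing identically on \<open>B(H)\<^sup>n\<close>.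
  (Finite dimension can be expressed with the real span: complex and real finite dimension of
  \<open>H\<close> are equivalent.)
\<close>

definition free_holomorphic ::
    "('n::finite list \<Rightarrow> complex)
      \<Rightarrow> (('n \<Rightarrow> ('h::complex_hilbert_space \<Rightarrow>\<^sub>L 'h)) \<Rightarrow> ('h \<Rightarrow>\<^sub>L 'h)) \<Rightarrow> bool" where
  "free_holomorphic a u \<longleftrightarrow>
     limsup (\<lambda>k. ereal (root (2 * k) (\<Sum>\<alpha> | length \<alpha> = k. (cmod (a \<alpha>))\<^sup>2))) \<le> 1 \<and>
     (\<forall>X\<in>row_ball. (\<lambda>k. \<Sum>\<alpha> | length \<alpha> = k. a \<alpha> *\<^sub>C word_op X \<alpha>) sums u X)"

definition radial :: "('n::finite list \<Rightarrow> complex) \<Rightarrow> real \<Rightarrow> ('n fock \<Rightarrow>\<^sub>L 'n fock)" where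
  "radial a r = (\<Sum>k. \<Sum>\<alpha> | length \<alpha> = k. (complex_of_real (r ^ k) * a \<alpha>) *\<^sub>C word_op creation \<alpha>)"

definition defect :: "('n::finite \<Rightarrow> ('h::complex_hilbert_space \<Rightarrow>\<^sub>L 'h)) \<Rightarrow> ('h \<Rightarrow>\<^sub>L 'h)" where
  "defect X = sqrt_op (id_blinfun - (\<Sum>i\<in>UNIV. X i o\<^sub>L cadj (X i)))"

definition poisson_kernel ::
    "('n::finite \<Rightarrow> ('h::complex_hilbert_space \<Rightarrow>\<^sub>L 'h)) \<Rightarrow> ('h \<Rightarrow>\<^sub>L ('n list, 'h) ell2)" where
  "poisson_kernel X =
     Blinfun (\<lambda>h. \<Sum>\<^sub>\<infinity>\<alpha>. tensor (ket \<alpha>) (defect X (cadj (word_op X \<alpha>) h)))"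

definition poisson ::
    "('n::finite fock \<Rightarrow>\<^sub>L 'n fock)
      \<Rightarrow> ('n \<Rightarrow> ('h::complex_hilbert_space \<Rightarrow>\<^sub>L 'h)) \<Rightarrow> ('h \<Rightarrow>\<^sub>L 'h)" where
  "poisson A X = cadj (poisson_kernel X) o\<^sub>L ampl A o\<^sub>L poisson_kernel X"

end

theory Submission
  imports Defs
begin

text \<open>
  The Poisson kernel is an isometry that intertwines \<open>X\<^sub>\<alpha>\<^sup>*\<close> with \<open>S\<^sub>\<alpha>\<^sup>* \<otimes> I\<close>, so \<open>P[f](X)\<close> has the
  power series of \<open>f\<close>; the coefficients of a series are in turn determined by its values on
  finite-rank partial shifts (on scalars if \<open>n = 1\<close>). Hence \<open>u = P[f]\<close> just says that \<open>f\<close> has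
  the coefficients of \<open>u\<close>. In that case \<open>u(r S) = P[f](r S)\<close> has norm at most \<open>\<parallel>L\<^sub>f\<parallel>\<close>, and
  \<open>u(r S) D\<^sub>r = D\<^sub>r L\<^sub>f\<close> for the contractions \<open>D\<^sub>r e\<^sub>\<alpha> = r\<^bsup>|\<alpha>|\<^esup> e\<^sub>\<alpha>\<close>, which tend strongly to the
  identity; this gives the strong and the \<open>w\<^sup>*\<close> convergence. Conversely, a uniform bound on
  \<open>u(r S)\<close> passes to the limit in every finite set of coordinates. For part (ii), the multipliers
  with norm convergent dilations form a closed algebra that contains the \<open>S\<^sub>i\<close>.
\<close>

text \<open>\<open>radial a\<close> is built from the coefficients, whereas \<open>u = P[f]\<close>
  speaks only of values on \<open>row_ball\<close>; the two can be compared where values determine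
  coefficients, and this is where the assumption on the dimension enters. The Poisson transform
  plays two roles: on the given space it represents \<open>u\<close>, and on the Fock space itself
  it bounds the dilations of a multiplier uniformly in \<open>r\<close>, a bound that cannot be read
  off the sizes of the coefficients. The series of \<open>P[f]\<close> is compared with that of
  \<open>u\<close> through matrix entries, where it becomes a scalar family that may be rearranged.
  Adjoints, square roots and ampliations are definite descriptions, so each has to be constructed
  and shown to be unique before it can be computed with: adjoints come from Riesz representation,
  square roots from a contraction, ampliations from a vector-valued Cauchy product.\<close>

instance complex_hilbert_space \<subseteq> banach ..

section \<open>Complex Hilbert spaces\<close>

lemma scaleC_one [simp]: "1 *\<^sub>C x = (x :: 'a::complex_normed_vector)"
  using scaleR_scaleC[of 1 x] by simp

lemma scaleC_zero_left [simp]: "0 *\<^sub>C x = (0 :: 'a::complex_normed_vector)"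
  using scaleR_scaleC[of 0 x] by simp

lemma scaleC_zero_right [simp]: "c *\<^sub>C 0 = (0 :: 'a::complex_normed_vector)"
  using scaleC_add_right[of c 0 "0::'a"] by simp

lemma scaleC_minus_right: "c *\<^sub>C (- x) = - (c *\<^sub>C (x :: 'a::complex_normed_vector))"
  using scaleC_add_right[of c x "- x"] by (simp add: eq_neg_iff_add_eq_0 add.commute)

lemma scaleC_diff_right: "c *\<^sub>C (x - y) = c *\<^sub>C x - c *\<^sub>C (y :: 'a::complex_normed_vector)"
  using scaleC_add_right[of c x "- y"] by (simp add: scaleC_minus_right)

lemma scaleC_sum_right: "c *\<^sub>C (\<Sum>i\<in>A. f i) = (\<Sum>i\<in>A. c *\<^sub>C (f i :: 'a::complex_normed_vector))"
  by (induction A rule: infinite_finite_induct) (auto simp: scaleC_add_right)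

lemma bounded_linear_scaleC: "bounded_linear (\<lambda>x :: 'a::complex_normed_vector. c *\<^sub>C x)"
  by (rule bounded_linear_intro[where K = "cmod c"])
    (auto simp: scaleC_add_right scaleR_scaleC scaleC_scaleC norm_scaleC mult.commute)

lemma cinner_zero_left [simp]: "cinner 0 y = 0"
  using cinner_add_left[of 0 0 y] by simp

lemma cinner_zero_right [simp]: "cinner x 0 = 0"
  using cinner_add_right[of x 0 0] by simp

lemma cinner_diff_left: "cinner (x - y) z = cinner x z - cinner y z"
  using cinner_add_left[of "x - y" y z] by (simp add: algebra_simps)

lemma cinner_diff_right: "cinner x (y - z) = cinner x y - cinner x z"
  using cinner_add_right[of x "y - z" z] by (simp add: algebra_simps)

lemma cinner_sum_left: "cinner (\<Sum>i\<in>A. f i) y = (\<Sum>i\<in>A. cinner (f i) y)"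
  by (induction A rule: infinite_finite_induct) (auto simp: cinner_add_left)

lemma cinner_sum_right: "cinner x (\<Sum>i\<in>A. f i) = (\<Sum>i\<in>A. cinner x (f i))"
  by (induction A rule: infinite_finite_induct) (auto simp: cinner_add_right)

lemma cinner_scaleR_left: "cinner (r *\<^sub>R x) y = r *\<^sub>R cinner x y"
  by (simp add: scaleR_scaleC[of r x] cinner_scaleC_left scaleR_conv_of_real)

lemma cinner_scaleR_right: "cinner x (r *\<^sub>R y) = r *\<^sub>R cinner x y"
  by (simp add: scaleR_scaleC[of r y] cinner_scaleC_right scaleR_conv_of_real)

lemma Re_cinner_self: "Re (cinner x x) = (norm x)\<^sup>2"
  by (simp add: cinner_self)

lemma Re_cinner_commute: "Re (cinner x y) = Re (cinner y x)"
  by (metis cinner_commute complex_cnj(1) complex_surj complex.sel(1))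

lemma norm_add_sqr: "(norm (x + y))\<^sup>2 = (norm x)\<^sup>2 + 2 * Re (cinner x y) + (norm y)\<^sup>2"
  for x y :: "'a::complex_hilbert_space"
  unfolding Re_cinner_self[symmetric]
  by (simp add: cinner_add_left cinner_add_right Re_cinner_commute[of y x])

lemma norm_diff_sqr: "(norm (x - y))\<^sup>2 = (norm x)\<^sup>2 - 2 * Re (cinner x y) + (norm y)\<^sup>2"
  for x y :: "'a::complex_hilbert_space"
  unfolding Re_cinner_self[symmetric]
  by (simp add: cinner_diff_left cinner_diff_right Re_cinner_commute[of y x])

lemma Im_cinner: "Im (cinner x y) = Re (cinner x (\<i> *\<^sub>C y))"
  by (simp add: cinner_scaleC_right)

lemma cauchy_schwarz: "cmod (cinner x y) \<le> norm x * norm y"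
  for x y :: "'a::complex_hilbert_space"
proof (cases "y = 0")
  case False
  define c where "c = cinner x y / (norm y)\<^sup>2"
  have y: "norm y > 0" using False by simp
  have "Re (cinner x (c *\<^sub>C y)) = (cmod (cinner x y))\<^sup>2 / (norm y)\<^sup>2"
    unfolding c_def cinner_scaleC_right
    by (simp add: complex_norm_square[symmetric] power2_eq_square mult.commute cmod_def
        flip: of_real_mult of_real_power)
  moreover have "(norm (c *\<^sub>C y))\<^sup>2 = (cmod (cinner x y))\<^sup>2 / (norm y)\<^sup>2"
    using y by (simp add: c_def norm_scaleC norm_divide norm_power norm_mult power2_eq_square field_simps)
  ultimately have "0 \<le> (norm x)\<^sup>2 - (cmod (cinner x y))\<^sup>2 / (norm y)\<^sup>2"
    using norm_diff_sqr[of x "c *\<^sub>C y"] zero_le_power2[of "norm (x - c *\<^sub>C y)"] by linarith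
  then have "(cmod (cinner x y))\<^sup>2 \<le> (norm x * norm y)\<^sup>2"
    using y by (simp add: field_simps)
  then show ?thesis by (rule power2_le_imp_le) simp
qed simp

lemma bounded_linear_cinner_left: "bounded_linear (\<lambda>x. cinner x y)"
  by (rule bounded_linear_intro[where K = "norm y"])
    (auto simp: cinner_add_left cinner_scaleR_left cauchy_schwarz)

lemma bounded_linear_cinner_right: "bounded_linear (\<lambda>y. cinner x y)"
  by (rule bounded_linear_intro[where K = "norm x"])
    (auto simp: cinner_add_right cinner_scaleR_right cauchy_schwarz mult.commute[of "norm _" "norm x"])

lemmas tendsto_cinner_left = bounded_linear.tendsto[OF bounded_linear_cinner_left]
lemmas tendsto_cinner_right = bounded_linear.tendsto[OF bounded_linear_cinner_right]

lemma cinner_self_eq_zero [simp]: "cinner x x = 0 \<longleftrightarrow> x = 0"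
  by (simp add: cinner_self)

lemma cinner_ext:
  assumes "\<And>y. cinner x y = cinner x' y" shows "x = x'"
  using assms[of "x - x'"] cinner_self_eq_zero[of "x - x'"] by (simp add: cinner_diff_left del: cinner_self_eq_zero)

lemma cinner_ext_right:
  assumes "\<And>x. cinner x y = cinner x y'" shows "y = y'"
  by (rule cinner_ext) (metis assms cinner_commute)

lemma norm_le_cinner_bound:
  fixes x :: "'a::complex_hilbert_space"
  assumes "\<And>y. cmod (cinner x y) \<le> C * norm y" "0 \<le> C"
  shows "norm x \<le> C"
proof (cases "x = 0")
  case False
  have "norm x * norm x \<le> C * norm x"
    using assms(1)[of x] by (simp add: cinner_self norm_power power2_eq_square norm_mult)
  then show ?thesis using False by simp
qed (use assms in simp)

subsection \<open>The Riesz representation theorem\<close>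

text \<open>A nonnegative parabola through the origin has slope 0 there. This is the first-order
  condition for the minimiser in \<open>riesz_real\<close>.\<close>

lemma quadratic_nonneg_imp_linear_zero:
  fixes d N :: real
  assumes "\<And>t. 0 \<le> 2 * t * d + t\<^sup>2 * N" "0 \<le> N"
  shows "d = 0"
proof -
  \<comment> \<open>The vertex is at \<open>- d / N\<close>, but \<open>N\<close> may be 0; dividing
    by \<open>N + 1\<close> instead still gives a negative value unless
    \<open>d = 0\<close>.\<close>
  define s where "s = N + 1"
  have s: "s > 0" "N = s - 1" using assms(2) by (auto simp: s_def)
  have "0 \<le> 2 * (- d / s) * d + (- d / s)\<^sup>2 * N" by (rule assms(1))
  also have "\<dots> = - (d\<^sup>2 * (s + 1)) / s\<^sup>2"
    using s(1) unfolding s(2) by (simp add: field_simps power2_eq_square)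
  finally have "d\<^sup>2 * (s + 1) \<le> 0"
    using s(1) by (simp add: divide_le_0_iff)
  then have "d\<^sup>2 \<le> 0" using s by (simp add: mult_le_0_iff)
  then show ?thesis by simp
qed

text \<open>The representing vector minimises \<open>\<parallel>y\<parallel>\<^sup>2 - 2 \<phi> y\<close>; minimising sequences are Cauchy
  by the parallelogram identity.\<close>

lemma riesz_real:
  fixes \<phi> :: "'a::complex_hilbert_space \<Rightarrow> real"
  assumes "bounded_linear \<phi>"
  shows "\<exists>y. \<forall>x. \<phi> x = Re (cinner x y)"
proof -
  interpret bounded_linear \<phi> by fact
  define F where "F y = (norm y)\<^sup>2 - 2 * \<phi> y" for y
  obtain K where K: "\<And>x. norm (\<phi> x) \<le> norm x * K" using bounded by blast
  have lower: "- K\<^sup>2 \<le> F y" for y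
    using K[of y] zero_le_power2[of "norm y - K"]
    by (simp add: F_def power2_diff algebra_simps)
  then have bdd: "bdd_below (range F)" by (intro bdd_belowI[of _ "- K\<^sup>2"]) auto
  define m where "m = Inf (range F)"
  have m: "m \<le> F y" for y unfolding m_def by (rule cINF_lower[OF bdd]) simp
  have "\<exists>y. F y < m + 1 / real (Suc n)" for n
  proof -
    have "Inf (range F) < m + 1 / real (Suc n)" by (simp add: m_def)
    then show ?thesis by (subst (asm) cInf_less_iff) (auto simp: bdd)
  qed
  then obtain y where y: "\<And>n. F (y n) < m + 1 / real (Suc n)" by metis
  have par: "(norm (y n - y k))\<^sup>2 \<le> 2 / real (Suc n) + 2 / real (Suc k)" for n k
  proof -
    have "F ((1/2) *\<^sub>R (y n + y k)) = (norm (y n + y k))\<^sup>2 / 4 - \<phi> (y n) - \<phi> (y k)"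
      by (simp only: F_def scaleR add norm_scaleR power_mult_distrib) (simp add: power2_eq_square field_simps)
    moreover have "(norm (y n - y k))\<^sup>2 + (norm (y n + y k))\<^sup>2 = 2 * (norm (y n))\<^sup>2 + 2 * (norm (y k))\<^sup>2"
      by (simp add: norm_add_sqr norm_diff_sqr)
    ultimately have "(norm (y n - y k))\<^sup>2
        = 2 * F (y n) + 2 * F (y k) - 4 * F ((1/2) *\<^sub>R (y n + y k))"
      by (simp add: F_def)
    then show ?thesis using y[of n] y[of k] m[of "(1/2) *\<^sub>R (y n + y k)"] by simp
  qed
  have "Cauchy y"
  proof (rule CauchyI)
    fix e :: real assume e: "0 < e"
    obtain M where M: "4 / e\<^sup>2 < real M" using reals_Archimedean2 by blast
    have "norm (y n - y k) < e" if "n \<ge> M" "k \<ge> M" for n k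
    proof -
      have M0: "real M > 0" using M e by (smt (verit) divide_pos_pos zero_less_power)
      have "2 / real (Suc n) < 2 / real M" "2 / real (Suc k) < 2 / real M"
        using that M0 by (auto intro!: divide_strict_left_mono)
      then have "(norm (y n - y k))\<^sup>2 < 4 / real M" using par[of n k] by simp
      also have "\<dots> < e\<^sup>2" using M M0 e by (simp add: field_simps)
      finally show ?thesis using e by (simp add: power_less_imp_less_base)
    qed
    then show "\<exists>M. \<forall>n\<ge>M. \<forall>k\<ge>M. norm (y n - y k) < e" by blast
  qed
  then obtain z where z: "y \<longlonglongrightarrow> z" using Cauchy_convergent convergent_def by blast
  have "(\<lambda>n. F (y n)) \<longlonglongrightarrow> F z"
    unfolding F_def by (intro tendsto_intros tendsto z)
  moreover have "(\<lambda>n. m + 1 / real (Suc n)) \<longlonglongrightarrow> m + 0"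
    by (intro tendsto_intros lim_1_over_n[THEN LIMSEQ_Suc])
  ultimately have "F z \<le> m + 0"
    by (rule LIMSEQ_le) (use y in \<open>auto intro: less_imp_le\<close>)
  then have Fz: "F z \<le> m" by simp
  have "Re (cinner x z) - \<phi> x = 0" for x
  proof (rule quadratic_nonneg_imp_linear_zero)
    fix t :: real
    have "F z \<le> F (z + t *\<^sub>R x)" using Fz m order_trans by blast
    moreover have "F (z + t *\<^sub>R x)
        = F z + 2 * t * (Re (cinner x z) - \<phi> x) + t\<^sup>2 * (norm x)\<^sup>2"
      by (simp add: F_def norm_add_sqr add scaleR cinner_scaleR_right Re_cinner_commute[of z x]
          power_mult_distrib algebra_simps)
    ultimately show "0 \<le> 2 * t * (Re (cinner x z) - \<phi> x) + t\<^sup>2 * (norm x)\<^sup>2" by simp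
  qed simp
  then show ?thesis by (metis eq_iff_diff_eq_0)
qed

text \<open>A complex-linear functional is recovered from its real part, because
  \<open>Re (\<phi> (\<i> *\<^sub>C x))\<close> is \<open>- Im (\<phi> x)\<close>; so the real case
  suffices.\<close>

lemma riesz:
  fixes \<phi> :: "'a::complex_hilbert_space \<Rightarrow> complex"
  assumes "bounded_linear \<phi>" "\<And>c x. \<phi> (c *\<^sub>C x) = c * \<phi> x"
  shows "\<exists>y. \<forall>x. \<phi> x = cinner x y"
proof -
  have "bounded_linear (\<lambda>x. Re (\<phi> x))"
    by (rule bounded_linear_compose[OF bounded_linear_Re assms(1)])
  then obtain y where y: "\<And>x. Re (\<phi> x) = Re (cinner x y)" using riesz_real by blast
  have "Im (\<phi> x) = Im (cinner x y)" for x
    using y[of "\<i> *\<^sub>C x"] by (simp add: assms(2) cinner_scaleC_left)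
  then show ?thesis using y complex_eqI by blast
qed

subsection \<open>Adjoints\<close>

lemma bopsD: "T \<in> bops \<Longrightarrow> blinfun_apply T (c *\<^sub>C x) = c *\<^sub>C blinfun_apply T x"
  by (simp add: bops_def)

lemma bopsI: "(\<And>c x. blinfun_apply T (c *\<^sub>C x) = c *\<^sub>C blinfun_apply T x) \<Longrightarrow> T \<in> bops"
  by (simp add: bops_def)

text \<open>Riesz gives the value of the adjoint at each \<open>y\<close> separately, and membership
  in \<open>bops\<close> provides the complex linearity it asks for. Linearity in \<open>y\<close>
  follows because inner products separate vectors.\<close>

lemma cadj_exists:
  assumes "T \<in> bops"
  shows "\<exists>S :: 'b::complex_hilbert_space \<Rightarrow>\<^sub>L 'a::complex_hilbert_space.
    \<forall>x y. cinner (blinfun_apply T x) y = cinner x (blinfun_apply S y)"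
proof -
  have "\<exists>z. \<forall>x. cinner (T x) y = cinner x z" for y
    by (rule riesz)
      (auto simp: bopsD[OF assms] cinner_scaleC_left
        intro!: bounded_linear_compose[OF bounded_linear_cinner_left blinfun.bounded_linear_right])
  then obtain S where S: "\<And>x y. cinner (T x) y = cinner x (S y)" by metis
  have "bounded_linear S"
  proof (rule bounded_linear_intro[where K = "norm T"])
    show "S (y + z) = S y + S z" for y z
      by (rule cinner_ext_right) (simp add: S[symmetric] cinner_add_right)
    show "S (r *\<^sub>R y) = r *\<^sub>R S y" for r y
      by (rule cinner_ext_right) (simp add: S[symmetric] cinner_scaleR_right)
    show "norm (S y) \<le> norm y * norm T" for y
    proof (rule norm_le_cinner_bound)
      show "cmod (cinner (S y) x) \<le> norm y * norm T * norm x" for x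
      proof -
        have "cmod (cinner (S y) x) = cmod (cinner (T x) y)"
          by (metis S cinner_commute complex_mod_cnj)
        also have "\<dots> \<le> norm (T x) * norm y" by (rule cauchy_schwarz)
        also have "\<dots> \<le> (norm T * norm x) * norm y"
          by (intro mult_right_mono norm_blinfun) simp
        finally show ?thesis by (simp add: mult_ac)
      qed
    qed simp
  qed
  then show ?thesis using S by (intro exI[of _ "Blinfun S"]) (simp add: bounded_linear_Blinfun_apply)
qed

lemma cadj_eqI:
  assumes "\<And>x y. cinner (blinfun_apply T x) y = cinner x (blinfun_apply S y)"
  shows "cadj T = S"
  unfolding cadj_def
proof (rule the_equality)
  show "S' = S" if "\<forall>x y. cinner (T x) y = cinner x (blinfun_apply S' y)" for S'
    by (rule blinfun_eqI, rule cinner_ext_right) (metis assms that)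
qed (use assms in blast)

lemma cinner_cadj:
  assumes "T \<in> bops" shows "cinner (blinfun_apply T x) y = cinner x (blinfun_apply (cadj T) y)"
proof -
  obtain S where "\<forall>x y. cinner (T x) y = cinner x (blinfun_apply S y)" using cadj_exists[OF assms] ..
  then show ?thesis using cadj_eqI[of T S] by metis
qed

lemma cinner_cadj_left:
  assumes "T \<in> bops" shows "cinner (blinfun_apply (cadj T) y) x = cinner y (blinfun_apply T x)"
  by (metis assms cinner_cadj cinner_commute)

lemma cadj_in_bops [simp]: "T \<in> bops \<Longrightarrow> cadj T \<in> bops"
  by (rule bopsI, rule cinner_ext_right)
    (simp add: cinner_cadj[symmetric] cinner_scaleC_right)

lemma id_in_bops [simp]: "id_blinfun \<in> bops"
  by (simp add: bops_def)

lemma compose_in_bops [simp]: "S \<in> bops \<Longrightarrow> T \<in> bops \<Longrightarrow> S o\<^sub>L T \<in> bops"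
  by (simp add: bops_def)

lemma sum_in_bops: "(\<And>i. i \<in> A \<Longrightarrow> f i \<in> bops) \<Longrightarrow> sum f A \<in> bops"
  by (simp add: bops_def blinfun.sum_left scaleC_sum_right)

lemma diff_in_bops [simp]: "S \<in> bops \<Longrightarrow> T \<in> bops \<Longrightarrow> S - T \<in> bops"
  by (simp add: bops_def blinfun.diff_left scaleC_diff_right)

lemma cadj_id [simp]: "cadj id_blinfun = id_blinfun"
  by (rule cadj_eqI) simp

lemma cadj_compose: "S \<in> bops \<Longrightarrow> T \<in> bops \<Longrightarrow> cadj (S o\<^sub>L T) = cadj T o\<^sub>L cadj S"
  by (rule cadj_eqI) (simp add: cinner_cadj)

lemma scaleC_in_bops [simp]: "T \<in> bops \<Longrightarrow> c *\<^sub>C T \<in> bops"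
  by (simp add: bops_def scaleC_blinfun.rep_eq scaleC_scaleC mult.commute)

text \<open>Norms determine the real parts of inner products by polarisation; imaginary parts are
  real parts after multiplying the second vector by \<open>\<i>\<close>, which \<open>K\<close>
  respects.\<close>

lemma isometry_cinner:
  assumes "K \<in> bops" "\<And>x. norm (blinfun_apply K x) = norm x"
  shows "cinner (blinfun_apply K x) (blinfun_apply K y) = cinner x y"
proof -
  have Re: "Re (cinner (K x) (K y)) = Re (cinner x y)" for x y
    using norm_add_sqr[of "K x" "K y"] norm_add_sqr[of x y]
    by (simp add: assms(2) flip: blinfun.add_right)
  show ?thesis
    by (rule complex_eqI) (simp_all only: Re Im_cinner flip: bopsD[OF assms(1)])
qed

subsection \<open>Finite orthonormal sets\<close>

definition orthonormal :: "'a::complex_hilbert_space set \<Rightarrow> bool" where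
  "orthonormal E \<longleftrightarrow> (\<forall>x\<in>E. \<forall>y\<in>E. cinner x y = (if x = y then 1 else 0))"

lemma cinner_orthonormal_expansion:
  assumes "finite E" "orthonormal E" "e \<in> E"
  shows "cinner (\<Sum>e'\<in>E. c e' *\<^sub>C e') e = c e"
proof -
  have "cinner (\<Sum>e'\<in>E. c e' *\<^sub>C e') e = (\<Sum>e'\<in>E. if e' = e then c e' else 0)"
    unfolding cinner_sum_left
    by (intro sum.cong) (use assms in \<open>auto simp: orthonormal_def cinner_scaleC_left\<close>)
  then show ?thesis using assms by simp
qed

text \<open>The normalised residual of \<open>v\<close> is orthogonal to \<open>E\<close>. The last
  conjunct serves to build a basis for finitely many given vectors, the orthonormality to build an
  infinite sequence.\<close>

lemma gram_schmidt_step: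
  assumes E: "finite E" "orthonormal E" and v: "v \<noteq> (\<Sum>e\<in>E. cinner v e *\<^sub>C e)"
  shows "\<exists>w. w \<notin> E \<and> orthonormal (insert w E)
    \<and> (\<exists>c. v = c *\<^sub>C w + (\<Sum>e\<in>E. cinner v e *\<^sub>C e))"
proof -
  define u where "u = v - (\<Sum>e\<in>E. cinner v e *\<^sub>C e)"
  define w where "w = complex_of_real (1 / norm u) *\<^sub>C u"
  have u: "norm u > 0" using v by (simp add: u_def)
  have "cinner u e = 0" if "e \<in> E" for e
    using cinner_orthonormal_expansion[OF E that] by (simp add: u_def cinner_diff_left)
  then have w0: "cinner w e = 0" if "e \<in> E" for e using that by (simp add: w_def cinner_scaleC_left)
  have w1: "cinner w w = 1"
    using u by (simp add: w_def cinner_self norm_scaleC norm_divide)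
  have w2: "cinner e w = 0" if "e \<in> E" for e
    by (subst cinner_commute) (simp add: w0[OF that])
  have "w \<notin> E" using w0 w1 by fastforce
  moreover have "orthonormal (insert w E)"
    using E(2) w0 w1 w2 by (auto simp: orthonormal_def)
  moreover have "v = complex_of_real (norm u) *\<^sub>C w + (\<Sum>e\<in>E. cinner v e *\<^sub>C e)"
    using u by (simp add: w_def scaleC_scaleC) (simp add: u_def)
  ultimately show ?thesis by blast
qed

lemma orthonormal_expansionI:
  assumes "finite E" "orthonormal E" "v = (\<Sum>e\<in>E. c e *\<^sub>C e)"
  shows "v = (\<Sum>e\<in>E. cinner v e *\<^sub>C e)"
  by (subst assms(3), intro sum.cong)
    (use assms in \<open>auto simp: cinner_orthonormal_expansion\<close>)

lemma finite_orthonormal_basis: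
  assumes "finite V"
  shows "\<exists>E. finite E \<and> orthonormal E \<and> (\<forall>v\<in>V. v = (\<Sum>e\<in>E. cinner v e *\<^sub>C e))"
  using assms
proof (induction V)
  case empty
  show ?case by (intro exI[of _ "{}"]) (simp add: orthonormal_def)
next
  case (insert v V)
  then obtain E where E: "finite E" "orthonormal E" "\<forall>v\<in>V. v = (\<Sum>e\<in>E. cinner v e *\<^sub>C e)" by blast
  show ?case
  proof (cases "v = (\<Sum>e\<in>E. cinner v e *\<^sub>C e)")
    case True
    then show ?thesis using E by blast
  next
    case False
    then obtain w c where w: "w \<notin> E" "orthonormal (insert w E)"
        "v = c *\<^sub>C w + (\<Sum>e\<in>E. cinner v e *\<^sub>C e)"
      using gram_schmidt_step[OF E(1,2)] by blast
    have "x = (\<Sum>e\<in>insert w E. cinner x e *\<^sub>C e)" if x: "x \<in> insert v V" for x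
    proof -
      have "\<exists>d. x = d *\<^sub>C w + (\<Sum>e\<in>E. cinner x e *\<^sub>C e)"
        using x w(3) E(3) by (metis add_0 insertE scaleC_zero_left)
      then obtain d where "x = d *\<^sub>C w + (\<Sum>e\<in>E. cinner x e *\<^sub>C e)" ..
      moreover have "(\<Sum>e\<in>E. (if e = w then d else cinner x e) *\<^sub>C e) = (\<Sum>e\<in>E. cinner x e *\<^sub>C e)"
        using w(1) by (intro sum.cong) auto
      ultimately have "x = (\<Sum>e\<in>insert w E. (if e = w then d else cinner x e) *\<^sub>C e)"
        using w(1) E(1) by (simp add: sum.insert)
      then show ?thesis by (rule orthonormal_expansionI[OF _ w(2), rotated]) (simp add: E(1))
    qed
    then show ?thesis using w(2) E(1) by (intro exI[of _ "insert w E"]) simp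
  qed
qed

lemma norm_orthonormal_expansion:
  assumes "finite E" "orthonormal E" "v = (\<Sum>e\<in>E. cinner v e *\<^sub>C e)"
  shows "(norm v)\<^sup>2 = (\<Sum>e\<in>E. (cmod (cinner v e))\<^sup>2)"
proof -
  have "complex_of_real ((norm v)\<^sup>2) = cinner v (\<Sum>e\<in>E. cinner v e *\<^sub>C e)"
    by (simp only: assms(3)[symmetric] cinner_self)
  also have "\<dots> = complex_of_real (\<Sum>e\<in>E. (cmod (cinner v e))\<^sup>2)"
    by (simp add: cinner_sum_right cinner_scaleC_right complex_norm_square mult.commute del: of_real_power)
  finally show ?thesis by (simp only: of_real_eq_iff)
qed

lemma extend_orthonormal:
  assumes "\<nexists>B :: 'a::complex_hilbert_space set. finite B \<and> span B = UNIV"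
    and E: "finite E" "orthonormal (E :: 'a set)"
  shows "\<exists>w. w \<notin> E \<and> orthonormal (insert w E)"
proof -
  \<comment> \<open>The dimension hypothesis is about real spans. The real span of \<open>E\<close>
    together with \<open>\<i>\<close> times \<open>E\<close> contains the complex span of
    \<open>E\<close>, so \<open>v\<close> lies outside the latter.\<close>
  have "finite (E \<union> (\<lambda>e. \<i> *\<^sub>C e) ` E)" using E by simp
  then obtain v where v: "v \<notin> span (E \<union> (\<lambda>e. \<i> *\<^sub>C e) ` E)" using assms(1) by blast
  have "v \<noteq> (\<Sum>e\<in>E. cinner v e *\<^sub>C e)"
  proof
    assume v': "v = (\<Sum>e\<in>E. cinner v e *\<^sub>C e)"
    have "cinner v e *\<^sub>C e = Re (cinner v e) *\<^sub>R e + Im (cinner v e) *\<^sub>R (\<i> *\<^sub>C e)" for e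
    proof -
      have "cinner v e = complex_of_real (Re (cinner v e)) + complex_of_real (Im (cinner v e)) * \<i>"
        by (simp add: complex_eq_iff)
      then show ?thesis by (metis scaleR_scaleC scaleC_scaleC scaleC_add_left)
    qed
    then have "(\<Sum>e\<in>E. cinner v e *\<^sub>C e) \<in> span (E \<union> (\<lambda>e. \<i> *\<^sub>C e) ` E)"
      by (intro span_sum) (auto intro!: span_add span_scale intro: span_base)
    then show False using v v' by simp
  qed
  then show ?thesis using gram_schmidt_step[OF E] by blast
qed

lemma exists_orthonormal_sequence:
  assumes "\<nexists>B :: 'a::complex_hilbert_space set. finite B \<and> span B = UNIV"
  shows "\<exists>h :: nat \<Rightarrow> 'a. inj h \<and> orthonormal (range h)"
proof -
  \<comment> \<open>The choice is made over finite sets, because each new vector depends on all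
    earlier ones; \<open>h\<close> then lists the vectors added.\<close>
  have "\<exists>g :: nat \<Rightarrow> 'a set. \<forall>n. (finite (g n) \<and> orthonormal (g n)) \<and> (\<exists>w. w \<notin> g n \<and> g (Suc n) = insert w (g n))"
  proof (rule dependent_nat_choice)
    show "\<exists>E :: 'a set. finite E \<and> orthonormal E" by (intro exI[of _ "{}"]) (simp add: orthonormal_def)
    show "\<exists>E'. (finite E' \<and> orthonormal E') \<and> (\<exists>w. w \<notin> E \<and> E' = insert w E)"
      if "finite E \<and> orthonormal E" for E :: "'a set"
      using extend_orthonormal[OF assms, of E] that by (metis finite_insert)
  qed
  then obtain g :: "nat \<Rightarrow> 'a set" where g: "\<And>n. orthonormal (g n)"
      "\<And>n. \<exists>w. w \<notin> g n \<and> g (Suc n) = insert w (g n)" by blast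
  then obtain h where h: "\<And>n. h n \<notin> g n" "\<And>n. g (Suc n) = insert (h n) (g n)" by metis
  have mono: "g m \<subseteq> g n" if "m \<le> n" for m n
    using that by (induction rule: dec_induct) (auto simp: h(2))
  have mem: "h m \<in> g n" if "m < n" for m n using mono[of "Suc m" n] that h(2)[of m] by auto
  have "h m \<noteq> h n" if "m < n" for m n using mem[OF that] h(1)[of n] by metis
  then have "inj h" by (metis injI linorder_neqE_nat)
  moreover have "orthonormal (range h)"
  proof -
    have "cinner (h m) (h n) = (if h m = h n then 1 else 0)" for m n
      using g(1)[of "Suc (max m n)"] mem[of m "Suc (max m n)"] mem[of n "Suc (max m n)"]
      by (auto simp: orthonormal_def)
    then show ?thesis by (auto simp: orthonormal_def)
  qed
  ultimately show ?thesis by blast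
qed

subsection \<open>Square roots of strictly positive operators\<close>

text \<open>The square root of \<open>I - Q\<close> is \<open>I - Y\<close>, where \<open>Y\<close> is the fixed point of
  \<open>Y \<mapsto> (Q + Y\<^sup>2) / 2\<close> on the ball of radius \<open>1 - \<surd>(1 - \<parallel>Q\<parallel>) < 1\<close>.\<close>

lemma sqrt_fixed_point:
  fixes Q :: "'a::complex_hilbert_space \<Rightarrow>\<^sub>L 'a"
  assumes Q: "Q \<in> bops" "\<And>x y. cinner (blinfun_apply Q x) y = cinner x (blinfun_apply Q y)"
    and norm_Q: "norm Q < 1"
  obtains Y where "Y \<in> bops" "norm Y < 1"
    "\<And>x y. cinner (blinfun_apply Y x) y = cinner x (blinfun_apply Y y)"
    "\<And>C. C o\<^sub>L Q = Q o\<^sub>L C \<Longrightarrow> C o\<^sub>L Y = Y o\<^sub>L C"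
    "2 *\<^sub>R Y = Q + (Y o\<^sub>L Y)"
proof -
  define \<rho> where "\<rho> = 1 - sqrt (1 - norm Q)"
  have \<rho>: "0 \<le> \<rho>" "\<rho> < 1" using norm_Q by (auto simp: \<rho>_def)
  \<comment> \<open>\<open>\<rho>\<close> is the smaller root of
    \<open>t\<^sup>2 - 2 t + norm Q\<close>; this equation is what makes \<open>f\<close> map the
    ball of radius \<open>\<rho>\<close> into itself.\<close>
  have \<rho>2: "norm Q + \<rho> * \<rho> = 2 * \<rho>"
    using norm_Q by (simp add: \<rho>_def algebra_simps)
  \<comment> \<open>The commutation clause is part of the set so that the fixed point inherits it;
    uniqueness of the positive square root relies on it. Every clause survives norm limits, so
    \<open>S\<close> is complete.\<close>
  define S where "S = {Y. norm Y \<le> \<rho> \<and> Y \<in> bops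
    \<and> (\<forall>x y. cinner (blinfun_apply Y x) y = cinner x (blinfun_apply Y y))
    \<and> (\<forall>C. C o\<^sub>L Q = Q o\<^sub>L C \<longrightarrow> C o\<^sub>L Y = Y o\<^sub>L C)}"
  define f where "f Y = (1/2) *\<^sub>R (Q + (Y o\<^sub>L Y))" for Y
  have "closed S"
    unfolding closed_sequential_limits
  proof (intro allI impI, elim conjE)
    fix X :: "nat \<Rightarrow> 'a \<Rightarrow>\<^sub>L 'a" and Y assume X: "\<forall>n. X n \<in> S" and lim: "X \<longlonglongrightarrow> Y"
    have X: "norm (X n) \<le> \<rho>" "X n \<in> bops" "cinner (X n x) y = cinner x (X n y)"
      "C o\<^sub>L Q = Q o\<^sub>L C \<Longrightarrow> C o\<^sub>L X n = X n o\<^sub>L C" for n x y C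
      using X unfolding S_def mem_Collect_eq by blast+
    have lim_ap: "(\<lambda>n. X n x) \<longlonglongrightarrow> Y x" for x
      by (intro tendsto_intros lim)
    have "norm Y \<le> \<rho>"
      by (rule LIMSEQ_le_const2[OF tendsto_norm[OF lim]]) (use X(1) in auto)
    moreover have "Y \<in> bops"
    proof (rule bopsI)
      fix c x
      have "(\<lambda>n. c *\<^sub>C X n x) \<longlonglongrightarrow> c *\<^sub>C Y x"
        by (rule bounded_linear.tendsto[OF bounded_linear_scaleC lim_ap])
      moreover have "(\<lambda>n. c *\<^sub>C X n x) = (\<lambda>n. X n (c *\<^sub>C x))"
        using X(2) by (simp add: bopsD)
      ultimately show "Y (c *\<^sub>C x) = c *\<^sub>C Y x"
        using lim_ap[of "c *\<^sub>C x"] LIMSEQ_unique by metis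
    qed
    moreover have "cinner (Y x) y = cinner x (Y y)" for x y
    proof (rule LIMSEQ_unique)
      show "(\<lambda>n. cinner (X n x) y) \<longlonglongrightarrow> cinner (Y x) y"
        by (intro tendsto_cinner_left lim_ap)
      show "(\<lambda>n. cinner (X n x) y) \<longlonglongrightarrow> cinner x (Y y)"
        using tendsto_cinner_right[OF lim_ap, of x y] by (simp add: X(3))
    qed
    moreover have "C o\<^sub>L Y = Y o\<^sub>L C" if C: "C o\<^sub>L Q = Q o\<^sub>L C" for C
    proof (rule LIMSEQ_unique)
      show "(\<lambda>n. C o\<^sub>L X n) \<longlonglongrightarrow> (C o\<^sub>L Y)"
        by (intro bounded_bilinear.tendsto[OF bounded_bilinear_blinfun_compose] tendsto_const lim)
      show "(\<lambda>n. C o\<^sub>L X n) \<longlonglongrightarrow> (Y o\<^sub>L C)"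
        unfolding X(4)[OF C]
        by (intro bounded_bilinear.tendsto[OF bounded_bilinear_blinfun_compose] tendsto_const lim)
    qed
    ultimately show "Y \<in> S" unfolding S_def mem_Collect_eq by blast
  qed
  then have "complete S" by (simp add: complete_eq_closed)
  moreover have "S \<noteq> {}"
  proof -
    have "0 \<in> S" using \<rho> by (auto simp: S_def bops_def intro!: blinfun_eqI)
    then show ?thesis by blast
  qed
  moreover have "f ` S \<subseteq> S"
  proof
    fix Z assume "Z \<in> f ` S"
    then obtain Y where Y: "Y \<in> S" and Z: "Z = f Y" by blast
    have nY: "norm Y \<le> \<rho>" and bY: "Y \<in> bops"
      and sY: "\<And>x y. cinner (Y x) y = cinner x (Y y)"
      and cY: "\<And>C. C o\<^sub>L Q = Q o\<^sub>L C \<Longrightarrow> C o\<^sub>L Y = Y o\<^sub>L C"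
      using Y unfolding S_def mem_Collect_eq by blast+
    have Zx: "Z x = (1/2) *\<^sub>R (Q x + Y (Y x))" for x
      by (simp add: Z f_def blinfun.scaleR_left blinfun.add_left)
    have "norm (Y o\<^sub>L Y) \<le> norm Y * norm Y" by (rule norm_blinfun_compose)
    also have "\<dots> \<le> \<rho> * \<rho>" by (intro mult_mono nY) (use \<rho> in auto)
    finally have "norm Z \<le> \<rho>"
      using norm_triangle_ineq[of Q "Y o\<^sub>L Y"] \<rho>2 by (simp add: Z f_def)
    moreover have "Z \<in> bops"
      by (rule bopsI)
        (simp add: Zx bopsD[OF bY] bopsD[OF Q(1)] scaleR_scaleC scaleC_add_right scaleC_scaleC mult.commute)
    moreover have "cinner (Z x) y = cinner x (Z y)" for x y
      by (simp add: Zx cinner_scaleR_left cinner_scaleR_right cinner_add_left cinner_add_right sY Q(2))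
    moreover have "C o\<^sub>L Z = Z o\<^sub>L C" if C: "C o\<^sub>L Q = Q o\<^sub>L C" for C
    proof (rule blinfun_eqI)
      fix x
      have "C (Q x) = Q (C x)" "\<And>x. C (Y x) = Y (C x)"
        using C cY[OF C] by (metis blinfun_apply_blinfun_compose)+
      then show "(C o\<^sub>L Z) x = (Z o\<^sub>L C) x"
        by (simp add: Zx blinfun.scaleR_right blinfun.add_right)
    qed
    ultimately show "Z \<in> S" unfolding S_def mem_Collect_eq by blast
  qed
  moreover have "dist (f Y) (f Z) \<le> \<rho> * dist Y Z" if "Y \<in> S" "Z \<in> S" for Y Z
  proof -
    have n: "norm Y \<le> \<rho>" "norm Z \<le> \<rho>" using that unfolding S_def mem_Collect_eq by blast+
    have "f Y - f Z = (1/2) *\<^sub>R ((Y o\<^sub>L (Y - Z)) + ((Y - Z) o\<^sub>L Z))"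
      by (rule blinfun_eqI)
        (simp add: f_def blinfun.scaleR_left blinfun.add_left blinfun.diff_left blinfun.diff_right algebra_simps)
    then have "norm (f Y - f Z) = (1/2) * norm ((Y o\<^sub>L (Y - Z)) + ((Y - Z) o\<^sub>L Z))" by simp
    also have "\<dots> \<le> (1/2) * (norm Y * norm (Y - Z) + norm (Y - Z) * norm Z)"
      by (intro mult_left_mono norm_triangle_mono norm_blinfun_compose) auto
    also have "\<dots> \<le> (1/2) * (\<rho> * norm (Y - Z) + norm (Y - Z) * \<rho>)"
      by (intro mult_left_mono add_mono mult_right_mono n) auto
    finally show ?thesis by (simp add: dist_norm)
  qed
  ultimately have "\<exists>!Y. Y \<in> S \<and> f Y = Y"
    using Banach_fix[of S \<rho> f] \<rho> by blast
  then obtain Y where Y: "Y \<in> S" "f Y = Y" by blast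
  have "2 *\<^sub>R Y = 2 *\<^sub>R f Y" using Y(2) by simp
  also have "\<dots> = Q + (Y o\<^sub>L Y)" by (simp add: f_def)
  finally have "2 *\<^sub>R Y = Q + (Y o\<^sub>L Y)" .
  moreover have "norm Y < 1" using Y(1) \<rho> unfolding S_def mem_Collect_eq by linarith
  ultimately show ?thesis using Y(1) unfolding S_def mem_Collect_eq by (intro that[of Y]) blast+
qed

text \<open>Uniqueness: a positive root \<open>P\<close> commutes with \<open>Q\<close>, which is
  \<open>I - P\<^sup>2\<close>, hence with the fixed point \<open>Y\<close> and with
  \<open>Z = I - Y\<close>. Then \<open>(Z + P) (Z - P)\<close> is 0, and \<open>Z + P\<close> is
  injective because \<open>Z\<close> is bounded below by \<open>1 - norm Y\<close>.\<close>

lemma sqrt_op_id_minus: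
  fixes Q :: "'a::complex_hilbert_space \<Rightarrow>\<^sub>L 'a"
  assumes Q: "Q \<in> bops" "\<And>x y. cinner (blinfun_apply Q x) y = cinner x (blinfun_apply Q y)"
    and norm_Q: "norm Q < 1"
  defines "R \<equiv> sqrt_op (id_blinfun - Q)"
  shows "R \<in> bops" "cinner (blinfun_apply R x) y = cinner x (blinfun_apply R y)"
    "R o\<^sub>L R = id_blinfun - Q"
proof -
  obtain Y where Y: "Y \<in> bops" "norm Y < 1" "\<And>x y. cinner (blinfun_apply Y x) y = cinner x (blinfun_apply Y y)"
    "\<And>C. C o\<^sub>L Q = Q o\<^sub>L C \<Longrightarrow> C o\<^sub>L Y = Y o\<^sub>L C"
    "2 *\<^sub>R Y = Q + (Y o\<^sub>L Y)"
    by (rule sqrt_fixed_point[OF assms(1-3)]) (rule that)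
  define Z where "Z = id_blinfun - Y"
  have Zx: "Z x = x - Y x" for x by (simp add: Z_def blinfun.diff_left)
  have YY: "Y (Y x) = 2 *\<^sub>R Y x - Q x" for x
    using arg_cong[OF Y(5), of "\<lambda>T. blinfun_apply T x"]
    by (simp add: blinfun.scaleR_left blinfun.add_left)
  have Zb: "Z \<in> bops" using Y(1) by (simp add: Z_def)
  have Zs: "cinner (Z x) y = cinner x (Z y)" for x y
    by (simp add: Zx cinner_diff_left cinner_diff_right Y(3))
  have ZZ: "Z o\<^sub>L Z = id_blinfun - Q"
    by (rule blinfun_eqI) (simp add: Zx blinfun.diff_right blinfun.diff_left YY scaleR_2)
  have Zpos: "(1 - norm Y) * (norm x)\<^sup>2 \<le> Re (cinner (Z x) x)" for x
  proof -
    have "Re (cinner (Y x) x) \<le> norm (Y x) * norm x"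
      using complex_Re_le_cmod cauchy_schwarz order_trans by blast
    also have "\<dots> \<le> (norm Y * norm x) * norm x" by (intro mult_right_mono norm_blinfun) simp
    finally show ?thesis by (simp add: Zx cinner_diff_left Re_cinner_self power2_eq_square algebra_simps)
  qed
  have "positive_op Z"
    unfolding positive_op_def
  proof (intro conjI allI)
    show "Im (cinner (Z x) x) = 0" for x
      using cinner_commute[of "Z x" x] by (simp add: Zs complex_eq_iff)
    show "0 \<le> Re (cinner (Z x) x)" for x
      using Zpos[of x] Y(2) by (smt (verit) mult_nonneg_nonneg zero_le_power2)
  qed (rule Zb)
  moreover have "P = Z" if P: "positive_op P" "P o\<^sub>L P = id_blinfun - Q" for P
  proof (rule blinfun_eqI)
    fix x
    have PP: "P (P x) = x - Q x" for x
      using arg_cong[OF P(2), of "\<lambda>T. blinfun_apply T x"] by (simp add: blinfun.diff_left)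
    have "P o\<^sub>L Q = Q o\<^sub>L P"
    proof (rule blinfun_eqI)
      fix x
      have "P (Q x) = P x - P (P (P x))" by (simp only: PP[of x] blinfun.diff_right) simp
      also have "\<dots> = Q (P x)" by (simp only: PP[of "P x"]) simp
      finally show "(P o\<^sub>L Q) x = (Q o\<^sub>L P) x" by simp
    qed
    then have "P o\<^sub>L Y = Y o\<^sub>L P" by (rule Y(4))
    then have PY: "P (Y x) = Y (P x)" for x by (metis blinfun_apply_blinfun_compose)
    define y where "y = Z x - P x"
    have "Z (Z x) = P (P x)" using arg_cong[OF ZZ, of "\<lambda>T. blinfun_apply T x"] PP by (simp add: blinfun.diff_left)
    then have "Z y + P y = 0"
      by (simp add: y_def blinfun.diff_right) (simp add: Zx blinfun.diff_right PY)
    then have "Re (cinner (Z y) y) + Re (cinner (P y) y) = 0"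
      by (metis cinner_add_left cinner_zero_left plus_complex.sel(1) zero_complex.sel(1))
    moreover have "0 \<le> Re (cinner (P y) y)" using P(1) by (simp add: positive_op_def)
    ultimately have "(1 - norm Y) * (norm y)\<^sup>2 \<le> 0" using Zpos[of y] by linarith
    then have "y = 0" using Y(2) by (simp add: mult_le_0_iff)
    then show "P x = Z x" by (simp add: y_def)
  qed
  ultimately have "R = Z"
    unfolding R_def sqrt_op_def using ZZ by (intro the_equality) blast+
  then show "R \<in> bops" "cinner (R x) y = cinner x (R y)" "R o\<^sub>L R = id_blinfun - Q"
    using Zb Zs ZZ by auto
qed

section \<open>Square-summable families\<close>

lemma scaleC_sum_left: "(\<Sum>i\<in>A. c i) *\<^sub>C x = (\<Sum>i\<in>A. c i *\<^sub>C (x :: 'a::complex_normed_vector))"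
  by (induction A rule: infinite_finite_induct) (auto simp: scaleC_add_left)

lemma coord_zero [simp]: "coord 0 i = 0"
  by (simp add: zero_ell2.rep_eq)

lemma coord_add [simp]: "coord (x + y) i = coord x i + coord y i"
  by (simp add: plus_ell2.rep_eq)

lemma coord_diff [simp]: "coord (x - y) i = coord x i - coord y i"
  by (simp add: minus_ell2.rep_eq)

lemma coord_scaleC [simp]: "coord (c *\<^sub>C x) i = c *\<^sub>C coord x i"
  by (simp add: scaleC_ell2.rep_eq)

lemma coord_scaleR [simp]: "coord (r *\<^sub>R x) i = r *\<^sub>R coord x i"
  by (simp add: scaleR_ell2.rep_eq)

lemma coord_sum: "coord (\<Sum>j\<in>A. f j) i = (\<Sum>j\<in>A. coord (f j) i)"
  by (induction A rule: infinite_finite_induct) auto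

lemma coord_ket: "coord (ket i) j = (if j = i then 1 else 0)"
  by (simp add: ket.rep_eq)

lemma coord_tensor [simp]: "coord (tensor \<xi> h) i = coord \<xi> i *\<^sub>C h"
  by (simp add: tensor.rep_eq)

lemma ell2_eqI: "(\<And>i. coord x i = coord y i) \<Longrightarrow> x = y"
  by (metis coord_inject ext)

lemma coord_Abs_ell2: "(\<lambda>i. (norm (f i))\<^sup>2) summable_on UNIV \<Longrightarrow> coord (Abs_ell2 f) = f"
  by (simp add: Abs_ell2_inverse)

lemma bounded_linear_coord: "bounded_linear (\<lambda>x. coord x i)"
  by (rule bounded_linear_intro[where K = 1]) (auto simp: norm_coord_le)

lemma norm_ell2_has_sum: "((\<lambda>i. (norm (coord x i))\<^sup>2) has_sum (norm x)\<^sup>2) UNIV"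
  using has_sum_infsum[OF summable_coord[of x]]
  by (simp add: norm_ell2.rep_eq infsum_nonneg)

lemma norm_ell2_sqr: "(norm x)\<^sup>2 = (\<Sum>\<^sub>\<infinity>i. (norm (coord x i))\<^sup>2)"
  using norm_ell2_has_sum by (metis infsumI)

lemma sum_coord_le_norm: "finite F \<Longrightarrow> (\<Sum>i\<in>F. (norm (coord x i))\<^sup>2) \<le> (norm x)\<^sup>2"
  unfolding norm_ell2_sqr by (intro finite_sum_le_infsum summable_coord) auto

lemma norm_ell2_le_sum:
  assumes "\<And>F. finite F \<Longrightarrow> (\<Sum>i\<in>F. (norm (coord x i))\<^sup>2) \<le> C\<^sup>2" "0 \<le> C"
  shows "norm x \<le> C"
proof (rule norm_ell2_le)
  fix F :: "'a set" assume "finite F"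
  then have "sqrt (\<Sum>i\<in>F. (norm (coord x i))\<^sup>2) \<le> sqrt (C\<^sup>2)"
    by (intro real_sqrt_le_mono assms(1))
  then show "L2_set (\<lambda>i. norm (coord x i)) F \<le> C" using assms(2) by (simp add: L2_set_def)
qed

lemma summable_L2_of_bounded_sums:
  assumes "\<And>F. finite F \<Longrightarrow> (\<Sum>i\<in>F. (norm (f i))\<^sup>2) \<le> C"
  shows "(\<lambda>i. (norm (f i))\<^sup>2) summable_on UNIV"
  by (rule nonneg_bounded_partial_sums_imp_summable_on[where C = C])
    (auto simp: assms eventually_finite_subsets_at_top)

lemma summable_L2_finite_support:
  "finite {i. f i \<noteq> 0} \<Longrightarrow> (\<lambda>i. (norm (f i))\<^sup>2) summable_on UNIV"
  by (rule finite_nonzero_values_imp_summable_on) simp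

text \<open>The squared distance from \<open>x\<close> to a finite partial sum is the tail of the
  sum for its squared norm. The expansion evaluates the infinite sum in
  \<open>poisson_kernel\<close> and shows that operators are determined by the vectors
  \<open>tensor (ket i) h\<close>.\<close>

lemma has_sum_tensor_ket: "((\<lambda>i. tensor (ket i) (coord x i)) has_sum x) UNIV"
proof -
  have coord_part: "coord (\<Sum>j\<in>F. tensor (ket j) (coord x j)) i = (if i \<in> F then coord x i else 0)"
    if "finite F" for F i
  proof -
    have "coord (\<Sum>j\<in>F. tensor (ket j) (coord x j)) i = (\<Sum>j\<in>F. if j = i then coord x j else 0)"
      unfolding coord_sum by (intro sum.cong) (auto simp: coord_ket)
    then show ?thesis using that by simp
  qed
  have "((\<lambda>F. (norm ((\<Sum>j\<in>F. tensor (ket j) (coord x j)) - x))\<^sup>2) \<longlongrightarrow> 0) (finite_subsets_at_top UNIV)"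
  proof -
    have "((\<lambda>F. (norm x)\<^sup>2 - (\<Sum>i\<in>F. (norm (coord x i))\<^sup>2)) \<longlongrightarrow> (norm x)\<^sup>2 - (norm x)\<^sup>2)
        (finite_subsets_at_top UNIV)"
      using norm_ell2_has_sum[of x] unfolding has_sum_def by (intro tendsto_diff tendsto_const)
    moreover have "\<forall>\<^sub>F F in finite_subsets_at_top UNIV. (norm x)\<^sup>2 - (\<Sum>i\<in>F. (norm (coord x i))\<^sup>2)
        = (norm ((\<Sum>j\<in>F. tensor (ket j) (coord x j)) - x))\<^sup>2"
    proof (rule eventually_finite_subsets_at_top_weakI)
      fix F :: "'a set" assume F: "finite F" "F \<subseteq> UNIV"
      have "((\<lambda>i. if i \<in> F then (norm (coord x i))\<^sup>2 else 0) has_sum (\<Sum>i\<in>F. (norm (coord x i))\<^sup>2)) UNIV"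
        by (rule has_sum_finite_neutralI[OF F]) auto
      then have "((\<lambda>i. (norm (coord x i))\<^sup>2 + - (if i \<in> F then (norm (coord x i))\<^sup>2 else 0))
          has_sum (norm x)\<^sup>2 + - (\<Sum>i\<in>F. (norm (coord x i))\<^sup>2)) UNIV"
        by (intro has_sum_add norm_ell2_has_sum has_sum_uminusI)
      moreover have "(norm (coord ((\<Sum>j\<in>F. tensor (ket j) (coord x j)) - x) i))\<^sup>2
          = (norm (coord x i))\<^sup>2 + - (if i \<in> F then (norm (coord x i))\<^sup>2 else 0)" for i
        by (simp add: coord_part[OF F(1)])
      ultimately show "(norm x)\<^sup>2 - (\<Sum>i\<in>F. (norm (coord x i))\<^sup>2)
        = (norm ((\<Sum>j\<in>F. tensor (ket j) (coord x j)) - x))\<^sup>2"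
        unfolding norm_ell2_sqr[of "_ - _"] by (simp add: infsumI)
    qed
    ultimately show ?thesis
      unfolding diff_self by (rule Lim_transform_eventually)
  qed
  from tendsto_real_sqrt[OF this]
  have "((\<lambda>F. (\<Sum>j\<in>F. tensor (ket j) (coord x j)) - x) \<longlongrightarrow> 0) (finite_subsets_at_top UNIV)"
    by (simp add: tendsto_norm_zero_iff)
  then show ?thesis unfolding has_sum_def by (simp add: LIM_zero_iff)
qed

lemma blinfun_eq_on_tensors:
  fixes S T :: "('i, 'h::complex_hilbert_space) ell2 \<Rightarrow>\<^sub>L 'b::real_normed_vector"
  assumes "\<And>i h. blinfun_apply S (tensor (ket i) h) = blinfun_apply T (tensor (ket i) h)"
  shows "S = T"
proof (rule blinfun_eqI)
  fix x
  note has_sum_bounded_linear[OF blinfun.bounded_linear_right has_sum_tensor_ket]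
  from this[of S x] this[of T x] show "S x = T x"
    unfolding assms by (rule has_sum_unique)
qed

text \<open>Multiplication operators, ampliations and the Poisson kernel are all known through their
  coordinates first. One bound on finite sets yields both square-summability of the values and the
  operator norm.\<close>

lemma coordinate_operator:
  fixes \<phi> :: "'a::complex_hilbert_space \<Rightarrow> 'i \<Rightarrow> 'b::complex_hilbert_space"
  assumes add: "\<And>x y i. \<phi> (x + y) i = \<phi> x i + \<phi> y i"
    and scale: "\<And>c x i. \<phi> (c *\<^sub>C x) i = c *\<^sub>C \<phi> x i"
    and bound: "\<And>x F. finite F \<Longrightarrow> (\<Sum>i\<in>F. (norm (\<phi> x i))\<^sup>2) \<le> (C * norm x)\<^sup>2"
    and C: "0 \<le> C"
  obtains T :: "'a \<Rightarrow>\<^sub>L ('i, 'b) ell2"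
    where "T \<in> bops" "\<And>x. coord (blinfun_apply T x) = \<phi> x" "norm T \<le> C"
proof -
  define T where "T x = Abs_ell2 (\<phi> x)" for x
  have coord_T: "coord (T x) = \<phi> x" for x
    unfolding T_def by (rule coord_Abs_ell2, rule summable_L2_of_bounded_sums, rule bound)
  have norm_T: "norm (T x) \<le> C * norm x" for x
    by (rule norm_ell2_le_sum) (auto simp: coord_T bound C)
  have "bounded_linear T"
  proof (rule bounded_linear_intro)
    show "T (x + y) = T x + T y" for x y by (rule ell2_eqI) (simp add: coord_T add)
    show "T (r *\<^sub>R x) = r *\<^sub>R T x" for r x
      by (rule ell2_eqI) (simp add: coord_T scaleR_scaleC scale)
    show "norm (T x) \<le> norm x * C" for x using norm_T[of x] by (simp add: mult.commute)
  qed
  note ap = bounded_linear_Blinfun_apply[OF this]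
  show ?thesis
  proof (rule that)
    show "Blinfun T \<in> bops" by (rule bopsI, rule ell2_eqI) (simp add: ap coord_T scale)
    show "coord (Blinfun T x) = \<phi> x" for x by (simp add: ap coord_T)
    show "norm (Blinfun T) \<le> C" by (rule norm_blinfun_bound) (auto simp: ap norm_T C)
  qed
qed

subsection \<open>Sums over words\<close>

lemma finite_words: "finite {\<alpha> :: 'n::finite list. length \<alpha> = k}"
  using finite_lists_length_eq[of "UNIV :: 'n set" k] by simp

lemma sum_words_Suc:
  "(\<Sum>\<alpha> | length (\<alpha> :: 'n::finite list) = Suc k. f \<alpha>) = (\<Sum>i\<in>UNIV. \<Sum>\<alpha> | length \<alpha> = k. f (i # \<alpha>))"
proof -
  have "{\<alpha> :: 'n list. length \<alpha> = Suc k} = (\<lambda>(i, \<alpha>). i # \<alpha>) ` (UNIV \<times> {\<alpha>. length \<alpha> = k})"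
    by (auto simp: length_Suc_conv image_iff)
  then have "(\<Sum>\<alpha> | length (\<alpha> :: 'n list) = Suc k. f \<alpha>)
      = (\<Sum>(i, \<alpha>)\<in>UNIV \<times> {\<alpha>. length \<alpha> = k}. f (i # \<alpha>))"
    by (simp add: sum.reindex inj_on_def case_prod_unfold)
  then show ?thesis by (simp add: sum.cartesian_product)
qed

lemma sum_words_snoc:
  "(\<Sum>\<alpha> | length (\<alpha> :: 'n::finite list) = Suc k. f \<alpha>) = (\<Sum>\<alpha> | length \<alpha> = k. \<Sum>i\<in>UNIV. f (\<alpha> @ [i]))"
proof -
  have "{\<alpha> :: 'n list. length \<alpha> = Suc k} = (\<lambda>(\<alpha>, i). \<alpha> @ [i]) ` ({\<alpha>. length \<alpha> = k} \<times> UNIV)"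
    by (auto simp: length_Suc_conv_rev image_iff)
  then have "(\<Sum>\<alpha> | length (\<alpha> :: 'n list) = Suc k. f \<alpha>)
      = (\<Sum>(\<alpha>, i)\<in>{\<alpha>. length \<alpha> = k} \<times> UNIV. f (\<alpha> @ [i]))"
    by (simp add: sum.reindex inj_on_def case_prod_unfold)
  then show ?thesis by (simp add: sum.cartesian_product)
qed

lemma has_sum_words_iff_Sigma:
  fixes f :: "'n list \<Rightarrow> 'a::{topological_comm_monoid_add, t3_space}"
  shows "(f has_sum s) UNIV \<longleftrightarrow> ((\<lambda>(k, \<alpha>). f \<alpha>) has_sum s) (SIGMA k:UNIV. {\<alpha>. length \<alpha> = k})"
  by (rule has_sum_reindex_bij_witness[where i = snd and j = "\<lambda>\<alpha>. (length \<alpha>, \<alpha>)"]) auto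

lemma has_sum_words_imp_sums:
  fixes f :: "'n::finite list \<Rightarrow> 'a::{topological_comm_monoid_add, t3_space}"
  assumes "(f has_sum s) UNIV"
  shows "(\<lambda>k. \<Sum>\<alpha> | length \<alpha> = k. f \<alpha>) sums s"
proof -
  have "((\<lambda>k. \<Sum>\<alpha> | length \<alpha> = k. f \<alpha>) has_sum s) UNIV"
    using assms unfolding has_sum_words_iff_Sigma
    by (rule has_sum_SigmaD[where f = "\<lambda>(k, \<alpha>). f \<alpha>"]) (simp add: finite_words has_sum_finiteI)
  then show ?thesis by (rule has_sum_imp_sums)
qed

text \<open>Grouping by length could hide cancellation inside a group, so the way back from a series
  over lengths to an unconditional sum is taken for nonnegative terms.\<close>

lemma sums_imp_has_sum_words:
  fixes f :: "'n::finite list \<Rightarrow> real"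
  assumes "(\<lambda>k. \<Sum>\<alpha> | length \<alpha> = k. f \<alpha>) sums s" "\<And>\<alpha>. 0 \<le> f \<alpha>"
  shows "(f has_sum s) UNIV"
proof -
  have s: "((\<lambda>k. \<Sum>\<alpha> | length \<alpha> = k. f \<alpha>) has_sum s) UNIV"
    by (rule sums_nonneg_imp_has_sum[OF assms(1)]) (simp add: sum_nonneg assms(2))
  have f: "(f has_sum (\<Sum>\<alpha> | length \<alpha> = k. f \<alpha>)) {\<alpha>. length \<alpha> = k}" for k
    by (simp add: finite_words has_sum_finiteI)
  have summable: "(\<lambda>(k, \<alpha>). f \<alpha>) summable_on (SIGMA k:UNIV. {\<alpha> :: 'n list. length \<alpha> = k})"
    by (rule summable_on_SigmaI[where f = "\<lambda>(k, \<alpha>). f \<alpha>", OF _ has_sum_imp_summable[OF s]])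
      (use f assms(2) in auto)
  show ?thesis
    unfolding has_sum_words_iff_Sigma
    by (rule has_sum_SigmaI[where f = "\<lambda>(k, \<alpha>). f \<alpha>", OF _ s summable]) (use f in simp)
qed

section \<open>Multiplication operators on the Fock space\<close>

text \<open>These are the coordinates of \<open>(L_f \<otimes> I) x\<close>. The sum over cut
  positions is finite, so the formula makes sense before \<open>f\<close> is known to be a
  multiplier.\<close>

definition conv :: "'n fock \<Rightarrow> ('n list, 'h::complex_hilbert_space) ell2 \<Rightarrow> 'n list \<Rightarrow> 'h" where
  "conv f x \<gamma> = (\<Sum>k\<le>length \<gamma>. coord f (take k \<gamma>) *\<^sub>C coord x (drop k \<gamma>))"

lemma fock_mult_eq_conv: "fock_mult f g = conv f g"
  by (rule ext) (simp add: fock_mult_def conv_def scaleC_complex_def)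

lemma conv_add_right: "conv f (x + y) \<gamma> = conv f x \<gamma> + conv f y \<gamma>"
  by (simp add: conv_def scaleC_add_right sum.distrib)

lemma conv_add_left: "conv (f + g) x \<gamma> = conv f x \<gamma> + conv g x \<gamma>"
  by (simp add: conv_def scaleC_add_left sum.distrib)

lemma conv_scaleC_right: "conv f (c *\<^sub>C x) \<gamma> = c *\<^sub>C conv f x \<gamma>"
  by (simp add: conv_def scaleC_scaleC scaleC_sum_right mult.commute)

lemma conv_scaleC_left: "conv (c *\<^sub>C f) x \<gamma> = c *\<^sub>C conv f x \<gamma>"
  by (simp add: conv_def scaleC_complex_def scaleC_scaleC scaleC_sum_right)

lemma conv_tensor: "conv f (tensor \<xi> h) \<gamma> = conv f \<xi> \<gamma> *\<^sub>C h"
  by (simp add: conv_def scaleC_complex_def scaleC_scaleC scaleC_sum_left)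

lemma Lmult_eqI:
  assumes "\<And>g. coord (blinfun_apply T g) = conv f g"
  shows "f \<in> F_infty" "Lmult f = T"
proof -
  show "f \<in> F_infty" using assms by (auto simp: F_infty_def fock_mult_eq_conv)
  show "Lmult f = T"
    unfolding Lmult_def
  proof (rule the_equality)
    show "\<forall>g. coord (T g) = fock_mult f g" by (simp add: assms fock_mult_eq_conv)
    show "S = T" if "\<forall>g. coord (blinfun_apply S g) = fock_mult f g" for S
      by (rule blinfun_eqI, rule ell2_eqI) (simp add: assms fock_mult_eq_conv that)
  qed
qed

lemma coord_Lmult:
  fixes f :: "'n::finite fock"
  assumes "f \<in> F_infty" shows "coord (blinfun_apply (Lmult f) g) = conv f g"
proof -
  obtain T :: "'n fock \<Rightarrow>\<^sub>L 'n fock" where T: "\<And>g. coord (blinfun_apply T g) = conv f g"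
    using assms unfolding F_infty_def fock_mult_eq_conv by blast
  show ?thesis unfolding Lmult_eqI(2)[of T, OF T] by (rule T)
qed

lemma Lmult_in_bops: "f \<in> F_infty \<Longrightarrow> Lmult f \<in> bops"
  by (rule bopsI, rule ell2_eqI) (simp add: coord_Lmult conv_scaleC_right)

lemma Lmult_of_bound:
  fixes f :: "'n::finite fock"
  assumes "\<And>(g :: 'n fock) F. finite F \<Longrightarrow> (\<Sum>\<gamma>\<in>F. (norm (conv f g \<gamma>))\<^sup>2) \<le> (C * norm g)\<^sup>2" "0 \<le> C"
  shows "f \<in> F_infty" "norm (Lmult f) \<le> C"
proof -
  obtain T :: "'n fock \<Rightarrow>\<^sub>L 'n fock" where T: "\<And>g. coord (blinfun_apply T g) = conv f g" "norm T \<le> C"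
  proof (rule coordinate_operator[of "conv f" C, OF conv_add_right conv_scaleC_right])
    show "(\<Sum>\<gamma>\<in>F. (norm (conv f g \<gamma>))\<^sup>2) \<le> (C * norm g)\<^sup>2" if "finite F" for g :: "'n fock" and F
      using that by (rule assms(1))
  qed (use assms(2) in auto)
  show "f \<in> F_infty" "norm (Lmult f) \<le> C" using Lmult_eqI[OF T(1)] T(2) by auto
qed

lemma conv_ket_Nil: "conv f (ket []) \<gamma> = coord f \<gamma>"
proof -
  have "conv f (ket []) \<gamma> = (\<Sum>k\<le>length \<gamma>. if k = length \<gamma> then coord f \<gamma> else 0)"
    unfolding conv_def by (intro sum.cong) (auto simp: coord_ket scaleC_complex_def)
  then show ?thesis by simp
qed

text \<open>The symbol is recovered at the vacuum vector, so \<open>Lmult\<close> is injective on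
  \<open>F_infty\<close>.\<close>

lemma Lmult_ket_Nil: "f \<in> F_infty \<Longrightarrow> blinfun_apply (Lmult f) (ket []) = f"
  by (rule ell2_eqI) (simp add: coord_Lmult conv_ket_Nil)

text \<open>Only finitely many vectors enter \<open>conv f x\<close> on a finite set of words. Expanding them in an
  orthonormal basis of their span reduces the vector-valued bound to the scalar one.\<close>

lemma conv_bound:
  assumes f: "f \<in> F_infty" and F: "finite F"
  shows "(\<Sum>\<gamma>\<in>F. (norm (conv f x \<gamma>))\<^sup>2) \<le> (norm (Lmult f) * norm x)\<^sup>2"
proof -
  define B where "B = (\<Union>\<gamma>\<in>F. (\<lambda>k. drop k \<gamma>) ` {..length \<gamma>})"
  have B: "finite B" using F by (simp add: B_def)
  obtain E where E: "finite E" "orthonormal E"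
      and exp: "\<And>\<beta>. \<beta> \<in> B \<Longrightarrow> coord x \<beta> = (\<Sum>e\<in>E. cinner (coord x \<beta>) e *\<^sub>C e)"
    using finite_orthonormal_basis[of "coord x ` B"] B by auto
  \<comment> \<open>Truncating to \<open>B\<close> controls the norms: by Parseval at each word of
    \<open>B\<close>, the squared norms of the \<open>g e\<close> add up to the part of
    \<open>(norm x)\<^sup>2\<close> carried by \<open>B\<close>.\<close>
  define g where "g e = Abs_ell2 (\<lambda>\<beta>. if \<beta> \<in> B then cinner (coord x \<beta>) e else 0)" for e
  have coord_g: "coord (g e) = (\<lambda>\<beta>. if \<beta> \<in> B then cinner (coord x \<beta>) e else 0)" for e
    unfolding g_def
    by (intro coord_Abs_ell2 summable_L2_finite_support finite_subset[OF _ B]) auto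
  have norm_g: "(norm (g e))\<^sup>2 = (\<Sum>\<beta>\<in>B. (cmod (cinner (coord x \<beta>) e))\<^sup>2)" for e
  proof -
    have "((\<lambda>\<beta>. (norm (coord (g e) \<beta>))\<^sup>2) has_sum (\<Sum>\<beta>\<in>B. (cmod (cinner (coord x \<beta>) e))\<^sup>2)) UNIV"
      by (rule has_sum_finite_neutralI[OF B]) (auto simp: coord_g)
    then show ?thesis by (metis infsumI norm_ell2_sqr)
  qed
  have cinner_conv: "cinner (conv f x \<gamma>) e = conv f (g e) \<gamma>" if "\<gamma> \<in> F" for \<gamma> e
    unfolding conv_def cinner_sum_left
    using that by (intro sum.cong) (auto simp: cinner_scaleC_left coord_g B_def scaleC_complex_def)
  have "(norm (conv f x \<gamma>))\<^sup>2 = (\<Sum>e\<in>E. (norm (conv f (g e) \<gamma>))\<^sup>2)" if \<gamma>: "\<gamma> \<in> F" for \<gamma>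
  proof -
    have "conv f x \<gamma> = (\<Sum>k\<le>length \<gamma>. coord f (take k \<gamma>) *\<^sub>C (\<Sum>e\<in>E. cinner (coord x (drop k \<gamma>)) e *\<^sub>C e))"
      unfolding conv_def using \<gamma> by (intro sum.cong arg_cong2[of _ _ _ _ scaleC] refl exp) (auto simp: B_def)
    also have "\<dots> = (\<Sum>e\<in>E. (\<Sum>k\<le>length \<gamma>. coord f (take k \<gamma>) * cinner (coord x (drop k \<gamma>)) e) *\<^sub>C e)"
      by (simp add: scaleC_sum_right scaleC_scaleC scaleC_sum_left sum.swap[of _ E])
    finally have "conv f x \<gamma> = (\<Sum>e\<in>E. cinner (conv f x \<gamma>) e *\<^sub>C e)"
      by (rule orthonormal_expansionI[OF E])
    from norm_orthonormal_expansion[OF E this] show ?thesis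
      by (simp only: cinner_conv[OF \<gamma>])
  qed
  then have "(\<Sum>\<gamma>\<in>F. (norm (conv f x \<gamma>))\<^sup>2) = (\<Sum>\<gamma>\<in>F. \<Sum>e\<in>E. (norm (conv f (g e) \<gamma>))\<^sup>2)"
    by simp
  also have "\<dots> = (\<Sum>e\<in>E. \<Sum>\<gamma>\<in>F. (norm (coord (Lmult f (g e)) \<gamma>))\<^sup>2)"
    by (subst sum.swap) (simp add: coord_Lmult[OF f])
  also have "\<dots> \<le> (\<Sum>e\<in>E. (norm (Lmult f) * norm (g e))\<^sup>2)"
    by (intro sum_mono order_trans[OF sum_coord_le_norm[OF F]] power_mono norm_blinfun) auto
  also have "\<dots> = (norm (Lmult f))\<^sup>2 * (\<Sum>e\<in>E. \<Sum>\<beta>\<in>B. (cmod (cinner (coord x \<beta>) e))\<^sup>2)"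
    by (simp add: power_mult_distrib norm_g sum_distrib_left)
  also have "\<dots> = (norm (Lmult f))\<^sup>2 * (\<Sum>\<beta>\<in>B. (norm (coord x \<beta>))\<^sup>2)"
    by (subst sum.swap) (simp add: norm_orthonormal_expansion[OF E exp] cong: sum.cong)
  also have "\<dots> \<le> (norm (Lmult f))\<^sup>2 * (norm x)\<^sup>2"
    by (intro mult_left_mono sum_coord_le_norm B) auto
  finally show ?thesis by (simp add: power_mult_distrib)
qed

text \<open>The vector-valued Cauchy product acts correctly on tensors, and tensors with basis
  vectors determine an operator, so it is the ampliation. Its boundedness is
  \<open>conv_bound\<close>.\<close>

lemma ampl_Lmult:
  fixes f :: "'n::finite fock"
  assumes "f \<in> F_infty"
  defines "T \<equiv> ampl (Lmult f) :: ('n list, 'h::complex_hilbert_space) ell2 \<Rightarrow>\<^sub>L ('n list, 'h) ell2"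
  shows "coord (blinfun_apply T x) = conv f x" "norm T \<le> norm (Lmult f)" "T \<in> bops"
proof -
  obtain S :: "('n list, 'h) ell2 \<Rightarrow>\<^sub>L ('n list, 'h) ell2"
    where S: "\<And>x. coord (blinfun_apply S x) = conv f x" "norm S \<le> norm (Lmult f)" "S \<in> bops"
  proof (rule coordinate_operator[of "conv f :: ('n list, 'h) ell2 \<Rightarrow> _" "norm (Lmult f)",
        OF conv_add_right conv_scaleC_right])
    show "(\<Sum>\<gamma>\<in>F. (norm (conv f x \<gamma>))\<^sup>2) \<le> (norm (Lmult f) * norm x)\<^sup>2"
      if "finite F" for x :: "('n list, 'h) ell2" and F
      using assms(1) that by (rule conv_bound)
  qed auto
  have tensor: "S (tensor \<xi> h) = tensor (Lmult f \<xi>) h" for \<xi> h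
    by (rule ell2_eqI) (simp add: S(1) coord_Lmult[OF assms(1)] conv_tensor)
  have "T = S"
    unfolding T_def ampl_def
  proof (rule the_equality)
    show "S' = S" if "\<forall>\<xi> h. blinfun_apply S' (tensor \<xi> h) = tensor (Lmult f \<xi>) h" for S'
      by (rule blinfun_eq_on_tensors) (simp add: that tensor)
  qed (simp add: tensor)
  then show "coord (T x) = conv f x" "norm T \<le> norm (Lmult f)" "T \<in> bops" using S by auto
qed

section \<open>The Poisson kernel\<close>

lemma word_op_append: "word_op X (\<alpha> @ \<beta>) = word_op X \<alpha> o\<^sub>L word_op X \<beta>"
  by (induction \<alpha>) (auto intro!: blinfun_eqI)

lemma word_op_in_bops: "(\<And>i. X i \<in> bops) \<Longrightarrow> word_op X \<alpha> \<in> bops"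
  by (induction \<alpha>) auto

lemma row_ball_in_bops: "X \<in> row_ball \<Longrightarrow> X i \<in> bops"
  by (simp add: row_ball_def)

lemmas row_ball_word_op = word_op_in_bops[OF row_ball_in_bops]

lemma cadj_word_op_append:
  assumes "X \<in> row_ball"
  shows "blinfun_apply (cadj (word_op X (\<alpha> @ \<beta>))) h
    = blinfun_apply (cadj (word_op X \<beta>)) (blinfun_apply (cadj (word_op X \<alpha>)) h)"
  by (simp add: word_op_append cadj_compose row_ball_word_op[OF assms])

lemma cadj_word_op_Cons:
  assumes "X \<in> row_ball"
  shows "blinfun_apply (cadj (word_op X (i # \<alpha>))) h
    = blinfun_apply (cadj (word_op X \<alpha>)) (blinfun_apply (cadj (X i)) h)"
  by (simp add: cadj_compose row_ball_in_bops[OF assms] row_ball_word_op[OF assms])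

lemma cinner_row_gram:
  assumes "X \<in> row_ball"
  shows "cinner (blinfun_apply (\<Sum>i\<in>UNIV. X i o\<^sub>L cadj (X i)) x) y
    = (\<Sum>i\<in>UNIV. cinner (blinfun_apply (cadj (X i)) x) (blinfun_apply (cadj (X i)) y))"
  by (simp add: blinfun.sum_left cinner_sum_left cinner_cadj[OF row_ball_in_bops[OF assms]])

lemma row_ball_norm_less: "X \<in> row_ball \<Longrightarrow> norm (\<Sum>i\<in>UNIV. X i o\<^sub>L cadj (X i)) < 1"
  by (simp add: row_ball_def)

lemma sum_norm_cadj_le:
  assumes "X \<in> row_ball"
  shows "(\<Sum>i\<in>UNIV. (norm (blinfun_apply (cadj (X i)) x))\<^sup>2)
    \<le> norm (\<Sum>i\<in>UNIV. X i o\<^sub>L cadj (X i)) * (norm x)\<^sup>2"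
proof -
  let ?Q = "\<Sum>i\<in>UNIV. X i o\<^sub>L cadj (X i)"
  have "(\<Sum>i\<in>UNIV. (norm (cadj (X i) x))\<^sup>2) = Re (cinner (?Q x) x)"
    unfolding cinner_row_gram[OF assms] by (simp add: Re_cinner_self)
  also have "\<dots> \<le> norm (?Q x) * norm x"
    using complex_Re_le_cmod cauchy_schwarz order_trans by blast
  also have "\<dots> \<le> (norm ?Q * norm x) * norm x"
    by (intro mult_right_mono norm_blinfun) simp
  finally show ?thesis by (simp add: power2_eq_square)
qed

lemma defect_props:
  assumes "X \<in> row_ball"
  shows "defect X \<in> bops"
    "(norm (blinfun_apply (defect X) x))\<^sup>2
      = (norm x)\<^sup>2 - (\<Sum>i\<in>UNIV. (norm (blinfun_apply (cadj (X i)) x))\<^sup>2)"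
proof -
  let ?Q = "\<Sum>i\<in>UNIV. X i o\<^sub>L cadj (X i)"
  have Q: "?Q \<in> bops" by (intro sum_in_bops) (simp add: row_ball_in_bops[OF assms])
  have self: "cinner (?Q x) y = cinner x (?Q y)" for x y
  proof -
    have "cinner x (?Q y) = cnj (cinner (?Q y) x)" by (rule cinner_commute)
    then show ?thesis
      unfolding cinner_row_gram[OF assms] cnj_sum by (simp flip: cinner_commute)
  qed
  note D = sqrt_op_id_minus[OF Q self row_ball_norm_less[OF assms], folded defect_def]
  show "defect X \<in> bops" by (rule D(1))
  have "(norm (defect X x))\<^sup>2 = Re (cinner x (defect X (defect X x)))"
    by (metis D(2) Re_cinner_self)
  also have "defect X (defect X x) = x - ?Q x"
    using arg_cong[OF D(3), of "\<lambda>T. blinfun_apply T x"] by (simp add: blinfun.diff_left)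
  also have "Re (cinner x (x - ?Q x)) = (norm x)\<^sup>2 - Re (cinner (?Q x) x)"
    by (simp only: cinner_diff_right minus_complex.sel Re_cinner_self self)
  also have "Re (cinner (?Q x) x) = (\<Sum>i\<in>UNIV. (norm (cadj (X i) x))\<^sup>2)"
    unfolding cinner_row_gram[OF assms] by (simp add: Re_cinner_self)
  finally show "(norm (defect X x))\<^sup>2 = (norm x)\<^sup>2 - (\<Sum>i\<in>UNIV. (norm (cadj (X i) x))\<^sup>2)" .
qed

text \<open>The adjoint reverses products, so removing the first letter \<open>i\<close> replaces
  \<open>x\<close> by \<open>cadj (X i) x\<close>; hence the induction keeps \<open>x\<close>
  arbitrary. Strictness of the row makes the bound geometric.\<close>

lemma sum_words_cadj_le:
  assumes "X \<in> row_ball"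
  shows "(\<Sum>\<alpha> | length \<alpha> = k. (norm (blinfun_apply (cadj (word_op X \<alpha>)) x))\<^sup>2)
    \<le> norm (\<Sum>i\<in>UNIV. X i o\<^sub>L cadj (X i)) ^ k * (norm x)\<^sup>2"
proof (induction k arbitrary: x)
  case 0
  then show ?case by simp
next
  case (Suc k)
  let ?q = "norm (\<Sum>i\<in>UNIV. X i o\<^sub>L cadj (X i))"
  have "(\<Sum>\<alpha> | length \<alpha> = Suc k. (norm (cadj (word_op X \<alpha>) x))\<^sup>2)
      = (\<Sum>i\<in>UNIV. \<Sum>\<alpha> | length \<alpha> = k. (norm (cadj (word_op X \<alpha>) (cadj (X i) x)))\<^sup>2)"
    by (simp only: sum_words_Suc cadj_word_op_Cons[OF assms])
  also have "\<dots> \<le> (\<Sum>i\<in>UNIV. ?q ^ k * (norm (cadj (X i) x))\<^sup>2)"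
    by (intro sum_mono Suc.IH)
  also have "\<dots> = ?q ^ k * (\<Sum>i\<in>UNIV. (norm (cadj (X i) x))\<^sup>2)" by (simp add: sum_distrib_left)
  also have "\<dots> \<le> ?q ^ k * (?q * (norm x)\<^sup>2)"
    by (intro mult_left_mono sum_norm_cadj_le assms) simp
  finally show ?case by (simp add: mult_ac)
qed

lemma summable_words_cadj:
  assumes "X \<in> row_ball"
  shows "(\<lambda>\<alpha>. (norm (blinfun_apply (cadj (word_op X \<alpha>)) x))\<^sup>2) summable_on UNIV"
proof -
  have "summable (\<lambda>k. \<Sum>\<alpha> | length \<alpha> = k. (norm (cadj (word_op X \<alpha>) x))\<^sup>2)"
  proof (rule summable_comparison_test')
    show "summable (\<lambda>k. norm (\<Sum>i\<in>UNIV. X i o\<^sub>L cadj (X i)) ^ k * (norm x)\<^sup>2)"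
      using row_ball_norm_less[OF assms] by (intro summable_mult2 summable_geometric) simp
    show "norm (\<Sum>\<alpha> | length \<alpha> = k. (norm (cadj (word_op X \<alpha>) x))\<^sup>2)
        \<le> norm (\<Sum>i\<in>UNIV. X i o\<^sub>L cadj (X i)) ^ k * (norm x)\<^sup>2" for k
      using sum_words_cadj_le[OF assms] by (simp add: sum_nonneg)
  qed
  from sums_imp_has_sum_words[OF summable_sums[OF this]] show ?thesis
    by (simp add: has_sum_imp_summable)
qed

text \<open>Telescoping: the words of length \<open>k\<close> contribute
  \<open>s k - s (Suc k)\<close>, where \<open>s k\<close> collects the squared norms of the adjoint
  words applied to \<open>x\<close>, and \<open>s k\<close> tends to 0 geometrically. This is why
  the kernel is isometric.\<close>

lemma has_sum_defect_words:
  assumes "X \<in> row_ball"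
  shows "((\<lambda>\<alpha>. (norm (blinfun_apply (defect X) (blinfun_apply (cadj (word_op X \<alpha>)) x)))\<^sup>2)
    has_sum (norm x)\<^sup>2) UNIV"
proof (rule sums_imp_has_sum_words)
  define s where "s k = (\<Sum>\<alpha> | length \<alpha> = k. (norm (cadj (word_op X \<alpha>) x))\<^sup>2)" for k
  have single: "word_op X [i] = X i" for i by (rule blinfun_eqI) simp
  \<comment> \<open>Here the new letter is appended on the right, because its adjoint has to act
    after the adjoint word.\<close>
  have s_Suc: "s (Suc k) = (\<Sum>\<alpha> | length \<alpha> = k. \<Sum>i\<in>UNIV. (norm (cadj (X i) (cadj (word_op X \<alpha>) x)))\<^sup>2)" for k
    by (simp only: s_def sum_words_snoc cadj_word_op_append[OF assms] single)
  have "s \<longlonglongrightarrow> 0"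
  proof (rule tendsto_sandwich[OF always_eventually always_eventually])
    show "\<forall>k. 0 \<le> s k" by (simp add: s_def sum_nonneg)
    show "\<forall>k. s k \<le> norm (\<Sum>i\<in>UNIV. X i o\<^sub>L cadj (X i)) ^ k * (norm x)\<^sup>2"
      by (simp add: s_def sum_words_cadj_le[OF assms])
    show "(\<lambda>k. norm (\<Sum>i\<in>UNIV. X i o\<^sub>L cadj (X i)) ^ k * (norm x)\<^sup>2) \<longlonglongrightarrow> 0"
      using row_ball_norm_less[OF assms] by (intro tendsto_mult_left_zero LIMSEQ_power_zero) simp
  qed simp
  then have "(\<lambda>k. s k - s (Suc k)) sums (s 0 - 0)" by (rule telescope_sums')
  moreover have "s k - s (Suc k) = (\<Sum>\<alpha> | length \<alpha> = k. (norm (defect X (cadj (word_op X \<alpha>) x)))\<^sup>2)" for k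
    unfolding s_Suc by (simp add: s_def defect_props(2)[OF assms] sum_subtractf)
  moreover have "s 0 = (norm x)\<^sup>2" by (simp add: s_def)
  ultimately show "(\<lambda>k. \<Sum>\<alpha> | length \<alpha> = k. (norm (defect X (cadj (word_op X \<alpha>) x)))\<^sup>2) sums (norm x)\<^sup>2"
    by simp
qed simp

text \<open>The sum in the definition is the basis expansion of an operator built from its
  coordinates; \<open>has_sum_defect_words\<close> makes that operator bounded and, being an
  equality, isometric.\<close>

lemma poisson_kernel_props:
  assumes "X \<in> row_ball"
  shows "poisson_kernel X \<in> bops"
    "coord (blinfun_apply (poisson_kernel X) h) \<alpha>
      = blinfun_apply (defect X) (blinfun_apply (cadj (word_op X \<alpha>)) h)"
    "norm (blinfun_apply (poisson_kernel X) h) = norm h"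
proof -
  let ?\<phi> = "\<lambda>h \<alpha>. defect X (cadj (word_op X \<alpha>) h)"
  note W = row_ball_word_op[OF assms] and D = defect_props(1)[OF assms]
  obtain K where K: "K \<in> bops" "\<And>h. coord (blinfun_apply K h) = ?\<phi> h"
  proof (rule coordinate_operator[of ?\<phi> 1])
    show "?\<phi> (c *\<^sub>C h) \<alpha> = c *\<^sub>C ?\<phi> h \<alpha>" for c h \<alpha>
      by (simp add: bopsD[OF cadj_in_bops[OF W]] bopsD[OF D])
    show "(\<Sum>\<alpha>\<in>F. (norm (?\<phi> h \<alpha>))\<^sup>2) \<le> (1 * norm h)\<^sup>2" if "finite F" for h F
      using finite_sum_le_has_sum[OF has_sum_defect_words[OF assms] that] by simp
  qed (auto simp: blinfun.add_right)
  have "(\<Sum>\<^sub>\<infinity>\<alpha>. tensor (ket \<alpha>) (?\<phi> h \<alpha>)) = K h" for h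
    using has_sum_tensor_ket[of "K h"] unfolding K(2) by (rule infsumI)
  then have PK: "poisson_kernel X = K"
    unfolding poisson_kernel_def by (simp add: blinfun_apply_inverse)
  show "poisson_kernel X \<in> bops" "coord (poisson_kernel X h) \<alpha> = ?\<phi> h \<alpha>"
    using K by (auto simp: PK)
  have "(norm (K h))\<^sup>2 = (norm h)\<^sup>2"
    using norm_ell2_has_sum[of "K h"] has_sum_defect_words[OF assms, of h]
    unfolding K(2) by (rule has_sum_unique)
  then show "norm (poisson_kernel X h) = norm h" by (simp add: PK)
qed

section \<open>Norm bound and power series of the Poisson transform\<close>

lemma cinner_poisson:
  assumes "X \<in> row_ball"
  shows "cinner (blinfun_apply (poisson A X) h) h'
    = cinner (blinfun_apply (ampl A) (blinfun_apply (poisson_kernel X) h))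
        (blinfun_apply (poisson_kernel X) h')"
  by (simp add: poisson_def cinner_cadj_left[OF poisson_kernel_props(1)[OF assms]])

lemma norm_poisson_Lmult_le:
  assumes "X \<in> row_ball" "f \<in> F_infty"
  shows "norm (poisson (Lmult f) X) \<le> norm (Lmult f)"
proof (rule norm_blinfun_bound)
  note K = poisson_kernel_props(3)[OF assms(1)]
  show "norm (poisson (Lmult f) X h) \<le> norm (Lmult f) * norm h" for h
  proof (rule norm_le_cinner_bound)
    fix h'
    have "cmod (cinner (poisson (Lmult f) X h) h')
        \<le> norm (ampl (Lmult f) (poisson_kernel X h)) * norm (poisson_kernel X h')"
      unfolding cinner_poisson[OF assms(1)] by (rule cauchy_schwarz)
    also have "\<dots> \<le> (norm (Lmult f) * norm (poisson_kernel X h)) * norm (poisson_kernel X h')"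
      by (intro mult_right_mono order_trans[OF norm_blinfun] ampl_Lmult(2)[OF assms(2)]) auto
    finally show "cmod (cinner (poisson (Lmult f) X h) h') \<le> norm (Lmult f) * norm h * norm h'"
      by (simp add: K)
  qed simp
qed simp

lemma cinner_ell2_has_sum: "((\<lambda>i. cinner (coord x i) (coord y i)) has_sum cinner x y) UNIV"
  unfolding cinner_ell2.rep_eq by (rule has_sum_infsum[OF summable_cinner])

text \<open>Both sides are iterated sums of the family
  \<open>f\<^sub>\<alpha> \<langle>(K h)\<^sub>\<beta>, (K h')\<^sub>\<alpha>\<^sub>\<beta>\<rangle>\<close> over pairs of words, which is absolutely summable because
  \<open>(K h')\<^sub>\<alpha>\<^sub>\<beta> = (K X\<^sub>\<alpha>\<^sup>* h')\<^sub>\<beta>\<close> and \<open>K\<close> is isometric.\<close>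

lemma poisson_Lmult_weak_sums:
  fixes X :: "'n::finite \<Rightarrow> ('h::complex_hilbert_space \<Rightarrow>\<^sub>L 'h)"
  assumes X: "X \<in> row_ball" and f: "f \<in> F_infty"
  shows "(\<lambda>k. \<Sum>\<alpha> | length \<alpha> = k. coord f \<alpha> * cinner (blinfun_apply (word_op X \<alpha>) h) h')
    sums cinner (blinfun_apply (poisson (Lmult f) X) h) h'"
proof -
  define x where "x = poisson_kernel X h"
  define y where "y = poisson_kernel X h'"
  define c where "c = (\<lambda>(\<alpha>, \<beta>). cinner (coord f \<alpha> *\<^sub>C coord x \<beta>) (coord y (\<alpha> @ \<beta>)))"
  have y_append: "coord y (\<alpha> @ \<beta>) = coord (poisson_kernel X (cadj (word_op X \<alpha>) h')) \<beta>" for \<alpha> \<beta>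
    by (simp add: y_def poisson_kernel_props(2)[OF X] cadj_word_op_append[OF X])
  \<comment> \<open>An inner product is estimated by a sum of two squares, so it is enough that each
    family of squares is summable over pairs of words.\<close>
  have 1: "(\<lambda>(\<alpha>, \<beta>). (cmod (coord f \<alpha>))\<^sup>2 * (norm (coord x \<beta>))\<^sup>2) summable_on UNIV \<times> UNIV"
  proof (rule summable_on_SigmaI)
    show "((\<lambda>\<beta>. case (\<alpha>, \<beta>) of (\<alpha>, \<beta>) \<Rightarrow> (cmod (coord f \<alpha>))\<^sup>2 * (norm (coord x \<beta>))\<^sup>2)
        has_sum (cmod (coord f \<alpha>))\<^sup>2 * (norm x)\<^sup>2) UNIV" for \<alpha>
      by (simp add: has_sum_cmult_right norm_ell2_has_sum)
    show "(\<lambda>\<alpha>. (cmod (coord f \<alpha>))\<^sup>2 * (norm x)\<^sup>2) summable_on UNIV"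
      by (intro summable_on_cmult_left summable_coord)
  qed auto
  have 2: "(\<lambda>(\<alpha>, \<beta>). (norm (coord y (\<alpha> @ \<beta>)))\<^sup>2) summable_on UNIV \<times> UNIV"
  proof (rule summable_on_SigmaI)
    show "((\<lambda>\<beta>. case (\<alpha>, \<beta>) of (\<alpha>, \<beta>) \<Rightarrow> (norm (coord y (\<alpha> @ \<beta>)))\<^sup>2)
        has_sum (norm (cadj (word_op X \<alpha>) h'))\<^sup>2) UNIV" for \<alpha>
      using norm_ell2_has_sum[of "poisson_kernel X (cadj (word_op X \<alpha>) h')"]
      by (simp add: y_append poisson_kernel_props(3)[OF X])
    show "(\<lambda>\<alpha>. (norm (cadj (word_op X \<alpha>) h'))\<^sup>2) summable_on UNIV"
      by (rule summable_words_cadj[OF X])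
  qed auto
  have "(\<lambda>p. norm (c p)) summable_on UNIV \<times> UNIV"
  proof (rule summable_on_comparison_test[OF summable_on_add[OF 1 2]])
    show "norm (c p) \<le> (case p of (\<alpha>, \<beta>) \<Rightarrow> (cmod (coord f \<alpha>))\<^sup>2 * (norm (coord x \<beta>))\<^sup>2)
        + (case p of (\<alpha>, \<beta>) \<Rightarrow> (norm (coord y (\<alpha> @ \<beta>)))\<^sup>2)" for p
      unfolding c_def case_prod_unfold
      by (rule order_trans[OF norm_cinner_le]) (simp add: norm_scaleC power_mult_distrib)
  qed simp
  then have "c summable_on UNIV \<times> UNIV" by (rule abs_summable_summable)
  then obtain S where S: "(c has_sum S) (UNIV \<times> UNIV)" by (auto simp: summable_on_def)
  have "((\<lambda>\<alpha>. coord f \<alpha> * cinner (word_op X \<alpha> h) h') has_sum S) UNIV"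
  proof (rule has_sum_SigmaD[OF S])
    fix \<alpha>
    have "((\<lambda>\<beta>. coord f \<alpha> * cinner (coord x \<beta>) (coord (poisson_kernel X (cadj (word_op X \<alpha>) h')) \<beta>))
        has_sum coord f \<alpha> * cinner x (poisson_kernel X (cadj (word_op X \<alpha>) h'))) UNIV"
      by (intro has_sum_cmult_right cinner_ell2_has_sum)
    also have "cinner x (poisson_kernel X (cadj (word_op X \<alpha>) h')) = cinner (word_op X \<alpha> h) h'"
      unfolding x_def isometry_cinner[OF poisson_kernel_props(1,3)[OF X]]
      by (rule cinner_cadj[OF row_ball_word_op[OF X], symmetric])
    finally show "((\<lambda>\<beta>. c (\<alpha>, \<beta>)) has_sum coord f \<alpha> * cinner (word_op X \<alpha> h) h') UNIV"
      by (simp add: c_def cinner_scaleC_left y_append)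
  qed
  then have sums: "(\<lambda>k. \<Sum>\<alpha> | length \<alpha> = k. coord f \<alpha> * cinner (word_op X \<alpha> h) h') sums S"
    by (rule has_sum_words_imp_sums)
  \<comment> \<open>A pair of words is the same as its concatenation with a cut position; regrouping
    by the concatenation produces the Cauchy product.\<close>
  have "((\<lambda>(\<gamma>, k). c (take k \<gamma>, drop k \<gamma>)) has_sum S) (SIGMA \<gamma>:UNIV. {..length \<gamma>})
      \<longleftrightarrow> (c has_sum S) (UNIV \<times> UNIV)"
    by (rule has_sum_reindex_bij_witness[where i = "\<lambda>(\<alpha>, \<beta>). (\<alpha> @ \<beta>, length \<alpha>)"
          and j = "\<lambda>(\<gamma>, k). (take k \<gamma>, drop k \<gamma>)"]) auto
  with S have S': "((\<lambda>(\<gamma>, k). c (take k \<gamma>, drop k \<gamma>)) has_sum S) (SIGMA \<gamma>:UNIV. {..length \<gamma>})" by simp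
  have "((\<lambda>\<gamma>. cinner (conv f x \<gamma>) (coord y \<gamma>)) has_sum S) UNIV"
  proof (rule has_sum_SigmaD[OF S'])
    show "((\<lambda>k. case (\<gamma>, k) of (\<gamma>, k) \<Rightarrow> c (take k \<gamma>, drop k \<gamma>))
        has_sum cinner (conv f x \<gamma>) (coord y \<gamma>)) {..length \<gamma>}" for \<gamma>
      by (rule has_sum_finiteI) (auto simp: conv_def cinner_sum_left c_def)
  qed
  moreover have "((\<lambda>\<gamma>. cinner (conv f x \<gamma>) (coord y \<gamma>)) has_sum cinner (ampl (Lmult f) x) y) UNIV"
    using cinner_ell2_has_sum[of "ampl (Lmult f) x" y] by (simp add: ampl_Lmult(1)[OF f])
  ultimately have "S = cinner (poisson (Lmult f) X h) h'"
    unfolding cinner_poisson[OF X] x_def[symmetric] y_def[symmetric] by (rule has_sum_unique)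
  with sums show ?thesis by simp
qed

section \<open>The algebra of multiplication operators\<close>

lemma F_infty_add:
  assumes "f \<in> F_infty" "g \<in> F_infty"
  shows "f + g \<in> F_infty" "Lmult (f + g) = Lmult f + Lmult g"
proof -
  have "coord ((Lmult f + Lmult g) h) = conv (f + g) h" for h
    by (rule ext) (simp add: blinfun.add_left coord_Lmult assms conv_add_left)
  then show "f + g \<in> F_infty" "Lmult (f + g) = Lmult f + Lmult g" by (rule Lmult_eqI)+
qed

lemma F_infty_scaleC:
  assumes "f \<in> F_infty"
  shows "c *\<^sub>C f \<in> F_infty" "Lmult (c *\<^sub>C f) = c *\<^sub>C Lmult f"
proof -
  have "coord ((c *\<^sub>C Lmult f) h) = conv (c *\<^sub>C f) h" for h
    by (rule ext) (simp add: scaleC_blinfun.rep_eq coord_Lmult assms conv_scaleC_left)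
  then show "c *\<^sub>C f \<in> F_infty" "Lmult (c *\<^sub>C f) = c *\<^sub>C Lmult f" by (rule Lmult_eqI)+
qed

lemma F_infty_zero: "(0 :: 'n::finite fock) \<in> F_infty" "Lmult (0 :: 'n fock) = 0"
proof -
  have "coord (blinfun_apply 0 h) = conv 0 h" for h :: "'n fock"
    by (rule ext) (simp add: conv_def)
  then show "(0 :: 'n fock) \<in> F_infty" "Lmult (0 :: 'n fock) = 0" by (rule Lmult_eqI)+
qed

lemma F_infty_sum:
  assumes "\<And>i. i \<in> A \<Longrightarrow> f i \<in> F_infty"
  shows "(\<Sum>i\<in>A. f i) \<in> F_infty \<and> Lmult (\<Sum>i\<in>A. f i) = (\<Sum>i\<in>A. Lmult (f i))"
  using assms by (induction A rule: infinite_finite_induct) (auto simp: F_infty_zero F_infty_add)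

lemma F_infty_diff:
  assumes "f \<in> F_infty" "g \<in> F_infty"
  shows "f - g \<in> F_infty" "Lmult (f - g) = Lmult f - Lmult g"
proof -
  have "coord ((Lmult f - Lmult g) h) = conv (f - g) h" for h
    using conv_add_left[of "f - g" g h]
    by (intro ext) (simp add: blinfun.diff_left coord_Lmult assms)
  then show "f - g \<in> F_infty" "Lmult (f - g) = Lmult f - Lmult g" by (rule Lmult_eqI)+
qed

text \<open>Both products sum over the ways to cut a word into three consecutive pieces, so this is
  associativity of the Cauchy product.\<close>

lemma F_infty_compose:
  assumes f: "f \<in> F_infty" and g: "g \<in> F_infty"
  shows "blinfun_apply (Lmult f) g \<in> F_infty" "Lmult (blinfun_apply (Lmult f) g) = Lmult f o\<^sub>L Lmult g"
proof -
  have "coord ((Lmult f o\<^sub>L Lmult g) h) \<gamma> = conv (blinfun_apply (Lmult f) g) h \<gamma>" for h \<gamma>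
  proof -
    \<comment> \<open>\<open>j\<close> and \<open>l\<close> are the lengths of the first and the
      second piece.\<close>
    let ?t = "\<lambda>j l. coord f (take j \<gamma>) * coord g (take l (drop j \<gamma>)) * coord h (drop (j + l) \<gamma>)"
    have "conv (blinfun_apply (Lmult f) g) h \<gamma> = (\<Sum>k\<le>length \<gamma>. \<Sum>j\<le>k. ?t j (k - j))"
      unfolding conv_def coord_Lmult[OF f] scaleC_complex_def sum_distrib_right
      by (intro sum.cong) (auto simp: drop_take min_def intro!: sum.cong)
    also have "\<dots> = (\<Sum>(k, j)\<in>(SIGMA k:{..length \<gamma>}. {..k}). ?t j (k - j))"
      by (subst sum.Sigma) (auto intro!: sum.cong)
    also have "\<dots> = (\<Sum>(j, l)\<in>(SIGMA j:{..length \<gamma>}. {..length \<gamma> - j}). ?t j l)"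
      by (rule sum.reindex_bij_witness[where i = "\<lambda>(j, l). (j + l, j)" and j = "\<lambda>(k, j). (j, k - j)"]) auto
    also have "\<dots> = (\<Sum>j\<le>length \<gamma>. \<Sum>l\<le>length \<gamma> - j. ?t j l)"
      by (simp add: sum.Sigma)
    also have "\<dots> = conv f (blinfun_apply (Lmult g) h) \<gamma>"
      unfolding conv_def coord_Lmult[OF g] scaleC_complex_def sum_distrib_left
      by (intro sum.cong refl) (auto simp: mult_ac add.commute)
    finally show ?thesis by (simp add: coord_Lmult[OF f])
  qed
  then have "coord ((Lmult f o\<^sub>L Lmult g) h) = conv (blinfun_apply (Lmult f) g) h" for h by blast
  then show "blinfun_apply (Lmult f) g \<in> F_infty" "Lmult (blinfun_apply (Lmult f) g) = Lmult f o\<^sub>L Lmult g"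
    by (rule Lmult_eqI)+
qed

subsection \<open>Homogeneous symbols and creation operators\<close>

lemma conv_homogeneous:
  assumes "\<And>\<alpha>. length \<alpha> \<noteq> k \<Longrightarrow> coord f \<alpha> = 0"
  shows "conv f x \<gamma> = (if k \<le> length \<gamma> then coord f (take k \<gamma>) *\<^sub>C coord x (drop k \<gamma>) else 0)"
proof -
  have "conv f x \<gamma> = (\<Sum>j\<le>length \<gamma>. if j = k then coord f (take k \<gamma>) *\<^sub>C coord x (drop k \<gamma>) else 0)"
    unfolding conv_def by (intro sum.cong) (auto simp: assms)
  then show ?thesis by simp
qed

text \<open>The words of length \<open>k\<close> give isometries with mutually orthogonal ranges, so there is no loss
  in passing from the symbol to the operator.\<close>

lemma Lmult_homogeneous:
  fixes f :: "'n::finite fock"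
  assumes "\<And>\<alpha>. length \<alpha> \<noteq> k \<Longrightarrow> coord f \<alpha> = 0"
  shows "f \<in> F_infty" "norm (Lmult f) \<le> norm f"
proof -
  have "(\<Sum>\<gamma>\<in>F. (norm (conv f g \<gamma>))\<^sup>2) \<le> (norm f * norm g)\<^sup>2" if F: "finite F" for g :: "'n fock" and F
  proof -
    define F' where "F' = {\<gamma> \<in> F. k \<le> length \<gamma>}"
    let ?s = "\<lambda>\<gamma>. (take k \<gamma>, drop k \<gamma>)"
    have F': "finite F'" using F by (simp add: F'_def)
    have inj: "inj_on ?s F'" by (rule inj_onI) (metis append_take_drop_id prod.inject)
    have "(\<Sum>\<gamma>\<in>F. (norm (conv f g \<gamma>))\<^sup>2) = (\<Sum>\<gamma>\<in>F'. (norm (coord f (take k \<gamma>)))\<^sup>2 * (norm (coord g (drop k \<gamma>)))\<^sup>2)"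
      unfolding F'_def
      by (rule sum.mono_neutral_cong_right)
        (use F in \<open>auto simp: conv_homogeneous[OF assms] norm_scaleC power_mult_distrib\<close>)
    also have "\<dots> = (\<Sum>(\<alpha>, \<beta>)\<in>?s ` F'. (norm (coord f \<alpha>))\<^sup>2 * (norm (coord g \<beta>))\<^sup>2)"
      by (simp add: sum.reindex[OF inj])
    also have "\<dots> \<le> (\<Sum>(\<alpha>, \<beta>)\<in>take k ` F' \<times> drop k ` F'. (norm (coord f \<alpha>))\<^sup>2 * (norm (coord g \<beta>))\<^sup>2)"
      by (rule sum_mono2) (use F' in auto)
    also have "\<dots> = (\<Sum>\<alpha>\<in>take k ` F'. (norm (coord f \<alpha>))\<^sup>2) * (\<Sum>\<beta>\<in>drop k ` F'. (norm (coord g \<beta>))\<^sup>2)"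
      by (simp add: sum_product sum.cartesian_product)
    also have "\<dots> \<le> (norm f)\<^sup>2 * (norm g)\<^sup>2"
      using F' by (intro mult_mono sum_coord_le_norm) (auto simp: sum_nonneg)
    finally show ?thesis by (simp add: power_mult_distrib)
  qed
  then show "f \<in> F_infty" "norm (Lmult f) \<le> norm f" by (rule Lmult_of_bound; simp)+
qed

lemma ket_in_F_infty: "ket \<alpha> \<in> F_infty"
  by (rule Lmult_homogeneous[of "length \<alpha>"]) (auto simp: coord_ket)

lemma conv_ket:
  "conv (ket \<alpha>) x \<gamma> = (if take (length \<alpha>) \<gamma> = \<alpha> then coord x (drop (length \<alpha>) \<gamma>) else 0)"
  by (subst conv_homogeneous[of "length \<alpha>"]) (auto simp: coord_ket)

lemma Lmult_ket_ket: "blinfun_apply (Lmult (ket \<alpha>)) (ket \<beta>) = ket (\<alpha> @ \<beta>)"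
proof (rule ell2_eqI)
  fix \<gamma>
  have "take (length \<alpha>) \<gamma> = \<alpha> \<and> drop (length \<alpha>) \<gamma> = \<beta> \<longleftrightarrow> \<gamma> = \<alpha> @ \<beta>"
    by (metis append_eq_conv_conj)
  then show "coord (Lmult (ket \<alpha>) (ket \<beta>)) \<gamma> = coord (ket (\<alpha> @ \<beta>)) \<gamma>"
    by (auto simp: coord_Lmult ket_in_F_infty conv_ket coord_ket)
qed

lemma word_op_creation: "word_op creation (\<alpha> :: 'n::finite list) = Lmult (ket \<alpha>)"
proof (induction \<alpha>)
  case Nil
  have "Lmult (ket [] :: 'n fock) = id_blinfun"
    by (rule Lmult_eqI) (auto simp: conv_ket)
  then show ?case by simp
next
  case (Cons i \<alpha>)
  have "Lmult (ket (i # \<alpha>)) = Lmult (ket [i]) o\<^sub>L Lmult (ket \<alpha>)"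
    using F_infty_compose(2)[OF ket_in_F_infty ket_in_F_infty, of "[i]" \<alpha>] by (simp add: Lmult_ket_ket)
  then show ?case by (simp add: Cons.IH creation_def[of i])
qed

section \<open>Creation operators and the row they form\<close>

lemma creation_in_bops: "creation i \<in> bops"
  by (simp add: creation_def Lmult_in_bops ket_in_F_infty)

lemma cinner_ket: "cinner x (ket \<gamma>) = coord x \<gamma>"
proof -
  have "((\<lambda>i. cinner (coord x i) (coord (ket \<gamma>) i)) has_sum coord x \<gamma>) UNIV"
    by (rule has_sum_finite_neutralI[of "{\<gamma>}"]) (auto simp: coord_ket cinner_complex_def)
  then show ?thesis using cinner_ell2_has_sum has_sum_unique by blast
qed

lemma coord_creation: "coord (blinfun_apply (creation i) g) \<gamma> =
    (case \<gamma> of [] \<Rightarrow> 0 | j # \<gamma>' \<Rightarrow> if j = i then coord g \<gamma>' else 0)"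
  by (simp add: creation_def coord_Lmult ket_in_F_infty conv_ket split: list.split)

lemma coord_cadj_creation: "coord (blinfun_apply (cadj (creation i)) g) \<beta> = coord g (i # \<beta>)"
proof -
  have "coord (cadj (creation i) g) \<beta> = cinner g (creation i (ket \<beta>))"
    by (simp add: cinner_cadj_left creation_in_bops flip: cinner_ket)
  also have "creation i (ket \<beta>) = ket (i # \<beta>)" by (simp add: creation_def Lmult_ket_ket)
  finally show ?thesis by (simp add: cinner_ket)
qed

lemma cadj_scaleC: "T \<in> bops \<Longrightarrow> cadj (c *\<^sub>C T) = cnj c *\<^sub>C cadj T"
  by (rule cadj_eqI) (simp add: scaleC_blinfun.rep_eq cinner_scaleC_left cinner_scaleC_right cinner_cadj)

lemma compose_scaleC: "S \<in> bops \<Longrightarrow> (c *\<^sub>C S) o\<^sub>L (d *\<^sub>C T) = (c * d) *\<^sub>C (S o\<^sub>L T)"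
  by (rule blinfun_eqI) (simp add: scaleC_blinfun.rep_eq bopsD scaleC_scaleC)

lemma word_op_scaleC:
  assumes "\<And>i. X i \<in> bops"
  shows "word_op (\<lambda>i. c *\<^sub>C X i) \<alpha> = c ^ length \<alpha> *\<^sub>C word_op X \<alpha>"
  by (induction \<alpha>) (auto simp: compose_scaleC assms)

lemma sum_scaleC_row_gram:
  fixes X :: "'n::finite \<Rightarrow> ('h::complex_hilbert_space \<Rightarrow>\<^sub>L 'h)"
  assumes "\<And>i. X i \<in> bops"
  shows "(\<Sum>i\<in>UNIV. (c *\<^sub>C X i) o\<^sub>L cadj (c *\<^sub>C X i))
    = complex_of_real ((cmod c)\<^sup>2) *\<^sub>C (\<Sum>i\<in>UNIV. X i o\<^sub>L cadj (X i))"
  unfolding complex_norm_square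
  by (simp add: cadj_scaleC compose_scaleC assms scaleC_sum_right)

text \<open>The sum of the products of \<open>creation i\<close> with its adjoint deletes the
  coordinate at the empty word and keeps all others, so it is a projection; scaling the row by
  \<open>r\<close> multiplies it by \<open>r\<^sup>2\<close>.\<close>

lemma scaled_creation_in_row_ball:
  assumes "0 \<le> r" "r < 1"
  shows "(\<lambda>i :: 'n::finite. complex_of_real r *\<^sub>C creation i) \<in> row_ball"
proof -
  let ?Q = "\<Sum>i\<in>UNIV. creation (i :: 'n) o\<^sub>L cadj (creation i)"
  have coord_Q: "coord (?Q g) \<gamma> = (case \<gamma> of [] \<Rightarrow> 0 | _ \<Rightarrow> coord g \<gamma>)" for g \<gamma>
    by (auto simp: blinfun.sum_left coord_sum coord_creation coord_cadj_creation split: list.split)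
  have "norm ?Q \<le> 1"
  proof (rule norm_blinfun_bound)
    show "norm (?Q g) \<le> 1 * norm g" for g
    proof (rule norm_ell2_le_sum)
      fix F :: "'n list set" assume "finite F"
      have "(\<Sum>\<gamma>\<in>F. (norm (coord (?Q g) \<gamma>))\<^sup>2) \<le> (\<Sum>\<gamma>\<in>F. (norm (coord g \<gamma>))\<^sup>2)"
        by (rule sum_mono) (simp add: coord_Q split: list.split)
      also have "\<dots> \<le> (norm g)\<^sup>2" using \<open>finite F\<close> by (rule sum_coord_le_norm)
      finally show "(\<Sum>\<gamma>\<in>F. (norm (coord (?Q g) \<gamma>))\<^sup>2) \<le> (1 * norm g)\<^sup>2" by simp
    qed simp
  qed simp
  then have "r\<^sup>2 * norm ?Q \<le> r\<^sup>2 * 1" by (intro mult_left_mono) auto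
  also have "\<dots> < 1" using assms by (simp add: power_less_one_iff abs_square_less_1)
  finally show ?thesis
    unfolding row_ball_def mem_Collect_eq sum_scaleC_row_gram[OF creation_in_bops]
    by (auto simp: creation_in_bops norm_scaleC simp del: of_real_power)
qed

subsection \<open>Dilation of symbols\<close>

text \<open>This is \<open>D_r\<close>, applied to symbols as well: the multiplier with symbol
  \<open>dil r f\<close> is the value of the series of \<open>f\<close> at the row
  \<open>r S\<close>. Square-summability is guaranteed for \<open>r\<close> between 0 and 1, whence
  the side conditions below.\<close>

definition dil :: "real \<Rightarrow> 'n::finite fock \<Rightarrow> 'n fock" where
  "dil r x = Abs_ell2 (\<lambda>\<gamma>. complex_of_real (r ^ length \<gamma>) * coord x \<gamma>)"

lemma coord_dil:
  assumes "0 \<le> r" "r \<le> 1"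
  shows "coord (dil r x) \<gamma> = complex_of_real (r ^ length \<gamma>) * coord x \<gamma>"
proof -
  have "(\<Sum>\<gamma>\<in>F. (norm (complex_of_real (r ^ length \<gamma>) * coord x \<gamma>))\<^sup>2) \<le> (norm x)\<^sup>2" if "finite F" for F
  proof (rule order_trans[OF sum_mono sum_coord_le_norm[OF that]])
    show "(norm (complex_of_real (r ^ length \<gamma>) * coord x \<gamma>))\<^sup>2 \<le> (norm (coord x \<gamma>))\<^sup>2" for \<gamma>
      using assms by (intro power_mono) (auto simp: norm_mult norm_power mult_left_le_one_le power_le_one)
  qed
  then show ?thesis
    unfolding dil_def by (subst coord_Abs_ell2) (auto intro!: summable_L2_of_bounded_sums)
qed

text \<open>Word length is additive at every cut, so dilation is multiplicative for the Cauchy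
  product.\<close>

lemma conv_dil:
  assumes "0 \<le> r" "r \<le> 1"
  shows "conv (dil r f) (dil r g) \<gamma> = complex_of_real (r ^ length \<gamma>) * conv f g \<gamma>"
proof -
  have "coord (dil r f) (take k \<gamma>) * coord (dil r g) (drop k \<gamma>)
      = complex_of_real (r ^ length \<gamma>) * (coord f (take k \<gamma>) * coord g (drop k \<gamma>))"
    if "k \<le> length \<gamma>" for k
  proof -
    have "r ^ length \<gamma> = r ^ length (take k \<gamma>) * r ^ length (drop k \<gamma>)"
      using that by (simp flip: power_add)
    then show ?thesis by (simp add: coord_dil[OF assms])
  qed
  then show ?thesis
    unfolding conv_def scaleC_complex_def sum_distrib_left by (intro sum.cong) auto
qed

text \<open>The contractivity of the dilation is the noncommutative von Neumann inequality: the dilated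
  operator is the Poisson transform of \<open>Lmult f\<close> at the row \<open>r S\<close>.\<close>

lemma dil_F_infty:
  fixes f :: "'n::finite fock"
  assumes f: "f \<in> F_infty" and r: "0 \<le> r" "r < 1"
  shows "dil r f \<in> F_infty" "norm (Lmult (dil r f)) \<le> norm (Lmult f)"
proof -
  define X where "X = (\<lambda>i :: 'n. complex_of_real r *\<^sub>C creation i)"
  have X: "X \<in> row_ball" unfolding X_def by (rule scaled_creation_in_row_ball[OF r])
  have "coord (poisson (Lmult f) X h) \<gamma> = conv (dil r f) h \<gamma>" for h \<gamma>
  proof -
    have coord_word: "coord (word_op X \<alpha> h) \<gamma> = complex_of_real (r ^ length \<alpha>) * conv (ket \<alpha>) h \<gamma>" for \<alpha>
      unfolding X_def word_op_scaleC[OF creation_in_bops] word_op_creation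
      by (simp add: scaleC_blinfun.rep_eq scaleC_complex_def coord_Lmult[OF ket_in_F_infty])
    \<comment> \<open>Tested against \<open>ket \<gamma>\<close>, the only word of length
      \<open>k\<close> that can contribute is the prefix of \<open>\<gamma>\<close>, so the series
      breaks off at \<open>length \<gamma>\<close> and becomes a Cauchy product.\<close>
    have "(\<Sum>\<alpha> | length \<alpha> = k. coord f \<alpha> * cinner (word_op X \<alpha> h) (ket \<gamma>))
        = (if k \<le> length \<gamma> then coord (dil r f) (take k \<gamma>) * coord h (drop k \<gamma>) else 0)" for k
    proof -
      have "(\<Sum>\<alpha> | length \<alpha> = k. coord f \<alpha> * cinner (word_op X \<alpha> h) (ket \<gamma>))
          = (\<Sum>\<alpha> | length \<alpha> = k. if \<alpha> = take k \<gamma> then coord (dil r f) \<alpha> * coord h (drop k \<gamma>) else 0)"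
      proof (intro sum.cong refl)
        fix \<alpha> :: "'n list" assume "\<alpha> \<in> {\<alpha>. length \<alpha> = k}"
        then show "coord f \<alpha> * cinner (word_op X \<alpha> h) (ket \<gamma>)
            = (if \<alpha> = take k \<gamma> then coord (dil r f) \<alpha> * coord h (drop k \<gamma>) else 0)"
          using r coord_dil[of r f \<alpha>] by (simp add: cinner_ket coord_word conv_ket eq_commute[of \<alpha>])
      qed
      also have "\<dots> = (if length (take k \<gamma>) = k then coord (dil r f) (take k \<gamma>) * coord h (drop k \<gamma>) else 0)"
        by (subst sum.delta[OF finite_words]) simp
      finally show ?thesis by (auto simp: min_def split: if_splits)
    qed
    with poisson_Lmult_weak_sums[OF X f, of h "ket \<gamma>"]
    have "(\<lambda>k. if k \<in> {..length \<gamma>} then coord (dil r f) (take k \<gamma>) * coord h (drop k \<gamma>) else 0)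
        sums coord (poisson (Lmult f) X h) \<gamma>"
      by (simp add: cinner_ket)
    moreover have "(\<lambda>k. if k \<in> {..length \<gamma>} then coord (dil r f) (take k \<gamma>) * coord h (drop k \<gamma>) else 0)
        sums conv (dil r f) h \<gamma>"
      unfolding conv_def scaleC_complex_def by (rule sums_If_finite_set) simp
    ultimately show ?thesis by (rule sums_unique2)
  qed
  then have *: "coord (poisson (Lmult f) X h) = conv (dil r f) h" for h by blast
  show "dil r f \<in> F_infty" by (rule Lmult_eqI(1)[OF *])
  show "norm (Lmult (dil r f)) \<le> norm (Lmult f)"
    unfolding Lmult_eqI(2)[OF *] by (rule norm_poisson_Lmult_le[OF X f])
qed

lemma Lmult_dil_dil:
  assumes "f \<in> F_infty" "0 \<le> r" "r < 1"
  shows "blinfun_apply (Lmult (dil r f)) (dil r g) = dil r (blinfun_apply (Lmult f) g)"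
  by (rule ell2_eqI) (use assms in \<open>simp add: coord_Lmult dil_F_infty conv_dil coord_dil\<close>)

lemma eventually_at_left_1: "\<forall>\<^sub>F r in at_left (1::real). 0 \<le> r \<and> r < 1"
  using eventually_at_left_real[of 0 "1::real"] by (auto elim: eventually_mono)

text \<open>Grouped by length, the squared distance is the series of
  \<open>(1 - r ^ k)\<^sup>2 * B k\<close>, dominated by the summable \<open>B\<close>; Tannery's
  theorem takes the limit under the sum.\<close>

lemma tendsto_dil: "((\<lambda>r. dil r x) \<longlongrightarrow> x) (at_left 1)"
proof -
  define B where "B k = (\<Sum>\<gamma> | length \<gamma> = k. (norm (coord x \<gamma>))\<^sup>2)" for k
  have B: "summable B" "\<And>k. 0 \<le> B k"
    using has_sum_words_imp_sums[OF norm_ell2_has_sum[of x]]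
    by (auto simp: B_def[abs_def] sums_iff sum_nonneg)
  have norm: "(norm (dil r x - x))\<^sup>2 = (\<Sum>k. (1 - r ^ k)\<^sup>2 * B k)" if "0 \<le> r" "r < 1" for r
  proof -
    have "(norm (coord (dil r x - x) \<gamma>))\<^sup>2 = (1 - r ^ length \<gamma>)\<^sup>2 * (norm (coord x \<gamma>))\<^sup>2" for \<gamma>
    proof -
      have "coord (dil r x - x) \<gamma> = complex_of_real (r ^ length \<gamma> - 1) * coord x \<gamma>"
        using that by (simp add: coord_dil algebra_simps)
      then show ?thesis by (simp only: norm_mult norm_of_real power_mult_distrib power2_abs power2_commute[of 1])
    qed
    then have "(\<Sum>\<gamma> | length \<gamma> = k. (norm (coord (dil r x - x) \<gamma>))\<^sup>2) = (1 - r ^ k)\<^sup>2 * B k" for k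
      unfolding B_def sum_distrib_left by (intro sum.cong) auto
    with has_sum_words_imp_sums[OF norm_ell2_has_sum[of "dil r x - x"]] show ?thesis
      by (simp add: sums_iff)
  qed
  have "((\<lambda>r. \<Sum>k. (1 - r ^ k)\<^sup>2 * B k) \<longlongrightarrow> (\<Sum>k. 0)) (at_left 1)"
  proof (rule conjunct2[OF conjunct2[OF tannerys_theorem]])
    show "((\<lambda>r. (1 - r ^ k)\<^sup>2 * B k) \<longlongrightarrow> 0) (at_left 1)" for k
      by (rule tendsto_eq_intros refl | simp)+
    have "\<forall>\<^sub>F r in at_left (1::real). \<forall>k. norm ((1 - r ^ k)\<^sup>2 * B k) \<le> B k"
      using eventually_at_left_1
    proof eventually_elim
      case (elim r)
      then have "(1 - r ^ k)\<^sup>2 \<le> 1" for k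
        by (simp add: abs_square_le_1 power_le_one)
      then show ?case using B(2) by (simp add: abs_mult mult_left_le_one_le)
    qed
    then show "\<forall>\<^sub>F (k, r) in at_top \<times>\<^sub>F at_left (1::real). norm ((1 - r ^ k)\<^sup>2 * B k) \<le> B k"
      unfolding eventually_prod_filter
      by (intro exI[of _ "\<lambda>_. True"] exI[of _ "\<lambda>r. \<forall>k. norm ((1 - r ^ k)\<^sup>2 * B k) \<le> B k"]) auto
  qed (use B in auto)
  then have "((\<lambda>r. sqrt (\<Sum>k. (1 - r ^ k)\<^sup>2 * B k)) \<longlongrightarrow> sqrt 0) (at_left 1)"
    by (intro tendsto_real_sqrt) simp
  moreover have "\<forall>\<^sub>F r in at_left (1::real). sqrt (\<Sum>k. (1 - r ^ k)\<^sup>2 * B k) = norm (dil r x - x)"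
    using eventually_at_left_1 by eventually_elim (simp flip: norm)
  ultimately have "((\<lambda>r. norm (dil r x - x)) \<longlongrightarrow> 0) (at_left 1)"
    by (simp add: Lim_transform_eventually)
  then show ?thesis by (simp add: tendsto_norm_zero_iff LIM_zero_iff)
qed

lemma tendsto_Lmult_dil:
  assumes f: "f \<in> F_infty"
  shows "((\<lambda>r. blinfun_apply (Lmult (dil r f)) g) \<longlongrightarrow> blinfun_apply (Lmult f) g) (at_left 1)"
proof -
  have lim: "((\<lambda>r. norm (Lmult f) * norm (g - dil r g) + norm (dil r (Lmult f g) - Lmult f g))
      \<longlongrightarrow> 0) (at_left 1)"
  proof -
    have "((\<lambda>r. norm (Lmult f) * norm (g - dil r g) + norm (dil r (Lmult f g) - Lmult f g))
      \<longlongrightarrow> norm (Lmult f) * norm (g - g) + norm (Lmult f g - Lmult f g)) (at_left 1)"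
      by (intro tendsto_intros tendsto_dil)
    then show ?thesis by simp
  qed
  have "\<forall>\<^sub>F r in at_left 1. norm (Lmult (dil r f) g - Lmult f g)
      \<le> norm (Lmult f) * norm (g - dil r g) + norm (dil r (Lmult f g) - Lmult f g)"
    using eventually_at_left_1
  proof eventually_elim
    case (elim r)
    \<comment> \<open>The first summand is small because \<open>dil r g\<close> tends to
      \<open>g\<close> while the norms of \<open>Lmult (dil r f)\<close> stay bounded; by the
      intertwining relation the second is the dilation error of one fixed vector.\<close>
    have "Lmult (dil r f) g - Lmult f g = Lmult (dil r f) (g - dil r g) + (dil r (Lmult f g) - Lmult f g)"
      using elim by (simp add: blinfun.diff_right Lmult_dil_dil[OF f])
    also have "norm \<dots> \<le> norm (Lmult (dil r f)) * norm (g - dil r g) + norm (dil r (Lmult f g) - Lmult f g)"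
      by (intro norm_triangle_mono norm_blinfun order_refl)
    also have "\<dots> \<le> norm (Lmult f) * norm (g - dil r g) + norm (dil r (Lmult f g) - Lmult f g)"
      using elim by (intro add_right_mono mult_right_mono dil_F_infty f) auto
    finally show ?case .
  qed
  then have "((\<lambda>r. Lmult (dil r f) g - Lmult f g) \<longlongrightarrow> 0) (at_left 1)"
    using lim by (rule Lim_null_comparison)
  then show ?thesis by (simp add: LIM_zero_iff)
qed

section \<open>Radial functions\<close>

lemma summable_radial:
  fixes a :: "'n::finite list \<Rightarrow> complex"
  assumes a: "limsup (\<lambda>k. ereal (root (2 * k) (\<Sum>\<alpha> | length \<alpha> = k. (cmod (a \<alpha>))\<^sup>2))) \<le> 1"
    and r: "0 \<le> r" "r < 1"
  shows "summable (\<lambda>k. r ^ k * sqrt (\<Sum>\<alpha> | length \<alpha> = k. (cmod (a \<alpha>))\<^sup>2))"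
proof (rule summable_comparison_test_ev)
  define A where "A k = (\<Sum>\<alpha> | length \<alpha> = k. (cmod (a \<alpha>))\<^sup>2)" for k
  have A: "0 \<le> A k" for k by (simp add: A_def sum_nonneg)
  \<comment> \<open>Any \<open>s > 1\<close> with \<open>r * s < 1\<close> would do: the growth
    condition eventually bounds the roots by \<open>s\<close>, and the majorant is then
    geometric.\<close>
  define s where "s = 2 / (1 + r)"
  have s: "1 < s" "r * s < 1" using r by (auto simp: s_def field_simps)
  have "limsup (\<lambda>k. ereal (root (2 * k) (A k))) \<le> ereal 1"
    using a by (simp add: A_def one_ereal_def)
  also have "\<dots> < ereal s" using s(1) by simp
  finally have "limsup (\<lambda>k. ereal (root (2 * k) (A k))) < ereal s" .
  from Limsup_lessD[OF this] have ev: "\<forall>\<^sub>F k in sequentially. root (2 * k) (A k) < s" by simp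
  show "\<forall>\<^sub>F k in sequentially. norm (r ^ k * sqrt (\<Sum>\<alpha> | length \<alpha> = k. (cmod (a \<alpha>))\<^sup>2)) \<le> (r * s) ^ k"
    using ev eventually_gt_at_top[of 0]
  proof eventually_elim
    case (elim k)
    have "A k = root (2 * k) (A k) ^ (2 * k)" using elim A by simp
    also have "\<dots> \<le> s ^ (2 * k)" using elim A by (intro power_mono) auto
    finally have "sqrt (A k) \<le> sqrt ((s ^ k)\<^sup>2)" by (simp add: power_mult[symmetric] mult.commute)
    then have "sqrt (A k) \<le> s ^ k" using s by simp
    then have "r ^ k * sqrt (A k) \<le> r ^ k * s ^ k" using r by (intro mult_left_mono) auto
    then show ?case using r A by (simp add: A_def abs_mult power_mult_distrib)
  qed
  show "summable (\<lambda>k. (r * s) ^ k)" using r s by (intro summable_geometric) simp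
qed

definition homog :: "('n::finite list \<Rightarrow> complex) \<Rightarrow> nat \<Rightarrow> 'n fock" where
  "homog c k = (\<Sum>\<alpha> | length \<alpha> = k. c \<alpha> *\<^sub>C ket \<alpha>)"

lemma coord_homog: "coord (homog c k) \<alpha> = (if length \<alpha> = k then c \<alpha> else 0)"
proof -
  have "coord (homog c k) \<alpha> = (\<Sum>\<beta> | length \<beta> = k. if \<beta> = \<alpha> then c \<alpha> else 0)"
    unfolding homog_def coord_sum by (intro sum.cong) (auto simp: coord_ket scaleC_complex_def)
  then show ?thesis by (simp add: sum.delta'[OF finite_words] finite_words)
qed

lemma homog_in_F_infty: "homog c k \<in> F_infty"
  by (rule Lmult_homogeneous[of k]) (simp add: coord_homog)

lemma norm_homog: "norm (homog c k) = sqrt (\<Sum>\<alpha> | length \<alpha> = k. (cmod (c \<alpha>))\<^sup>2)"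
proof -
  have "((\<lambda>\<alpha>. (norm (coord (homog c k) \<alpha>))\<^sup>2) has_sum (\<Sum>\<alpha> | length \<alpha> = k. (cmod (c \<alpha>))\<^sup>2)) UNIV"
    by (rule has_sum_finite_neutralI[OF finite_words[of k]]) (auto simp: coord_homog)
  then have "(norm (homog c k))\<^sup>2 = (\<Sum>\<alpha> | length \<alpha> = k. (cmod (c \<alpha>))\<^sup>2)"
    using norm_ell2_has_sum has_sum_unique by blast
  then show ?thesis by (metis norm_ge_zero real_sqrt_unique)
qed

lemma Lmult_homog: "Lmult (homog c k) = (\<Sum>\<alpha> | length \<alpha> = k. c \<alpha> *\<^sub>C word_op creation \<alpha>)"
  using F_infty_sum[of "{\<alpha>. length \<alpha> = k}" "\<lambda>\<alpha>. c \<alpha> *\<^sub>C ket \<alpha>"]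
  by (simp add: homog_def F_infty_scaleC ket_in_F_infty word_op_creation)

text \<open>The operator norm of a homogeneous part is at most the Hilbert space norm of its
  coefficients. Hence the growth condition on sums of squares, with no factor for the number of
  words, gives absolute convergence.\<close>

lemma radial_sums:
  fixes a :: "'n::finite list \<Rightarrow> complex"
  assumes a: "limsup (\<lambda>k. ereal (root (2 * k) (\<Sum>\<alpha> | length \<alpha> = k. (cmod (a \<alpha>))\<^sup>2))) \<le> 1"
    and r: "0 \<le> r" "r < 1"
  shows "(\<lambda>k. Lmult (homog (\<lambda>\<alpha>. complex_of_real (r ^ k) * a \<alpha>) k)) sums radial a r"
proof -
  have "summable (\<lambda>k. Lmult (homog (\<lambda>\<alpha>. complex_of_real (r ^ k) * a \<alpha>) k))"
  proof (rule summable_norm_cancel, rule summable_comparison_test'[OF summable_radial[OF a r]])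
    fix k
    have "norm (Lmult (homog (\<lambda>\<alpha>. complex_of_real (r ^ k) * a \<alpha>) k))
        \<le> norm (homog (\<lambda>\<alpha>. complex_of_real (r ^ k) * a \<alpha>) k)"
      by (rule Lmult_homogeneous[of k]) (simp add: coord_homog)
    also have "\<dots> = r ^ k * sqrt (\<Sum>\<alpha> | length \<alpha> = k. (cmod (a \<alpha>))\<^sup>2)"
      using r by (simp add: norm_homog norm_mult norm_power power_mult_distrib real_sqrt_mult
          flip: sum_distrib_left)
    finally show "norm (norm (Lmult (homog (\<lambda>\<alpha>. complex_of_real (r ^ k) * a \<alpha>) k)))
        \<le> r ^ k * sqrt (\<Sum>\<alpha> | length \<alpha> = k. (cmod (a \<alpha>))\<^sup>2)" by simp
  qed
  from summable_sums[OF this] show ?thesis by (simp add: radial_def Lmult_homog)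
qed

text \<open>Only degrees up to the length of the word reach a given coordinate. The result is a
  polynomial in \<open>r\<close>, which extends to \<open>r = 1\<close> whatever the coefficients
  are.\<close>

lemma coord_radial:
  fixes a :: "'n::finite list \<Rightarrow> complex"
  assumes a: "limsup (\<lambda>k. ereal (root (2 * k) (\<Sum>\<alpha> | length \<alpha> = k. (cmod (a \<alpha>))\<^sup>2))) \<le> 1"
    and r: "0 \<le> r" "r < 1"
  shows "coord (blinfun_apply (radial a r) g) \<gamma>
    = (\<Sum>k\<le>length \<gamma>. complex_of_real (r ^ k) * a (take k \<gamma>) * coord g (drop k \<gamma>))"
proof -
  have "bounded_linear (\<lambda>T. coord (blinfun_apply T g) \<gamma>)"
    by (intro bounded_linear_compose[OF bounded_linear_coord] blinfun.bounded_linear_left)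
  from bounded_linear.sums[OF this radial_sums[OF a r]]
  have "(\<lambda>k. coord (Lmult (homog (\<lambda>\<alpha>. complex_of_real (r ^ k) * a \<alpha>) k) g) \<gamma>)
      sums coord (radial a r g) \<gamma>" .
  moreover have "coord (Lmult (homog (\<lambda>\<alpha>. complex_of_real (r ^ k) * a \<alpha>) k) g) \<gamma>
      = (if k \<in> {..length \<gamma>} then complex_of_real (r ^ k) * a (take k \<gamma>) * coord g (drop k \<gamma>) else 0)" for k
    unfolding coord_Lmult[OF homog_in_F_infty]
    by (subst conv_homogeneous[of k]) (auto simp: coord_homog scaleC_complex_def)
  ultimately have "(\<lambda>k. if k \<in> {..length \<gamma>} then complex_of_real (r ^ k) * a (take k \<gamma>) * coord g (drop k \<gamma>) else 0)
      sums coord (radial a r g) \<gamma>" by simp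
  moreover have "(\<lambda>k. if k \<in> {..length \<gamma>} then complex_of_real (r ^ k) * a (take k \<gamma>) * coord g (drop k \<gamma>) else 0)
      sums (\<Sum>k\<le>length \<gamma>. complex_of_real (r ^ k) * a (take k \<gamma>) * coord g (drop k \<gamma>))"
    by (rule sums_If_finite_set) simp
  ultimately show ?thesis by (rule sums_unique2)
qed

lemma radial_coord:
  fixes f :: "'n::finite fock"
  assumes "limsup (\<lambda>k. ereal (root (2 * k) (\<Sum>\<alpha> | length \<alpha> = k. (cmod (coord f \<alpha>))\<^sup>2))) \<le> 1"
    and f: "f \<in> F_infty" and r: "0 \<le> r" "r < 1"
  shows "radial (coord f) r = Lmult (dil r f)"
proof (rule blinfun_eqI, rule ell2_eqI)
  show "coord (radial (coord f) r g) \<gamma> = coord (Lmult (dil r f) g) \<gamma>" for g \<gamma>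
    unfolding coord_radial[OF assms(1) r] coord_Lmult[OF dil_F_infty(1)[OF f r]] conv_def
    by (intro sum.cong) (use r in \<open>auto simp: coord_dil scaleC_complex_def\<close>)
qed

text \<open>On finitely many coordinates the action of \<open>radial a r\<close> is polynomial in
  \<open>r\<close>, so the uniform bound persists at \<open>r = 1\<close>, where it bounds
  multiplication by \<open>a\<close>. The bound is asked only near 1, so that norm convergence
  supplies it too.\<close>

lemma bounded_radial_imp_F_infty:
  fixes a :: "'n::finite list \<Rightarrow> complex"
  assumes a: "limsup (\<lambda>k. ereal (root (2 * k) (\<Sum>\<alpha> | length \<alpha> = k. (cmod (a \<alpha>))\<^sup>2))) \<le> 1"
    and bound: "\<forall>\<^sub>F r in at_left 1. norm (radial a r) \<le> M"
  obtains f where "f \<in> F_infty" "coord f = a"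
proof -
  have "0 \<le> M"
    using eventually_happens'[OF _ bound] norm_ge_zero order_trans by (metis trivial_limit_at_left_real)
  define A where "A g \<gamma> = (\<Sum>k\<le>length \<gamma>. a (take k \<gamma>) * coord g (drop k \<gamma>))" for g :: "'n fock" and \<gamma>
  have le: "(\<Sum>\<gamma>\<in>F. (norm (A g \<gamma>))\<^sup>2) \<le> (M * norm g)\<^sup>2" if F: "finite F" for g F
  proof (rule tendsto_upperbound)
    let ?c = "\<lambda>r \<gamma>. \<Sum>k\<le>length \<gamma>. complex_of_real (r ^ k) * a (take k \<gamma>) * coord g (drop k \<gamma>)"
    have "((\<lambda>r. \<Sum>\<gamma>\<in>F. (norm (?c r \<gamma>))\<^sup>2) \<longlongrightarrow> (\<Sum>\<gamma>\<in>F. (norm (?c 1 \<gamma>))\<^sup>2)) (at_left 1)"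
      by (intro tendsto_intros)
    then show "((\<lambda>r. \<Sum>\<gamma>\<in>F. (norm (?c r \<gamma>))\<^sup>2) \<longlongrightarrow> (\<Sum>\<gamma>\<in>F. (norm (A g \<gamma>))\<^sup>2)) (at_left 1)"
      by (simp add: A_def)
    show "\<forall>\<^sub>F r in at_left 1. (\<Sum>\<gamma>\<in>F. (norm (?c r \<gamma>))\<^sup>2) \<le> (M * norm g)\<^sup>2"
      using bound eventually_at_left_1
    proof eventually_elim
      case (elim r)
      have "(\<Sum>\<gamma>\<in>F. (norm (?c r \<gamma>))\<^sup>2) = (\<Sum>\<gamma>\<in>F. (norm (coord (radial a r g) \<gamma>))\<^sup>2)"
        using elim by (simp add: coord_radial[OF a])
      also have "\<dots> \<le> (norm (radial a r g))\<^sup>2" using F by (rule sum_coord_le_norm)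
      also have "\<dots> \<le> (M * norm g)\<^sup>2"
        using elim by (intro power_mono order_trans[OF norm_blinfun] mult_right_mono) auto
      finally show ?case .
    qed
  qed simp
  \<comment> \<open>Nothing so far says that \<open>a\<close> is square-summable; the bound at the
    vacuum vector, whose product with \<open>a\<close> is \<open>a\<close> itself, shows it.\<close>
  have A_Nil: "A (ket []) \<gamma> = a \<gamma>" for \<gamma>
  proof -
    have "A (ket []) \<gamma> = (\<Sum>k\<le>length \<gamma>. if k = length \<gamma> then a \<gamma> else 0)"
      unfolding A_def by (intro sum.cong) (auto simp: coord_ket)
    then show ?thesis by simp
  qed
  define f where "f = Abs_ell2 a"
  have f: "coord f = a"
    unfolding f_def using le[of _ "ket []"] unfolding A_Nil
    by (intro coord_Abs_ell2 summable_L2_of_bounded_sums)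
  have "f \<in> F_infty"
    using le \<open>0 \<le> M\<close> by (intro Lmult_of_bound[of f M]) (auto simp: A_def conv_def f scaleC_complex_def)
  then show ?thesis using f by (rule that)
qed

subsection \<open>The noncommutative disc algebra\<close>

lemma disc_algebra_ops_closure:
  shows closed_disc_algebra_ops: "closed disc_algebra_ops"
    and id_in_disc_algebra_ops: "id_blinfun \<in> disc_algebra_ops"
    and creation_in_disc_algebra_ops: "creation i \<in> disc_algebra_ops"
    and add_in_disc_algebra_ops: "\<lbrakk>S \<in> disc_algebra_ops; T \<in> disc_algebra_ops\<rbrakk> \<Longrightarrow> S + T \<in> disc_algebra_ops"
    and compose_in_disc_algebra_ops: "\<lbrakk>S \<in> disc_algebra_ops; T \<in> disc_algebra_ops\<rbrakk> \<Longrightarrow> S o\<^sub>L T \<in> disc_algebra_ops"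
    and scaleC_in_disc_algebra_ops: "T \<in> disc_algebra_ops \<Longrightarrow> c *\<^sub>C T \<in> disc_algebra_ops"
  unfolding disc_algebra_ops_def by (blast intro: closed_Inter)+

lemma word_op_in_disc_algebra_ops: "word_op creation \<alpha> \<in> disc_algebra_ops"
  by (induction \<alpha>)
    (auto intro: id_in_disc_algebra_ops compose_in_disc_algebra_ops creation_in_disc_algebra_ops)

lemma sum_in_disc_algebra_ops:
  assumes "\<And>i. i \<in> A \<Longrightarrow> T i \<in> disc_algebra_ops"
  shows "(\<Sum>i\<in>A. T i) \<in> disc_algebra_ops"
proof -
  have "0 \<in> disc_algebra_ops" using scaleC_in_disc_algebra_ops[OF id_in_disc_algebra_ops, of 0] by simp
  then show ?thesis
    using assms by (induction A rule: infinite_finite_induct) (auto intro: add_in_disc_algebra_ops)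
qed

lemma radial_in_disc_algebra_ops:
  assumes "limsup (\<lambda>k. ereal (root (2 * k) (\<Sum>\<alpha> | length \<alpha> = k. (cmod (a \<alpha>))\<^sup>2))) \<le> 1"
    and "0 \<le> r" "r < 1"
  shows "radial a r \<in> disc_algebra_ops"
proof (rule Lim_in_closed_set[OF closed_disc_algebra_ops])
  show "(\<lambda>n. \<Sum>k<n. Lmult (homog (\<lambda>\<alpha>. complex_of_real (r ^ k) * a \<alpha>) k)) \<longlonglongrightarrow> radial a r"
    using radial_sums[OF assms] by (simp add: sums_def)
qed (auto simp: Lmult_homog intro!: always_eventually sum_in_disc_algebra_ops scaleC_in_disc_algebra_ops
    word_op_in_disc_algebra_ops)

section \<open>The algebra of symbols with norm convergent dilations\<close>

lemma dil_add: "0 \<le> r \<Longrightarrow> r \<le> 1 \<Longrightarrow> dil r (f + g) = dil r f + dil r g"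
  by (rule ell2_eqI) (simp add: coord_dil algebra_simps)

lemma dil_diff: "0 \<le> r \<Longrightarrow> r \<le> 1 \<Longrightarrow> dil r (f - g) = dil r f - dil r g"
  by (rule ell2_eqI) (simp add: coord_dil algebra_simps)

lemma dil_scaleC: "0 \<le> r \<Longrightarrow> r \<le> 1 \<Longrightarrow> dil r (c *\<^sub>C f) = c *\<^sub>C dil r f"
  by (rule ell2_eqI) (simp add: coord_dil scaleC_complex_def)

lemma dil_ket: "0 \<le> r \<Longrightarrow> r \<le> 1 \<Longrightarrow> dil r (ket \<alpha>) = complex_of_real (r ^ length \<alpha>) *\<^sub>C ket \<alpha>"
  by (rule ell2_eqI) (simp add: coord_dil scaleC_complex_def coord_ket)

definition norm_dilation_symbols :: "'n::finite fock set" where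
  "norm_dilation_symbols = {f \<in> F_infty. ((\<lambda>r. Lmult (dil r f)) \<longlongrightarrow> Lmult f) (at_left 1)}"

lemma norm_dilation_symbols_transform:
  assumes "f \<in> F_infty" "(G \<longlongrightarrow> Lmult f) (at_left 1)"
    "\<And>r. 0 \<le> r \<Longrightarrow> r < 1 \<Longrightarrow> Lmult (dil r f) = G r"
  shows "f \<in> norm_dilation_symbols"
proof -
  have "\<forall>\<^sub>F r in at_left 1. G r = Lmult (dil r f)"
    using eventually_at_left_1 by eventually_elim (simp add: assms(3))
  then show ?thesis
    using assms(1,2) by (simp add: norm_dilation_symbols_def Lim_transform_eventually)
qed

lemma ket_norm_dilation: "ket \<alpha> \<in> norm_dilation_symbols"
proof (rule norm_dilation_symbols_transform)
  have "((\<lambda>r. r ^ length \<alpha> *\<^sub>R Lmult (ket \<alpha>)) \<longlongrightarrow> 1 ^ length \<alpha> *\<^sub>R Lmult (ket \<alpha>)) (at_left 1)"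
    by (intro tendsto_intros)
  then show "((\<lambda>r. r ^ length \<alpha> *\<^sub>R Lmult (ket \<alpha>)) \<longlongrightarrow> Lmult (ket \<alpha>)) (at_left 1)" by simp
  show "Lmult (dil r (ket \<alpha>)) = r ^ length \<alpha> *\<^sub>R Lmult (ket \<alpha>)" if "0 \<le> r" "r < 1" for r
    using that by (simp add: dil_ket F_infty_scaleC ket_in_F_infty scaleR_scaleC)
qed (rule ket_in_F_infty)

text \<open>The only candidate for the symbol is the value at the vacuum, \<open>T (ket [])\<close>.
  Each coordinate of a Cauchy product involves finitely many coordinates of the symbol and therefore
  passes to the limit.\<close>

lemma F_infty_limit:
  fixes T :: "'n::finite fock \<Rightarrow>\<^sub>L 'n fock"
  assumes f: "\<And>n. f n \<in> F_infty" and lim: "(\<lambda>n. Lmult (f n)) \<longlonglongrightarrow> T"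
  obtains g where "g \<in> F_infty" "Lmult g = T"
proof -
  have ap: "(\<lambda>n. Lmult (f n) h) \<longlonglongrightarrow> T h" for h by (intro tendsto_intros lim)
  have fl: "f \<longlonglongrightarrow> T (ket [])" using ap[of "ket []"] by (simp add: Lmult_ket_Nil[OF f])
  have "coord (T h) \<gamma> = conv (T (ket [])) h \<gamma>" for h \<gamma>
  proof (rule LIMSEQ_unique)
    show "(\<lambda>n. conv (f n) h \<gamma>) \<longlonglongrightarrow> coord (T h) \<gamma>"
      using bounded_linear.tendsto[OF bounded_linear_coord[where i = \<gamma>] ap[of h]] by (simp add: coord_Lmult[OF f])
    show "(\<lambda>n. conv (f n) h \<gamma>) \<longlonglongrightarrow> conv (T (ket [])) h \<gamma>"
      unfolding conv_def scaleC_complex_def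
      by (intro tendsto_intros bounded_linear.tendsto[OF bounded_linear_coord fl])
  qed
  then have "coord (T h) = conv (T (ket [])) h" for h by blast
  from Lmult_eqI[OF this] show ?thesis by (rule that)
qed

text \<open>Dilation is contractive on multipliers, so replacing \<open>g\<close> by a nearby
  \<open>f n\<close> costs at most \<open>norm (Lmult (f n - g))\<close>, uniformly in
  \<open>r\<close>; three thirds of \<open>e\<close> then suffice.\<close>

lemma closed_norm_dilation: "closed (Lmult ` (norm_dilation_symbols :: 'n::finite fock set))"
  unfolding closed_sequential_limits
proof (intro allI impI, elim conjE)
  fix X :: "nat \<Rightarrow> 'n fock \<Rightarrow>\<^sub>L 'n fock" and T
  assume "\<forall>n. X n \<in> Lmult ` norm_dilation_symbols" and X: "X \<longlonglongrightarrow> T"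
  then obtain f where f: "\<And>n. f n \<in> norm_dilation_symbols" "X = (\<lambda>n. Lmult (f n))"
    by (metis (no_types) ext image_iff)
  have fF: "f n \<in> F_infty" for n using f(1) by (simp add: norm_dilation_symbols_def)
  obtain g where g: "g \<in> F_infty" "Lmult g = T" using F_infty_limit[OF fF X[unfolded f(2)]] by blast
  have "((\<lambda>r. Lmult (dil r g)) \<longlongrightarrow> Lmult g) (at_left 1)"
  proof (rule tendstoI)
    fix e :: real assume e: "0 < e"
    obtain n where n: "dist (Lmult (f n)) (Lmult g) < e / 3"
      using tendstoD[OF X, of "e / 3"] e unfolding f(2) g(2) eventually_sequentially by auto
    have "\<forall>\<^sub>F r in at_left 1. dist (Lmult (dil r (f n))) (Lmult (f n)) < e / 3"
      using f(1)[of n] e by (intro tendstoD) (auto simp: norm_dilation_symbols_def)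
    then show "\<forall>\<^sub>F r in at_left 1. dist (Lmult (dil r g)) (Lmult g) < e"
      using eventually_at_left_1
    proof eventually_elim
      case (elim r)
      have "dist (Lmult (dil r (f n))) (Lmult (dil r g)) = norm (Lmult (dil r (f n - g)))"
        using elim by (simp add: dist_norm dil_diff F_infty_diff dil_F_infty fF g)
      also have "\<dots> \<le> norm (Lmult (f n - g))"
        using elim by (intro dil_F_infty F_infty_diff fF g) auto
      also have "\<dots> = dist (Lmult (f n)) (Lmult g)" by (simp add: dist_norm F_infty_diff fF g)
      finally show ?case
        using elim n dist_triangle[of "Lmult (dil r g)" "Lmult g" "Lmult (dil r (f n))"]
          dist_triangle[of "Lmult (dil r (f n))" "Lmult g" "Lmult (f n)"]
        by (simp add: dist_commute)
    qed
  qed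
  then have "g \<in> norm_dilation_symbols" using g by (simp add: norm_dilation_symbols_def)
  then show "T \<in> Lmult ` norm_dilation_symbols" using g(2) by blast
qed

text \<open>\<open>disc_algebra_ops\<close> is the smallest closed algebra with the identity and the
  generators, so it suffices that the right-hand side is one. For products, multiplicativity of the
  dilation gives a composition of two convergent families.\<close>

lemma disc_algebra_ops_norm_dilation: "disc_algebra_ops \<subseteq> Lmult ` (norm_dilation_symbols :: 'n::finite fock set)"
  unfolding disc_algebra_ops_def
proof (rule Inter_lower, unfold mem_Collect_eq, intro conjI ballI allI)
  let ?D = "norm_dilation_symbols :: 'n fock set"
  show "closed (Lmult ` ?D)" by (rule closed_norm_dilation)
  show "id_blinfun \<in> Lmult ` ?D"
    using word_op_creation[of "[] :: 'n list"] ket_norm_dilation[of "[]"] by auto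
  show "range creation \<subseteq> Lmult ` ?D" using ket_norm_dilation by (auto simp: creation_def)
  fix T assume "T \<in> Lmult ` ?D"
  then obtain g where g: "g \<in> F_infty" "((\<lambda>r. Lmult (dil r g)) \<longlongrightarrow> Lmult g) (at_left 1)" and T: "T = Lmult g"
    by (auto simp: norm_dilation_symbols_def)
  show "c *\<^sub>C T \<in> Lmult ` ?D" for c
  proof (rule image_eqI)
    show "c *\<^sub>C g \<in> ?D"
    proof (rule norm_dilation_symbols_transform)
      show "((\<lambda>r. c *\<^sub>C Lmult (dil r g)) \<longlongrightarrow> Lmult (c *\<^sub>C g)) (at_left 1)"
        unfolding F_infty_scaleC(2)[OF g(1)]
        by (intro bounded_linear.tendsto[OF bounded_linear_scaleC] g)
    qed (simp_all add: g F_infty_scaleC dil_scaleC dil_F_infty)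
  qed (simp add: T F_infty_scaleC g)
  fix S assume "S \<in> Lmult ` ?D"
  then obtain f where f: "f \<in> F_infty" "((\<lambda>r. Lmult (dil r f)) \<longlongrightarrow> Lmult f) (at_left 1)" and S: "S = Lmult f"
    by (auto simp: norm_dilation_symbols_def)
  show "S + T \<in> Lmult ` ?D"
  proof (rule image_eqI)
    show "f + g \<in> ?D"
    proof (rule norm_dilation_symbols_transform)
      show "((\<lambda>r. Lmult (dil r f) + Lmult (dil r g)) \<longlongrightarrow> Lmult (f + g)) (at_left 1)"
        unfolding F_infty_add(2)[OF f(1) g(1)] by (intro tendsto_intros f g)
    qed (simp_all add: f g F_infty_add dil_add dil_F_infty)
  qed (simp add: S T F_infty_add f g)
  show "S o\<^sub>L T \<in> Lmult ` ?D"
  proof (rule image_eqI)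
    show "Lmult f g \<in> ?D"
    proof (rule norm_dilation_symbols_transform)
      show "((\<lambda>r. Lmult (dil r f) o\<^sub>L Lmult (dil r g)) \<longlongrightarrow> Lmult (Lmult f g)) (at_left 1)"
        unfolding F_infty_compose(2)[OF f(1) g(1)]
        by (intro bounded_bilinear.tendsto[OF bounded_bilinear_blinfun_compose] f g)
      show "Lmult (dil r (Lmult f g)) = Lmult (dil r f) o\<^sub>L Lmult (dil r g)" if "0 \<le> r" "r < 1" for r
        using that by (simp add: f g dil_F_infty F_infty_compose flip: Lmult_dil_dil)
    qed (simp add: f g F_infty_compose)
  qed (simp add: S T F_infty_compose f g)
qed

lemma disc_algebra_tendsto:
  assumes "f \<in> disc_algebra"
  shows "((\<lambda>r. Lmult (dil r f)) \<longlongrightarrow> Lmult f) (at_left 1)"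
proof -
  have f: "f \<in> F_infty" "Lmult f \<in> disc_algebra_ops" using assms by (auto simp: disc_algebra_def)
  then obtain g where g: "g \<in> norm_dilation_symbols" "Lmult f = Lmult g"
    using disc_algebra_ops_norm_dilation by blast
  then have "f = g" using Lmult_ket_Nil f(1) by (metis (mono_tags, lifting) mem_Collect_eq norm_dilation_symbols_def)
  then show ?thesis using g(1) by (simp add: norm_dilation_symbols_def)
qed

section \<open>Operator topologies\<close>

lemma limitin_pullback_topology:
  assumes "limitin T (\<lambda>x. f (g x)) (f l) F"
  shows "limitin (pullback_topology UNIV f T) g l F"
  using assms by (auto simp: limitin_def topspace_pullback_topology openin_pullback_topology)

lemma tendsto_pointwise:
  fixes f :: "'b \<Rightarrow> 'i \<Rightarrow> 'a::topological_space"
  assumes "\<And>i. ((\<lambda>x. f x i) \<longlongrightarrow> l i) F"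
  shows "(f \<longlongrightarrow> l) F"
proof -
  have "limitin (product_topology (\<lambda>_. euclidean) UNIV) f l F"
    unfolding limitin_componentwise using assms by simp
  then show ?thesis by (simp add: euclidean_product_topology)
qed

lemma limitin_strong_operator_topology:
  assumes "\<And>x. ((\<lambda>r. blinfun_apply (T r) x) \<longlongrightarrow> blinfun_apply S x) F"
  shows "limitin strong_operator_topology T S F"
  unfolding strong_operator_topology_def
  by (rule limitin_pullback_topology) (simp add: tendsto_pointwise assms)

text \<open>Each functional is a series whose terms converge by strong convergence; the eventual
  norm bound dominates them uniformly by \<open>M\<close> times a summable sequence, so Tannery's
  theorem applies.\<close>

lemma limitin_weak_star_topology:
  fixes T :: "'r \<Rightarrow> ('a::complex_hilbert_space \<Rightarrow>\<^sub>L 'a)"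
  assumes lim: "\<And>x. ((\<lambda>r. blinfun_apply (T r) x) \<longlongrightarrow> blinfun_apply S x) F"
    and bound: "\<forall>\<^sub>F r in F. norm (T r) \<le> M" and F: "F \<noteq> bot"
  shows "limitin weak_star_topology T S F"
  unfolding weak_star_topology_def
proof (rule limitin_pullback_topology, unfold limitin_canonical_iff, rule tendsto_pointwise, clarify)
  fix x y :: "(nat, 'a) ell2"
  let ?a = "\<lambda>A j. cinner (blinfun_apply A (coord x j)) (coord y j)"
  let ?B = "\<lambda>j. (norm (coord x j))\<^sup>2 + (norm (coord y j))\<^sup>2"
  have B: "summable ?B"
    by (intro summable_on_imp_summable summable_on_add summable_coord)
  have le: "norm (?a A j) \<le> norm A * ?B j" for A j
  proof -
    have "norm (?a A j) \<le> norm (A (coord x j)) * norm (coord y j)" by (rule cauchy_schwarz)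
    also have "\<dots> \<le> (norm A * norm (coord x j)) * norm (coord y j)"
      by (intro mult_right_mono norm_blinfun) simp
    also have "norm (coord x j) * norm (coord y j) \<le> ?B j"
      using sum_squares_bound[of "norm (coord x j)" "norm (coord y j)"]
        mult_nonneg_nonneg[OF norm_ge_zero norm_ge_zero, of "coord x j" "coord y j"] by linarith
    then have "(norm A * norm (coord x j)) * norm (coord y j) \<le> norm A * ?B j"
      by (simp add: mult.assoc mult_left_mono)
    finally show ?thesis .
  qed
  \<comment> \<open>Tannery's theorem concerns ordered series, the topology unconditional sums;
    absolute summability identifies them.\<close>
  have infsum: "(\<Sum>\<^sub>\<infinity>j. ?a A j) = (\<Sum>j. ?a A j)" for A
  proof -
    have "(\<lambda>j. norm A * ?B j) summable_on UNIV"
      by (intro summable_on_cmult_right summable_on_add summable_coord)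
    then have "(\<lambda>j. norm (?a A j)) summable_on UNIV"
      by (rule summable_on_comparison_test) (auto intro: le)
    then have "?a A summable_on UNIV" by (rule abs_summable_summable)
    then show ?thesis using has_sum_imp_sums[OF has_sum_infsum] sums_unique by blast
  qed
  have "((\<lambda>r. \<Sum>j. ?a (T r) j) \<longlongrightarrow> (\<Sum>j. ?a S j)) F"
  proof (rule conjunct2[OF conjunct2[OF tannerys_theorem]])
    show "((\<lambda>r. ?a (T r) j) \<longlongrightarrow> ?a S j) F" for j
      by (intro tendsto_cinner_left lim)
    have "\<forall>\<^sub>F r in F. \<forall>j. norm (?a (T r) j) \<le> M * ?B j"
      using bound
    proof eventually_elim
      case (elim r)
      show ?case
      proof
        fix j
        have "norm (T r) * ?B j \<le> M * ?B j" using elim by (rule mult_right_mono) simp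
        with le[of "T r" j] show "norm (?a (T r) j) \<le> M * ?B j" by linarith
      qed
    qed
    then show "\<forall>\<^sub>F (j, r) in at_top \<times>\<^sub>F F. norm (?a (T r) j) \<le> M * ?B j"
      unfolding eventually_prod_filter
      by (intro exI[of _ "\<lambda>_. True"] exI[of _ "\<lambda>r. \<forall>j. norm (?a (T r) j) \<le> M * ?B j"]) auto
  qed (use B F in \<open>auto intro: summable_mult\<close>)
  then show "((\<lambda>r. \<Sum>\<^sub>\<infinity>j. ?a (T r) j) \<longlongrightarrow> (\<Sum>\<^sub>\<infinity>j. ?a S j)) F"
    by (simp only: infsum)
qed

section \<open>Uniqueness of the coefficients\<close>

lemma scaled_row_in_row_ball:
  fixes Y :: "'n::finite \<Rightarrow> ('h::complex_hilbert_space \<Rightarrow>\<^sub>L 'h)"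
  assumes Y: "\<And>i. Y i \<in> bops"
    and c: "(cmod c)\<^sup>2 * norm (\<Sum>i\<in>UNIV. Y i o\<^sub>L cadj (Y i)) < 1"
  shows "(\<lambda>i. c *\<^sub>C Y i) \<in> row_ball"
  using c unfolding row_ball_def mem_Collect_eq sum_scaleC_row_gram[OF Y]
  by (auto simp: Y norm_scaleC simp del: of_real_power)

text \<open>For a word \<open>\<alpha>\<close> of length \<open>m\<close> and an orthonormal sequence \<open>h\<close>, the partial shifts
  sending \<open>h (j + 1)\<close> to \<open>h j\<close> along the letter \<open>\<alpha> ! j\<close> satisfy \<open>Y\<^sub>\<alpha> (h m) = h 0\<close>, whereas
  \<open>Y\<^sub>\<beta> (h m)\<close> is orthogonal to \<open>h 0\<close> for every other word \<open>\<beta>\<close>.\<close>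

lemma word_separating_row:
  fixes \<alpha> :: "'n list"
  assumes "\<nexists>B :: 'h::complex_hilbert_space set. finite B \<and> span B = UNIV"
  obtains Y :: "'n \<Rightarrow> ('h::complex_hilbert_space \<Rightarrow>\<^sub>L 'h)" and x y where "\<And>i. Y i \<in> bops"
    "\<And>\<beta>. cinner (blinfun_apply (word_op Y \<beta>) x) y = (if \<beta> = \<alpha> then 1 else 0)"
proof -
  obtain h :: "nat \<Rightarrow> 'h" where "inj h" "orthonormal (range h)"
    using exists_orthonormal_sequence[OF assms] by blast
  then have h: "cinner (h j) (h k) = (if j = k then 1 else 0)" for j k
    by (auto simp: orthonormal_def inj_eq)
  define m where "m = length \<alpha>"
  define Y where "Y i = Blinfun (\<lambda>x. \<Sum>j<m. if \<alpha> ! j = i then cinner x (h (Suc j)) *\<^sub>C h j else 0)" for i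
  have bl: "bounded_linear (\<lambda>x. if b then cinner x u *\<^sub>C v else 0)" for b and u v :: 'h
  proof (cases b)
    case True
    have "bounded_linear (\<lambda>x. cinner x u *\<^sub>C v)"
      by (rule bounded_linear_intro[where K = "norm u * norm v"])
        (auto simp: cinner_add_left scaleC_add_left cinner_scaleR_left scaleR_scaleC scaleC_scaleC
          cinner_scaleC_left norm_scaleC scaleR_conv_of_real mult.assoc[symmetric] cauchy_schwarz mult_right_mono)
    with True show ?thesis by simp
  qed simp
  have Y: "Y i x = (\<Sum>j<m. if \<alpha> ! j = i then cinner x (h (Suc j)) *\<^sub>C h j else 0)" for i x
    unfolding Y_def by (rule bounded_linear_Blinfun_apply[THEN fun_cong]) (intro bounded_linear_sum bl)
  have Yb: "Y i \<in> bops" for i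
    by (rule bopsI) (auto simp: Y scaleC_sum_right cinner_scaleC_left scaleC_scaleC intro!: sum.cong)
  \<comment> \<open>Since \<open>h 0\<close> is annihilated, every word longer than \<open>m\<close>
    sends \<open>h m\<close> to 0.\<close>
  have Y0: "Y i (h 0) = 0" for i
    unfolding Y by (rule sum.neutral) (simp add: h)
  have Y_Suc: "Y i (h (Suc l)) = (if \<alpha> ! l = i then h l else 0)" if "l < m" for i l
  proof -
    have "Y i (h (Suc l)) = (\<Sum>j<m. if j = l then (if \<alpha> ! l = i then h l else 0) else 0)"
      unfolding Y by (intro sum.cong) (auto simp: h)
    then show ?thesis using that by simp
  qed
  \<comment> \<open>The rightmost letter acts first: a word equal to a suffix of
    \<open>\<alpha>\<close> moves \<open>h m\<close> down by its length, and a mismatch gives 0 for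
    good.\<close>
  have word: "word_op Y \<beta> (h m)
      = (if length \<beta> \<le> m \<and> \<beta> = drop (m - length \<beta>) \<alpha> then h (m - length \<beta>) else 0)" for \<beta>
  proof (induction \<beta>)
    case Nil
    show ?case by (simp add: m_def)
  next
    case (Cons i \<beta>)
    show ?case
    proof (cases "length \<beta> < m")
      case True
      define l where "l = m - Suc (length \<beta>)"
      have l: "m - length \<beta> = Suc l" "l < m" "m - length (i # \<beta>) = l"
        using True by (auto simp: l_def)
      have dl: "drop l \<alpha> = \<alpha> ! l # drop (Suc l) \<alpha>"
        using l(2) by (simp add: m_def Cons_nth_drop_Suc)
      have IH: "word_op Y \<beta> (h m) = (if \<beta> = drop (Suc l) \<alpha> then h (Suc l) else 0)"
        unfolding Cons.IH l(1) using True by simp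
      have "word_op Y (i # \<beta>) (h m) = Y i (word_op Y \<beta> (h m))" by simp
      also have "\<dots> = (if i # \<beta> = drop l \<alpha> then h l else 0)"
        unfolding IH dl using l(2) by (auto simp: Y_Suc)
      finally show ?thesis unfolding l(3) using True by simp
    next
      case False
      \<comment> \<open>Truncated subtraction: after \<open>m\<close> or more letters the vector
        reached is \<open>h 0\<close> or 0, and both are annihilated.\<close>
      then have z: "m - length \<beta> = 0" by simp
      have "Y i (word_op Y \<beta> (h m)) = 0" unfolding Cons.IH z by (simp add: Y0)
      then show ?thesis using False by simp
    qed
  qed
  have "cinner (word_op Y \<beta> (h m)) (h 0) = (if \<beta> = \<alpha> then 1 else 0)" for \<beta>
  proof (cases "length \<beta> = m")
    case True
    then have "m - length \<beta> = 0" by simp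
    with True show ?thesis unfolding word by (simp add: h) (simp add: m_def)
  next
    case False
    then show ?thesis unfolding word by (auto simp: h m_def)
  qed
  then show ?thesis using Yb by (intro that[of Y "h m" "h 0"]) auto
qed

text \<open>Once the lower coefficients vanish, dividing by \<open>z ^ k\<close> leaves a series
  that sums to 0 off the origin and whose limit at the origin is \<open>B k\<close>.\<close>

lemma power_series_zero_imp_coeff_zero:
  fixes B :: "nat \<Rightarrow> complex"
  assumes "\<And>z. cmod z < 1 \<Longrightarrow> (\<lambda>k. B k * z ^ k) sums 0"
  shows "B k = 0"
proof (induction k rule: less_induct)
  case (less k)
  have "(\<lambda>j. B (j + k) * z ^ j) sums 0" if z: "z \<noteq> 0" "cmod z < 1" for z
  proof -
    have "(\<lambda>j. B (j + k) * z ^ (j + k)) sums (0 - (\<Sum>j<k. B j * z ^ j))"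
      by (rule sums_split_initial_segment[OF assms[OF z(2)]])
    moreover have "(\<Sum>j<k. B j * z ^ j) = 0" by (rule sum.neutral) (simp add: less)
    ultimately have "(\<lambda>j. B (j + k) * z ^ (j + k)) sums 0" by simp
    then have "(\<lambda>j. (B (j + k) * z ^ (j + k)) / z ^ k) sums (0 / z ^ k)" by (rule sums_divide)
    then show ?thesis using z by (simp add: power_add)
  qed
  then have "((\<lambda>_. 0) \<longlongrightarrow> B (0 + k)) (at (0::complex))"
    by (rule powser_limit_0_strong[of 1, OF zero_less_one])
  then show ?case by (simp add: tendsto_const_iff)
qed

text \<open>Here \<open>b\<close> will be the difference of two coefficient families. The hypothesis
  concerns matrix entries, the sense in which the series of \<open>P[f]\<close> has been shown to
  converge.\<close>

lemma coefficients_unique: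
  fixes b :: "'n::finite list \<Rightarrow> complex"
  assumes H: "(\<nexists>B :: 'h::complex_hilbert_space set. finite B \<and> span B = UNIV)
      \<or> (CARD('n) = 1 \<and> (\<exists>h::'h::complex_hilbert_space. h \<noteq> 0))"
    and b: "\<And>X (x::'h::complex_hilbert_space) y. X \<in> row_ball \<Longrightarrow>
      (\<lambda>k. \<Sum>\<alpha> | length \<alpha> = k. b \<alpha> * cinner (blinfun_apply (word_op X \<alpha>) x) y) sums 0"
  shows "b \<alpha> = 0"
  using H
proof (elim disjE conjE exE)
  assume "\<nexists>B :: 'h set. finite B \<and> span B = UNIV"
  then obtain Y :: "'n \<Rightarrow> ('h \<Rightarrow>\<^sub>L 'h)" and x y where Y: "\<And>i. Y i \<in> bops"
      "\<And>\<beta>. cinner (blinfun_apply (word_op Y \<beta>) x) y = (if \<beta> = \<alpha> then 1 else 0)"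
    using word_separating_row[of \<alpha>] by blast
  define N where "N = norm (\<Sum>i\<in>UNIV. Y i o\<^sub>L cadj (Y i))"
  \<comment> \<open>The separating row is only bounded; \<open>t \<le> 1\<close> and
    \<open>t * N < 1\<close> bring its multiple by \<open>t\<close> into the ball. Scaling
    multiplies the separated coefficient by a nonzero power of \<open>t\<close>.\<close>
  define t where "t = 1 / (1 + N)"
  have "0 \<le> N" by (simp add: N_def)
  then have t: "0 < t" "t \<le> 1" "t * N < 1" by (auto simp: t_def field_simps)
  have "t * (t * N) \<le> 1 * (t * N)" using t \<open>0 \<le> N\<close> by (intro mult_right_mono) auto
  then have "t * (t * N) < 1" using t(3) by linarith
  then have "(cmod (complex_of_real t))\<^sup>2 * N < 1"
    using t(1) by (simp add: power2_eq_square mult.assoc)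
  then have "(\<lambda>i. complex_of_real t *\<^sub>C Y i) \<in> row_ball"
    unfolding N_def by (rule scaled_row_in_row_ball[OF Y(1)])
  from b[OF this, of x y]
  have "(\<lambda>k. \<Sum>\<beta> | length \<beta> = k. b \<beta> * (complex_of_real t ^ length \<beta> * (if \<beta> = \<alpha> then 1 else 0))) sums 0"
    by (simp only: word_op_scaleC[OF Y(1)] scaleC_blinfun.rep_eq cinner_scaleC_left Y(2))
  moreover have "(\<Sum>\<beta> | length \<beta> = k. b \<beta> * (complex_of_real t ^ length \<beta> * (if \<beta> = \<alpha> then 1 else 0)))
      = (if k = length \<alpha> then b \<alpha> * complex_of_real t ^ length \<alpha> else 0)" for k
  proof -
    have "(\<Sum>\<beta> | length \<beta> = k. b \<beta> * (complex_of_real t ^ length \<beta> * (if \<beta> = \<alpha> then 1 else 0)))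
        = (\<Sum>\<beta> | length \<beta> = k. if \<beta> = \<alpha> then b \<alpha> * complex_of_real t ^ length \<alpha> else 0)"
      by (intro sum.cong) auto
    then show ?thesis by (simp add: finite_words)
  qed
  ultimately have "(\<lambda>k. if k = length \<alpha> then b \<alpha> * complex_of_real t ^ length \<alpha> else 0) sums 0" by simp
  then have "b \<alpha> * complex_of_real t ^ length \<alpha> = 0"
    using sums_single[of "length \<alpha>" "\<lambda>_. b \<alpha> * complex_of_real t ^ length \<alpha>"] by (metis sums_unique2)
  then show ?thesis using t by simp
next
  fix h :: 'h
  assume card: "CARD('n) = 1" and h: "h \<noteq> 0"
  then obtain i where i: "(UNIV :: 'n set) = {i}" using card_1_singletonE by blast
  have rep: "xs = replicate (length xs) i" for xs :: "'n list"
    by (rule replicate_eqI) (use i in auto)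
  then have words: "{\<beta> :: 'n list. length \<beta> = k} = {replicate k i}" for k by auto
  define B where "B k = b (replicate k i) * cinner h h" for k
  \<comment> \<open>With one generator the row \<open>z I\<close> sends the word of length
    \<open>k\<close> to \<open>z ^ k\<close> times the identity, so the hypothesis becomes a scalar
    power series on the unit disc.\<close>
  have "(\<lambda>k. B k * z ^ k) sums 0" if z: "cmod z < 1" for z
  proof -
    let ?I = "\<lambda>_ :: 'n. id_blinfun :: 'h \<Rightarrow>\<^sub>L 'h"
    have id: "id_blinfun o\<^sub>L id_blinfun = (id_blinfun :: 'h \<Rightarrow>\<^sub>L 'h)" by (rule blinfun_eqI) simp
    have "(cmod z)\<^sup>2 * norm (\<Sum>j\<in>UNIV. ?I j o\<^sub>L cadj (?I j)) \<le> (cmod z)\<^sup>2 * 1"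
      using norm_blinfun_id_le[where 'a = 'h]
      by (intro mult_left_mono) (simp_all add: i id)
    also have "\<dots> < 1" using z by (simp add: power_less_one_iff abs_square_less_1)
    finally have "(\<lambda>j. z *\<^sub>C ?I j) \<in> row_ball" by (intro scaled_row_in_row_ball) auto
    moreover have "word_op ?I \<beta> = id_blinfun" for \<beta>
      by (induction \<beta>) (auto simp: id)
    ultimately show ?thesis
      using b[of "\<lambda>j. z *\<^sub>C ?I j" h h]
      by (simp add: word_op_scaleC words scaleC_blinfun.rep_eq cinner_scaleC_left B_def mult_ac)
  qed
  then have "B (length \<alpha>) = 0" by (rule power_series_zero_imp_coeff_zero)
  then show ?thesis using h by (simp add: B_def flip: rep)
qed

section \<open>Poisson representation of free holomorphic functions\<close>

lemma weak_sums_of_sums: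
  assumes "(\<lambda>k. \<Sum>\<alpha> | length \<alpha> = k. a \<alpha> *\<^sub>C word_op X \<alpha>) sums T"
  shows "(\<lambda>k. \<Sum>\<alpha> | length \<alpha> = k. a \<alpha> * cinner (blinfun_apply (word_op X \<alpha>) x) y)
    sums cinner (blinfun_apply T x) y"
proof -
  have "bounded_linear (\<lambda>S. cinner (blinfun_apply S x) y)"
    by (intro bounded_linear_compose[OF bounded_linear_cinner_left] blinfun.bounded_linear_left)
  from bounded_linear.sums[OF this assms] show ?thesis
    by (simp add: blinfun.sum_left cinner_sum_left scaleC_blinfun.rep_eq cinner_scaleC_left)
qed

lemma poisson_Lmult_iff_coefficients:
  fixes u :: "('n::finite \<Rightarrow> ('h::complex_hilbert_space \<Rightarrow>\<^sub>L 'h)) \<Rightarrow> ('h \<Rightarrow>\<^sub>L 'h)"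
  assumes H: "(\<nexists>B :: 'h set. finite B \<and> span B = UNIV) \<or> (CARD('n) = 1 \<and> (\<exists>h::'h. h \<noteq> 0))"
    and u: "free_holomorphic a u" and f: "f \<in> F_infty"
  shows "(\<forall>X\<in>row_ball. u X = poisson (Lmult f) X) \<longleftrightarrow> coord f = a"
proof
  note P = poisson_Lmult_weak_sums[OF _ f]
  have U: "(\<lambda>k. \<Sum>\<alpha> | length \<alpha> = k. a \<alpha> * cinner (blinfun_apply (word_op X \<alpha>) x) y)
      sums cinner (blinfun_apply (u X) x) y" if "X \<in> row_ball" for X x y
    using u that by (intro weak_sums_of_sums) (simp add: free_holomorphic_def)
  show "\<forall>X\<in>row_ball. u X = poisson (Lmult f) X" if "coord f = a"
  proof
    fix X :: "'n \<Rightarrow> ('h \<Rightarrow>\<^sub>L 'h)" assume X: "X \<in> row_ball"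
    show "u X = poisson (Lmult f) X"
      by (rule blinfun_eqI, rule cinner_ext)
        (rule sums_unique2[OF U[OF X] P[OF X, unfolded that]])
  qed
  show "coord f = a" if eq: "\<forall>X\<in>row_ball. u X = poisson (Lmult f) X"
  proof
    fix \<alpha>
    have "coord f \<alpha> - a \<alpha> = 0"
    proof (rule coefficients_unique[OF H])
      fix X :: "'n \<Rightarrow> ('h \<Rightarrow>\<^sub>L 'h)" and x y assume X: "X \<in> row_ball"
      show "(\<lambda>k. \<Sum>\<alpha> | length \<alpha> = k. (coord f \<alpha> - a \<alpha>) * cinner (blinfun_apply (word_op X \<alpha>) x) y) sums 0"
        using sums_diff[OF P[OF X, of x y] U[OF X, of x y]] eq X
        by (simp add: left_diff_distrib sum_subtractf)
    qed
    then show "coord f \<alpha> = a \<alpha>" by simp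
  qed
qed

theorem theorem6p1:
  fixes u :: "('n::finite \<Rightarrow> ('h::complex_hilbert_space \<Rightarrow>\<^sub>L 'h)) \<Rightarrow> ('h \<Rightarrow>\<^sub>L 'h)"
    and a :: "'n list \<Rightarrow> complex"
  assumes "(\<nexists>B :: 'h set. finite B \<and> span B = UNIV) \<or> (CARD('n) = 1 \<and> (\<exists>h::'h. h \<noteq> 0))"
    and "free_holomorphic a u"
  shows
    "((\<exists>f\<in>F_infty. \<forall>X\<in>row_ball. u X = poisson (Lmult f) X)
        \<longleftrightarrow> (SUP r\<in>{0..<1}. ereal (norm (radial a r))) < \<infinity>)
     \<and> (\<forall>f\<in>F_infty. (\<forall>X\<in>row_ball. u X = poisson (Lmult f) X) \<longrightarrow>
          limitin weak_star_topology (radial a) (Lmult f) (at_left 1)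
          \<and> limitin strong_operator_topology (radial a) (Lmult f) (at_left 1))
     \<and> ((\<exists>f\<in>disc_algebra. \<forall>X\<in>row_ball. u X = poisson (Lmult f) X)
        \<longleftrightarrow> (\<exists>T. (radial a \<longlongrightarrow> T) (at_left 1)))
     \<and> (\<forall>f\<in>disc_algebra. (\<forall>X\<in>row_ball. u X = poisson (Lmult f) X) \<longrightarrow>
          (radial a \<longlongrightarrow> Lmult f) (at_left 1))"
proof -
  note rep = poisson_Lmult_iff_coefficients[OF assms]
  have growth: "limsup (\<lambda>k. ereal (root (2 * k) (\<Sum>\<alpha> | length \<alpha> = k. (cmod (a \<alpha>))\<^sup>2))) \<le> 1"
    using assms(2) by (simp add: free_holomorphic_def)
  have disc_F: "f \<in> F_infty" if "f \<in> disc_algebra" for f :: "'n fock"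
    using that by (simp add: disc_algebra_def)
  have radial: "radial a r = Lmult (dil r f)"
    if "f \<in> F_infty" "coord f = a" "0 \<le> r" "r < 1" for f r
    using radial_coord[of f r] growth that by simp
  have ev_radial: "\<forall>\<^sub>F r in at_left 1. Lmult (dil r f) = radial a r" if "f \<in> F_infty" "coord f = a" for f
    using eventually_at_left_1 by eventually_elim (simp add: radial[OF that])
  have bounded: "norm (radial a r) \<le> norm (Lmult f)"
    if "f \<in> F_infty" "coord f = a" "0 \<le> r" "r < 1" for f r
    unfolding radial[OF that] using that(1,3,4) by (rule dil_F_infty)
  have strong: "((\<lambda>r. radial a r g) \<longlongrightarrow> Lmult f g) (at_left 1)" if "f \<in> F_infty" "coord f = a" for f g
    using tendsto_Lmult_dil[OF that(1)] by (rule Lim_transform_eventually)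
      (use ev_radial[OF that] in \<open>auto elim: eventually_mono\<close>)
  have i: "(\<exists>f\<in>F_infty. coord f = a) \<longleftrightarrow> (SUP r\<in>{0..<1}. ereal (norm (radial a r))) < \<infinity>"
  proof
    assume "\<exists>f\<in>F_infty. coord f = a"
    then obtain f where f: "f \<in> F_infty" "coord f = a" by blast
    have "(SUP r\<in>{0..<1}. ereal (norm (radial a r))) \<le> ereal (norm (Lmult f))"
      by (intro SUP_least) (simp add: bounded[OF f])
    then show "(SUP r\<in>{0..<1}. ereal (norm (radial a r))) < \<infinity>" by (rule le_less_trans) simp
  next
    assume sup: "(SUP r\<in>{0..<1}. ereal (norm (radial a r))) < \<infinity>"
    then obtain M where M: "(SUP r\<in>{0..<1}. ereal (norm (radial a r))) < ereal M"
      using less_PInf_Ex_of_nat by auto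
    have "norm (radial a r) \<le> M" if "0 \<le> r \<and> r < 1" for r
    proof -
      have "ereal (norm (radial a r)) \<le> (SUP r\<in>{0..<1}. ereal (norm (radial a r)))"
        using that by (intro SUP_upper) simp
      also have "\<dots> < ereal M" by (rule M)
      finally show ?thesis by simp
    qed
    then have "\<forall>\<^sub>F r in at_left 1. norm (radial a r) \<le> M"
      by (rule eventually_mono[OF eventually_at_left_1])
    then show "\<exists>f\<in>F_infty. coord f = a" using bounded_radial_imp_F_infty[OF growth] by metis
  qed
  have ii: "(\<exists>f\<in>disc_algebra. coord f = a) \<longleftrightarrow> (\<exists>T. (radial a \<longlongrightarrow> T) (at_left 1))"
  proof
    assume "\<exists>T. (radial a \<longlongrightarrow> T) (at_left 1)"
    then obtain T where T: "(radial a \<longlongrightarrow> T) (at_left 1)" by blast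
    \<comment> \<open>Norm convergence bounds the family near 1, which supplies a symbol
      \<open>f\<close>; its multiplier must be \<open>T\<close>, because a norm limit is also the
      strong limit.\<close>
    have "\<forall>\<^sub>F r in at_left 1. norm (radial a r) < norm T + 1"
      by (rule order_tendstoD(2)[OF tendsto_norm[OF T]]) simp
    then have "\<forall>\<^sub>F r in at_left 1. norm (radial a r) \<le> norm T + 1"
      by (rule eventually_mono) simp
    then obtain f where f: "f \<in> F_infty" "coord f = a"
      using bounded_radial_imp_F_infty[OF growth] by metis
    have "T = Lmult f"
    proof (rule blinfun_eqI)
      show "T g = Lmult f g" for g
        by (rule tendsto_unique[OF trivial_limit_at_left_real _ strong[OF f]]) (intro tendsto_intros T)
    qed
    \<comment> \<open>Each \<open>radial a r\<close> with \<open>r < 1\<close> is itself a norm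
      limit of polynomials in the creation operators.\<close>
    moreover have "T \<in> disc_algebra_ops"
    proof (rule Lim_in_closed_set[OF closed_disc_algebra_ops _ trivial_limit_at_left_real T])
      show "\<forall>\<^sub>F r in at_left 1. radial a r \<in> disc_algebra_ops"
        using eventually_at_left_1 by eventually_elim (simp add: radial_in_disc_algebra_ops[OF growth])
    qed
    ultimately have "f \<in> disc_algebra" using f(1) by (simp add: disc_algebra_def)
    then show "\<exists>f\<in>disc_algebra. coord f = a" using f(2) by blast
  next
    assume "\<exists>f\<in>disc_algebra. coord f = a"
    then show "\<exists>T. (radial a \<longlongrightarrow> T) (at_left 1)"
      using Lim_transform_eventually[OF disc_algebra_tendsto ev_radial] disc_F by blast
  qed
  have i': "limitin weak_star_topology (radial a) (Lmult f) (at_left 1)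
      \<and> limitin strong_operator_topology (radial a) (Lmult f) (at_left 1)"
    if f: "f \<in> F_infty" "coord f = a" for f
  proof
    have "\<forall>\<^sub>F r in at_left 1. norm (radial a r) \<le> norm (Lmult f)"
      using eventually_at_left_1 by eventually_elim (simp add: bounded[OF f])
    then show "limitin weak_star_topology (radial a) (Lmult f) (at_left 1)"
      by (intro limitin_weak_star_topology strong f) auto
    show "limitin strong_operator_topology (radial a) (Lmult f) (at_left 1)"
      by (intro limitin_strong_operator_topology strong f)
  qed
  have ii': "(radial a \<longlongrightarrow> Lmult f) (at_left 1)" if "f \<in> disc_algebra" "coord f = a" for f
    using Lim_transform_eventually[OF disc_algebra_tendsto ev_radial] that disc_F by blast
  have "(\<exists>f\<in>F_infty. \<forall>X\<in>row_ball. u X = poisson (Lmult f) X) \<longleftrightarrow> (\<exists>f\<in>F_infty. coord f = a)"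
    "(\<exists>f\<in>disc_algebra. \<forall>X\<in>row_ball. u X = poisson (Lmult f) X) \<longleftrightarrow> (\<exists>f\<in>disc_algebra. coord f = a)"
    using rep disc_F by blast+
  note reps = this
  show ?thesis
  proof (intro conjI ballI impI)
    show "(\<exists>f\<in>F_infty. \<forall>X\<in>row_ball. u X = poisson (Lmult f) X)
        \<longleftrightarrow> (SUP r\<in>{0..<1}. ereal (norm (radial a r))) < \<infinity>"
      unfolding reps(1) by (rule i)
    show "(\<exists>f\<in>disc_algebra. \<forall>X\<in>row_ball. u X = poisson (Lmult f) X)
        \<longleftrightarrow> (\<exists>T. (radial a \<longlongrightarrow> T) (at_left 1))"
      unfolding reps(2) by (rule ii)
  next
    fix f assume f: "f \<in> F_infty" "\<forall>X\<in>row_ball. u X = poisson (Lmult f) X"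
    then have "coord f = a" using rep by blast
    from i'[OF f(1) this]
    show "limitin weak_star_topology (radial a) (Lmult f) (at_left 1)"
      "limitin strong_operator_topology (radial a) (Lmult f) (at_left 1)" by blast+
  next
    fix f assume f: "f \<in> disc_algebra" "\<forall>X\<in>row_ball. u X = poisson (Lmult f) X"
    then have "coord f = a" using rep disc_F by blast
    with f(1) show "(radial a \<longlongrightarrow> Lmult f) (at_left 1)" by (rule ii')
  qed
qed

end
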